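(* Let $K\subset\mathbb{R}^d$ be a compact set of positive Lebesgue measure, and let $M=\{M(x)=(M_1(x),\ldots,M_D(x)),\ x\in\mathbb{R}^d\}$ be a Gaussian stochastic process with continuous sample paths and i.i.d. components. Write $\sigma_x^2=\mathrm{Var}(M_1(x))$, $\rho_{x,\bar x}=\mathrm{Corr}(M_1(x),M_1(\bar x))$, $f(x)=E(M(x))$, $\tilde M(x)=M(x)-f(x)$. Assume: 1. There exist positive constants $c_1,c_2$ such that $c_1\le\sigma_x^2\le c_2$ for all $x\in K$. 2. $\rho_{x,\bar x}<1$ for all $x,\bar x\in K$ with $x\ne\bar x$. 3. There exist $\eta>0$ and $c_3>0$ such that $|\sigma_x^2-\sigma_{\bar x}^2|\le c_3\,\|M_1(x)-M_1(\bar x)\|_{L^2(\Omega)}^{1+\eta}$ for all $x,\bar x\in K$. 4. There exist a gauge function $q$ and a constant $C_0$ such that for all $x,\bar x\in K$, $\|\tilde M_1(x)-\tilde M_1(\bar x)\|_{L^2(\Omega)}\asymp q(|x-\bar x|)$ and $|f(x)-f(\bar x)|\le C_0\,q(|x-\bar x|)$. 5. With $v_q(\tau)=\int_{q^{-1}(\tau)}^{\mathrm{diam}(K)}[q(\rho)]^{-D}\rho^{d-1}\,d\rho$ and $g_q(\tau)=\tau^D/(q^{-1}(\tau))^d$, $$\sup_{\tau\in(0,\mathrm{diam}(K)]}v_q(\tau)\,g_q(\tau)\in(0,\infty).$$ Fix $N>0$ and let $A\subset B_N(0)\subset\mathbb{R}^D$ be a Borel set. Then there exists a constant $C=C(f,K,N,d,D)>0$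 (not depending on $A$) such that $$P\{M(K)\cap A\neq\emptyset\}\ge C\ \mathrm{Cap}_{(g_q)^{-1}}(A).$$
   Context: A gauge function is a strictly increasing continuous function $q$ defined on an interval $[0,r)\subset\mathbb{R}_+$, with values in $\mathbb{R}_+=[0,\infty)$ and $q(0)=0$. It is understood that $q$ is regarded as defined on $\mathbb{R}_+$ and onto $\mathbb{R}_+$ (if initially given only on a bounded interval containing $[0,\mathrm{diam}(K)]$, it is extended as a strictly increasing continuous function), so that $q^{-1}$ and $g_q$ are defined on $\mathbb{R}_+$. The symbol $\asymp$ means equivalence up to positive multiplicative constants, uniform in the variables. $B_N(0)$ is the open Euclidean ball. The constant $C$ may also depend on $q$ and the constants in the hypotheses. For a kernel $\mathfrak{g}:\mathbb{R}^D\to[0,\infty]$ and a Borel set $A\subset\mathbb{R}^D$, $$\mathrm{Cap}_{\mathfrak{g}}(A)=\left[\inf_{\mu\in\mathbb{P}(A)}\int_{\mathbb{R}^D\times\mathbb{R}^D}\mathfrak{g}(y-\bar y)\,\mu(dy)\mu(d\bar y)\right]^{-1},$$ where $\mathbb{P}(A)$ is the set of probability measures on $A$ (with $\inf\emptyset=\infty$, $1/\infty=0$). $\mathrm{Cap}_{(g_q)^{-1}}$ denotes the capacity for the kernel $\mathfrak{g}(z)=1/g_q(|z|)$ (reciprocal), with $\mathfrak{g}(0)=\lim_{\tau\downarrow0}1/g_q(\tau)$. *)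

theory Defs
  imports "HOL-Probability.Probability"
begin

definition var :: "'w measure \<Rightarrow> ('w \<Rightarrow> real) \<Rightarrow> real" where
  "var P X = (LINT \<omega>|P. (X \<omega> - (LINT \<omega>'|P. X \<omega>'))\<^sup>2)"

definition cov :: "'w measure \<Rightarrow> ('w \<Rightarrow> real) \<Rightarrow> ('w \<Rightarrow> real) \<Rightarrow> real" where
  "cov P X Y = (LINT \<omega>|P. (X \<omega> - (LINT \<omega>'|P. X \<omega>')) * (Y \<omega> - (LINT \<omega>'|P. Y \<omega>')))"

definition corr :: "'w measure \<Rightarrow> ('w \<Rightarrow> real) \<Rightarrow> ('w \<Rightarrow> real) \<Rightarrow> real" where
  "corr P X Y = cov P X Y / sqrt (var P X * var P Y)"

definition L2norm :: "'w measure \<Rightarrow> ('w \<Rightarrow> real) \<Rightarrow> real" where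
  "L2norm P X = sqrt (LINT \<omega>|P. (X \<omega>)\<^sup>2)"

text \<open>Degenerate (almost surely constant) variables count as Gaussian.\<close>

definition gaussian_var :: "'w measure \<Rightarrow> ('w \<Rightarrow> real) \<Rightarrow> bool" where
  "gaussian_var P X \<longleftrightarrow> X \<in> borel_measurable P \<and>
     ((\<exists>m s. 0 < s \<and> distributed P lborel X (normal_density m s)) \<or>
      (\<exists>m. AE \<omega> in P. X \<omega> = m))"

definition gaussian_process :: "'w measure \<Rightarrow> ('i \<Rightarrow> 'w \<Rightarrow> 'a::euclidean_space) \<Rightarrow> bool" where
  "gaussian_process P X \<longleftrightarrow> (\<forall>x. X x \<in> borel_measurable P) \<and>
     (\<forall>F a. finite F \<longrightarrow> gaussian_var P (\<lambda>\<omega>. \<Sum>x\<in>F. a x \<bullet> X x \<omega>))"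

text \<open>The components are compared as processes, that is, as random elements of the space of
  all functions on the index set with the product sigma-algebra.\<close>

definition iid_components :: "'w measure \<Rightarrow> ('i \<Rightarrow> 'w \<Rightarrow> real ^ 'n) \<Rightarrow> bool" where
  "iid_components P X \<longleftrightarrow>
     prob_space.indep_vars P (\<lambda>_. \<Pi>\<^sub>M x\<in>UNIV. borel) (\<lambda>j \<omega> x. X x \<omega> $ j) UNIV \<and>
     (\<forall>j k. distr P (\<Pi>\<^sub>M x\<in>UNIV. borel) (\<lambda>\<omega> x. X x \<omega> $ j) =
            distr P (\<Pi>\<^sub>M x\<in>UNIV. borel) (\<lambda>\<omega> x. X x \<omega> $ k))"

text \<open>Only the values on the half-line \<open>{0..}\<close> matter; a gauge given on a bounded interval is
  understood to be already extended to an increasing bijection of the half-line.\<close>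

definition gauge_function :: "(real \<Rightarrow> real) \<Rightarrow> bool" where
  "gauge_function q \<longleftrightarrow> q 0 = 0 \<and> strict_mono_on {0..} q \<and> continuous_on {0..} q \<and>
     q ` {0..} = {0..}"

definition gauge_inv :: "(real \<Rightarrow> real) \<Rightarrow> real \<Rightarrow> real" where
  "gauge_inv q = inv_into {0..} q"

text \<open>The integral is oriented: it is nonpositive when the lower limit exceeds \<open>R\<close>.\<close>

definition gauge_v :: "(real \<Rightarrow> real) \<Rightarrow> nat \<Rightarrow> nat \<Rightarrow> real \<Rightarrow> real \<Rightarrow> real" where
  "gauge_v q d D R \<tau> = (LBINT \<rho>=gauge_inv q \<tau>..R. inverse (q \<rho> ^ D) * \<rho> ^ (d - 1))"

definition gauge_g :: "(real \<Rightarrow> real) \<Rightarrow> nat \<Rightarrow> nat \<Rightarrow> real \<Rightarrow> real" where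
  "gauge_g q d D \<tau> = \<tau> ^ D / gauge_inv q \<tau> ^ d"

text \<open>When \<open>gauge_v * gauge_g\<close> is bounded, the limit at 0 exists and is \<open>\<infinity>\<close>; otherwise it may
  fail to exist and \<open>Lim\<close> is unspecified.\<close>

definition recip_gauge_kernel :: "(real \<Rightarrow> real) \<Rightarrow> nat \<Rightarrow> real ^ 'n \<Rightarrow> ennreal" where
  "recip_gauge_kernel q d z =
     (if z = 0 then Lim (at_right 0) (\<lambda>\<tau>. ennreal (1 / gauge_g q d CARD('n) \<tau>))
      else ennreal (1 / gauge_g q d CARD('n) (norm z)))"

definition prob_measures_on :: "'a::topological_space set \<Rightarrow> 'a measure set" where
  "prob_measures_on A = {\<mu>. prob_space \<mu> \<and> sets \<mu> = sets borel \<and> emeasure \<mu> A = 1}"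

text \<open>In \<open>ennreal\<close>, the infimum of the empty set is \<open>\<infinity>\<close> and \<open>inverse \<infinity> = 0\<close>.\<close>

definition Cap :: "('a::euclidean_space \<Rightarrow> ennreal) \<Rightarrow> 'a set \<Rightarrow> ennreal" where
  "Cap g A = inverse (INF \<mu>\<in>prob_measures_on A.
     \<integral>\<^sup>+p. g (fst p - snd p) \<partial>(\<mu> \<Otimes>\<^sub>M \<mu>))"

text \<open>For a process with continuous paths, a compact \<open>K\<close> and a Borel set \<open>A\<close>, this set is a
  projection of a measurable set. It belongs to the completion of the probability measure but
  in general not to its sigma-algebra, so its probability is taken in the completion.\<close>

definition hitting_event ::
    "'w measure \<Rightarrow> ('i \<Rightarrow> 'w \<Rightarrow> 'a) \<Rightarrow> 'i set \<Rightarrow> 'a set \<Rightarrow> 'w set" where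
  "hitting_event P X K A = {\<omega> \<in> space P. (\<lambda>x. X x \<omega>) ` K \<inter> A \<noteq> {}}"

end

theory Submission
  imports Defs
begin

text \<open>
  For a probability measure \<open>\<mu>\<close> on a compact part of \<open>A\<close>, put
  \<open>J = \<integral>\<mu>(dz) \<integral>\<^sub>K dx 1{|M(x) - z| < \<epsilon>}\<close>. If \<open>J > 0\<close> then \<open>M(K)\<close> comes within distance of order
  \<open>\<epsilon>\<close> of \<open>A\<close>, and \<open>P(J > 0) \<ge> (E J)^2 / E J^2\<close>. The second moment is controlled by the two-point
  probabilities, which are at most \<open>C \<epsilon>^{2D} min(q(|x - y|)^{-D}, |z - z'|^{-D})\<close>; in polar
  coordinates the integral of this over \<open>x, y\<close> is of order \<open>1 / g_q(|z - z'|)\<close> by the hypothesis on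
  \<open>v_q g_q\<close>. Letting \<open>\<epsilon>\<close> tend to \<open>0\<close> gives the claim. All this is done on a small piece of \<open>K\<close>,
  where the hypothesis on variances forces, with constants that do not depend on the process, that
  in the regression of \<open>M(y)\<close> on \<open>M(x)\<close> the residual has standard deviation of order
  \<open>q(|x - y|)\<close> and the coefficient differs from \<open>1\<close> by at most that order.

  The event of hitting a Borel set is a projection; that it belongs to the completion follows from
  Choquet's capacitability argument.
\<close>

section \<open>Measurability of hitting events\<close>

text \<open>One constant must serve every \<open>\<epsilon>\<close>, although the effective standard
  deviation \<open>S\<close> contains \<open>\<epsilon>\<close> and has no upper bound in terms of
  \<open>q(|x - y|)\<close>. Hence two bounds per component: the probability is at most
  \<open>H \<epsilon>^2 / S\<close>, and after multiplication by \<open>|z_j - z'_j|^D\<close> at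
  most \<open>H \<epsilon>^2 S^D / S\<close>. The full power \<open>D\<close> sits on one component,
  the one with the largest difference; it pays for the whole product, and \<open>S\<close> cancels.
  The exponent \<open>1 + \<eta> > 1\<close> makes variance differences of smaller order than
  \<open>q(|x - y|)\<close>, so below a scale fixed by the constants they cannot spoil the residual
  variance. This is what the small piece of \<open>K\<close> is for. The hypothesis on
  \<open>v_q g_q\<close> covers \<open>\<tau>\<close> up to \<open>diam(K)\<close>, but
  \<open>|z - z'|\<close> may reach \<open>2 N\<close>; it is extended at the price of a constant.
  At \<open>z = z'\<close> an infinite kernel is required, which follows from the same hypothesis.
  The compact part of \<open>A\<close> is chosen with mass at least \<open>1 / 2\<close>, which
  causes the 4 in the denominator of \<open>C\<close>.\<close>

definition analytic_set :: "'a::topological_space set \<Rightarrow> bool" where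
  "analytic_set A \<longleftrightarrow> (\<exists>S :: ('a \<times> (nat \<Rightarrow> nat)) set. closed S \<and> A = fst ` S)"

lemma continuous_on_snd_coordinate:
  "continuous_on UNIV (\<lambda>p :: 'a::topological_space \<times> ('i \<Rightarrow> 'b::topological_space). snd p i)"
  using continuous_on_compose2[OF continuous_on_product_coordinates, of UNIV snd i] continuous_on_snd[OF continuous_on_id]
  by auto

lemma continuous_on_fun_comp:
  "continuous_on UNIV (\<lambda>p :: 'a::topological_space \<times> (nat \<Rightarrow> nat). (fst p, (\<lambda>j. snd p (h j))))"
proof -
  have "continuous_on UNIV (\<lambda>p :: 'a \<times> (nat \<Rightarrow> nat). (\<lambda>j. snd p (h j)))"
    by (intro continuous_on_coordinatewise_then_product continuous_on_snd_coordinate)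
  then show ?thesis by (intro continuous_on_Pair continuous_on_fst continuous_on_id)
qed

lemma analytic_set_closed: "closed A \<Longrightarrow> analytic_set A"
  unfolding analytic_set_def
  by (rule exI[of _ "A \<times> UNIV"]) (auto intro: closed_Times)

text \<open>With \<open>nat \<Rightarrow> nat\<close> as Baire space, coordinate 0 of the witness
  names the index \<open>i\<close>, and the shifted sequence is a witness for
  \<open>A i\<close>.\<close>

lemma analytic_set_UN:
  fixes A :: "nat \<Rightarrow> 'a::topological_space set"
  assumes "\<And>i. analytic_set (A i)"
  shows "analytic_set (\<Union>i. A i)"
proof -
  obtain S where S: "\<And>i. closed (S i)" "\<And>i. A i = fst ` (S i :: ('a \<times> (nat \<Rightarrow> nat)) set)"
    using assms unfolding analytic_set_def by metis
  \<comment> \<open>An infinite union of closed sets is not evidently closed, so membership is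
    phrased as an intersection: for each \<open>i\<close>, if coordinate 0 equals \<open>i\<close>,
    then the shift lies in \<open>S i\<close>. Each clause is closed because \<open>nat\<close> is
    discrete.\<close>
  define T where "T = (\<Inter>i. {p :: 'a \<times> (nat \<Rightarrow> nat). snd p 0 \<in> - {i}} \<union> (\<lambda>p. (fst p, (\<lambda>j. snd p (Suc j)))) -` S i)"
  have "closed {p :: 'a \<times> (nat \<Rightarrow> nat). snd p 0 \<in> - {i}}" for i
  proof -
    have "continuous_on UNIV (\<lambda>p :: 'a \<times> (nat \<Rightarrow> nat). snd p 0)"
      by (rule continuous_on_snd_coordinate)
    moreover have "closed (- {i} :: nat set)"
      by (metis closed_def Topological_Spaces.open_discrete)
    ultimately have "closed ((\<lambda>p :: 'a \<times> (nat \<Rightarrow> nat). snd p 0) -` (-{i}))"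
      by (simp add: closed_vimage)
    then show ?thesis by (simp add: vimage_def)
  qed
  moreover have "closed ((\<lambda>p :: 'a \<times> (nat \<Rightarrow> nat). (fst p, (\<lambda>j. snd p (Suc j)))) -` S i)" for i
    by (intro closed_vimage S continuous_on_fun_comp)
  ultimately have "closed T"
    unfolding T_def by (intro closed_INT ballI closed_Un) auto
  moreover have "(\<Union>i. A i) = fst ` T"
  proof (intro set_eqI iffI)
    fix y assume "y \<in> (\<Union>i. A i)"
    then obtain i s where "(y, s) \<in> S i" using S by auto
    then have "(y, \<lambda>j. case j of 0 \<Rightarrow> i | Suc j \<Rightarrow> s j) \<in> T"
      unfolding T_def by auto
    then show "y \<in> fst ` T" by force
  next
    fix y assume "y \<in> fst ` T"
    then obtain s where "(y, s) \<in> T" by auto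
    then have "(y, \<lambda>j. s (Suc j)) \<in> S (s 0)"
      unfolding T_def by auto
    then show "y \<in> (\<Union>i. A i)" using S by force
  qed
  ultimately show ?thesis unfolding analytic_set_def by blast
qed

text \<open>One sequence encodes countably many: row \<open>i\<close>, read off through
  \<open>prod_encode\<close>, is the witness for \<open>A i\<close>.\<close>

lemma analytic_set_INT:
  fixes A :: "nat \<Rightarrow> 'a::topological_space set"
  assumes "\<And>i. analytic_set (A i)"
  shows "analytic_set (\<Inter>i. A i)"
proof -
  obtain S where S: "\<And>i. closed (S i)" "\<And>i. A i = fst ` (S i :: ('a \<times> (nat \<Rightarrow> nat)) set)"
    using assms unfolding analytic_set_def by metis
  define T where "T = (\<Inter>i. (\<lambda>p :: 'a \<times> (nat \<Rightarrow> nat). (fst p, (\<lambda>j. snd p (prod_encode (i, j))))) -` S i)"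
  have "closed T"
    unfolding T_def by (intro closed_INT ballI closed_vimage S continuous_on_fun_comp)
  moreover have "(\<Inter>i. A i) = fst ` T"
  proof (intro set_eqI iffI)
    fix y assume "y \<in> (\<Inter>i. A i)"
    then have "\<forall>i. \<exists>s. (y, s) \<in> S i" using S by force
    then obtain s where "\<And>i. (y, s i) \<in> S i" by metis
    then have "(y, \<lambda>k. s (fst (prod_decode k)) (snd (prod_decode k))) \<in> T"
      unfolding T_def by auto
    then show "y \<in> fst ` T" by force
  next
    fix y assume "y \<in> fst ` T"
    then obtain s where "(y, s) \<in> T" by auto
    then have "(y, \<lambda>j. s (prod_encode (i, j))) \<in> S i" for i
      unfolding T_def by auto
    then show "y \<in> (\<Inter>i. A i)" using S by force
  qed
  ultimately show ?thesis unfolding analytic_set_def by blast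
qed

text \<open>Complements of analytic sets need not be analytic, so the induction carries
  \<open>A\<close> and \<open>- A\<close> together. The base case is that open sets are countable
  unions of closed sets.\<close>

lemma analytic_set_borel:
  fixes A :: "'a::metric_space set"
  assumes "A \<in> sets borel"
  shows "analytic_set A"
proof -
  have "A \<in> sigma_sets UNIV (Collect closed)"
    using assms by (simp add: borel_eq_closed)
  then have "analytic_set A \<and> analytic_set (- A)"
  proof induction
    case (Basic A)
    \<comment> \<open>The empty set is excluded because \<open>infdist x {}\<close> is 0 by
      convention.\<close>
    have "- A = (\<Union>n::nat. {x. infdist x A \<ge> 1 / Suc n})" if "A \<noteq> {}"
    proof (intro set_eqI iffI)
      fix x assume "x \<in> - A"
      then have "infdist x A > 0"
        using Basic that by (metis ComplD in_closed_iff_infdist_zero infdist_nonneg less_eq_real_def mem_Collect_eq)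
      then obtain n where "1 / Suc n < infdist x A"
        using nat_approx_posE by metis
      then show "x \<in> (\<Union>n::nat. {x. infdist x A \<ge> 1 / Suc n})"
        by (auto intro!: exI[of _ n])
    next
      fix x assume "x \<in> (\<Union>n::nat. {x. infdist x A \<ge> 1 / Suc n})"
      then obtain n where "infdist x A \<ge> 1 / real (Suc n)" by auto
      moreover have "1 / real (Suc n) > 0" by simp
      ultimately have "infdist x A > 0" by linarith
      then show "x \<in> - A" by auto
    qed
    moreover have "analytic_set (\<Union>n::nat. {x. infdist x A \<ge> 1 / Suc n})"
      by (intro analytic_set_UN analytic_set_closed closed_Collect_le continuous_intros)
    moreover have "analytic_set (UNIV :: 'a set)"
      by (intro analytic_set_closed) auto
    ultimately show ?case using Basic
      by (cases "A = {}") (auto intro: analytic_set_closed)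
  next
    case Empty
    then show ?case by (auto intro: analytic_set_closed)
  next
    case (Compl a)
    then show ?case by (auto simp: Compl_eq_Diff_UNIV[symmetric])
  next
    case (Union a)
    then show ?case by (auto simp: Compl_UN intro: analytic_set_UN analytic_set_INT)
  qed
  then show ?thesis by simp
qed

text \<open>By compactness the distance from \<open>h x\<close> to \<open>F\<close> attains its
  minimum on \<open>K\<close>, so hitting means that an infimum vanishes, and a countable dense set
  detects this. It makes the hitting of closed sets measurable.\<close>

lemma continuous_closure_hit_countable:
  fixes h :: "'a::metric_space \<Rightarrow> 'b::metric_space"
  assumes "compact K" "continuous_on K h" "closed F" "F \<noteq> {}" and D: "D \<subseteq> K" "K \<subseteq> closure D"
  shows "h ` K \<inter> F \<noteq> {} \<longleftrightarrow> (\<forall>n::nat. \<exists>x\<in>D. infdist (h x) F < 1 / Suc n)"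
proof
  assume "h ` K \<inter> F \<noteq> {}"
  then obtain x where x: "x \<in> K" "h x \<in> F" by auto
  show "\<forall>n::nat. \<exists>x\<in>D. infdist (h x) F < 1 / Suc n"
  proof
    fix n :: nat
    have "continuous_on K (\<lambda>x. infdist (h x) F)"
      by (intro continuous_intros assms)
    then obtain e where e: "e > 0" "\<And>y. y \<in> K \<Longrightarrow> dist y x < e \<Longrightarrow> dist (infdist (h y) F) (infdist (h x) F) < 1 / Suc n"
      unfolding continuous_on_iff using x by (metis of_nat_0_less_iff zero_less_Suc zero_less_divide_1_iff)
    obtain y where "y \<in> D" "dist y x < e"
      using D x e closure_approachable by blast
    then show "\<exists>x\<in>D. infdist (h x) F < 1 / Suc n"
      using e(2)[of y] D x by (intro bexI[of _ y]) (auto simp: dist_real_def)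
  qed
next
  assume *: "\<forall>n::nat. \<exists>x\<in>D. infdist (h x) F < 1 / Suc n"
  have "D \<noteq> {}" using * by auto
  then have "K \<noteq> {}" using D by auto
  have "continuous_on K (\<lambda>x. infdist (h x) F)"
    by (intro continuous_intros assms)
  then obtain x where x: "x \<in> K" "\<And>y. y \<in> K \<Longrightarrow> infdist (h x) F \<le> infdist (h y) F"
    using continuous_attains_inf[OF assms(1) \<open>K \<noteq> {}\<close>] by metis
  have "infdist (h x) F = 0"
  proof (rule ccontr)
    assume "infdist (h x) F \<noteq> 0"
    then have "infdist (h x) F > 0" using infdist_nonneg[of "h x" F] by linarith
    then obtain n where n: "1 / Suc n < infdist (h x) F"
      using nat_approx_posE by metis
    obtain y where "y \<in> D" "infdist (h y) F < 1 / Suc n" using * by blast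
    then show False using x(2)[of y] n D by auto
  qed
  then have "h x \<in> F" using assms by (simp add: in_closed_iff_infdist_zero)
  then show "h ` K \<inter> F \<noteq> {}" using x by auto
qed

lemma hitting_event_closed_sets:
  fixes X :: "'a::{metric_space, second_countable_topology} \<Rightarrow> 'w \<Rightarrow> 'b::euclidean_space"
  assumes "compact K" "closed F" and X: "\<And>x. X x \<in> borel_measurable P"
    and cont: "\<And>\<omega>. \<omega> \<in> space P \<Longrightarrow> continuous_on K (\<lambda>x. X x \<omega>)"
  shows "hitting_event P X K F \<in> sets P"
proof (cases "F = {}")
  case True
  then show ?thesis by (simp add: hitting_event_def)
next
  case False
  obtain D where D: "countable D" "D \<subseteq> K" "K \<subseteq> closure D"
    using separable by metis
  have "hitting_event P X K F = {\<omega>\<in>space P. \<forall>n::nat. \<exists>x\<in>D. infdist (X x \<omega>) F < 1 / Suc n}"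
    unfolding hitting_event_def
    using continuous_closure_hit_countable[OF assms(1) cont assms(2) False D(2,3)]
    by (intro Collect_cong conj_cong) blast+
  also have "\<dots> \<in> sets P"
  proof -
    have "(\<lambda>\<omega>. infdist (X x \<omega>) F) \<in> borel_measurable P" for x
      using X[of x] borel_measurable_continuous_onI[OF continuous_on_infdist[OF continuous_on_id, of UNIV F]]
      by measurable
    note [measurable] = this
    show ?thesis using D(1) by measurable
  qed
  finally show ?thesis .
qed

text \<open>The path image of \<open>K\<close> is compact, and its intersections with the
  \<open>F n\<close> are nested. This supplies the continuity from above that Choquet's argument
  asks for.\<close>

lemma hitting_event_Inter_closed:
  fixes X :: "'a::topological_space \<Rightarrow> 'w \<Rightarrow> 'b::{heine_borel}"
  assumes "compact K" "\<And>n::nat. closed (F n)" "decseq F"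
    and cont: "\<And>\<omega>. \<omega> \<in> space P \<Longrightarrow> continuous_on K (\<lambda>x. X x \<omega>)"
  shows "hitting_event P X K (\<Inter>n. F n) = (\<Inter>n. hitting_event P X K (F n))"
proof (intro set_eqI iffI)
  fix \<omega> assume "\<omega> \<in> hitting_event P X K (\<Inter>n. F n)"
  then show "\<omega> \<in> (\<Inter>n. hitting_event P X K (F n))"
    by (auto simp: hitting_event_def)
next
  fix \<omega> assume *: "\<omega> \<in> (\<Inter>n. hitting_event P X K (F n))"
  then have \<omega>: "\<omega> \<in> space P" by (auto simp: hitting_event_def)
  have c: "compact ((\<lambda>x. X x \<omega>) ` K)"
    using assms \<omega> by (intro compact_continuous_image)
  have "(\<Inter>n. (\<lambda>x. X x \<omega>) ` K \<inter> F n) \<noteq> {}"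
  proof (rule compact_nest)
    fix n
    show "compact ((\<lambda>x. X x \<omega>) ` K \<inter> F n)"
      using c assms(2) by (rule compact_Int_closed)
    show "(\<lambda>x. X x \<omega>) ` K \<inter> F n \<noteq> {}"
      using * by (auto simp: hitting_event_def)
  next
    fix m n :: nat assume "m \<le> n"
    then show "(\<lambda>x. X x \<omega>) ` K \<inter> F n \<subseteq> (\<lambda>x. X x \<omega>) ` K \<inter> F m"
      using assms(3) by (auto simp: decseq_def)
  qed
  then show "\<omega> \<in> hitting_event P X K (\<Inter>n. F n)"
    using \<omega> by (auto simp: hitting_event_def)
qed

section \<open>Choquet capacitability of analytic sets\<close>

lemma tendsto_fun_iff:
  fixes f :: "'c \<Rightarrow> 'i \<Rightarrow> 'b::topological_space"
  shows "(f \<longlongrightarrow> l) F \<longleftrightarrow> (\<forall>i. ((\<lambda>c. f c i) \<longlongrightarrow> l i) F)"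
  using limitin_componentwise[of "\<lambda>_. euclidean" UNIV f l F]
  by (simp add: euclidean_product_topology)

lemma compact_bounded_sequences: "compact {s :: nat \<Rightarrow> nat. \<forall>i. s i \<le> m i}"
proof -
  have "compactin (product_topology (\<lambda>i. euclidean) UNIV) (PiE UNIV (\<lambda>i. {..m i}))"
    unfolding compactin_PiE by (auto intro: finite_imp_compact)
  then show ?thesis
    by (simp add: euclidean_product_topology PiE_UNIV_domain Pi_def)
qed

text \<open>At each stage only finitely many coordinates are bounded, so the approximating sequences
  need not stay in a compact set. Their minimum with \<open>m\<close> does, and at any fixed
  coordinate the minimum changes nothing for large \<open>k\<close>, so a convergent subsequence of
  the truncations also gives convergence of the originals.\<close>

lemma closed_analytic_bounded_part:
  fixes S :: "('a::{metric_space} \<times> (nat \<Rightarrow> nat)) set"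
  assumes "closed S"
  shows "(\<Inter>k. closure (fst ` (S \<inter> {p. \<forall>i<k. snd p i \<le> m i}))) \<subseteq> fst ` S"
proof
  fix y assume y: "y \<in> (\<Inter>k. closure (fst ` (S \<inter> {p. \<forall>i<k. snd p i \<le> m i})))"
  have "\<exists>p. p \<in> S \<and> (\<forall>i<k. snd p i \<le> m i) \<and> dist (fst p) y < inverse (Suc k)" for k
  proof -
    have "y \<in> closure (fst ` (S \<inter> {p. \<forall>i<k. snd p i \<le> m i}))" using y by auto
    moreover have "0 < inverse (real (Suc k))" by simp
    ultimately obtain x where "x \<in> fst ` (S \<inter> {p. \<forall>i<k. snd p i \<le> m i})" "dist x y < inverse (Suc k)"
      unfolding closure_approachable by blast
    then show ?thesis by fastforce
  qed
  then have "\<exists>p. \<forall>k. p k \<in> S \<and> (\<forall>i<k. snd (p k) i \<le> m i) \<and> dist (fst (p k)) y < inverse (Suc k)"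
    by (intro choice allI)
  then obtain p where "\<forall>k. p k \<in> S \<and> (\<forall>i<k. snd (p k) i \<le> m i) \<and> dist (fst (p k)) y < inverse (Suc k)"
    by (rule exE)
  then have p: "\<And>k. p k \<in> S" "\<And>k i. i < k \<Longrightarrow> snd (p k) i \<le> m i"
      "\<And>k. dist (fst (p k)) y < inverse (Suc k)"
    by blast+
  have "seq_compact {s :: nat \<Rightarrow> nat. \<forall>i. s i \<le> m i}"
    by (intro compact_imp_seq_compact compact_bounded_sequences)
  moreover have "\<forall>k. (\<lambda>i. min (snd (p k) i) (m i)) \<in> {s :: nat \<Rightarrow> nat. \<forall>i. s i \<le> m i}" by auto
  ultimately obtain s r where r: "strict_mono r" and s: "((\<lambda>k. (\<lambda>i. min (snd (p k) i) (m i))) \<circ> r) \<longlonglongrightarrow> s"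
    unfolding seq_compact_def by meson
  have "(\<lambda>k. snd (p (r k))) \<longlonglongrightarrow> s"
  proof (unfold tendsto_fun_iff, rule allI)
    fix i
    have "(\<lambda>k. min (snd (p (r k)) i) (m i)) \<longlonglongrightarrow> s i"
      using s by (simp add: o_def tendsto_fun_iff)
    moreover have "\<forall>\<^sub>F k in sequentially. min (snd (p (r k)) i) (m i) = snd (p (r k)) i"
      using eventually_gt_at_top[of i]
    proof eventually_elim
      case (elim k)
      then have "i < r k" using seq_suble[OF r, of k] by linarith
      then show ?case using p(2)[of i "r k"] by simp
    qed
    ultimately show "(\<lambda>k. snd (p (r k)) i) \<longlonglongrightarrow> s i"
      by (rule Lim_transform_eventually)
  qed
  moreover have "(\<lambda>k. fst (p (r k))) \<longlonglongrightarrow> y"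
  proof -
    have "(\<lambda>k. fst (p k)) \<longlonglongrightarrow> y"
    proof (rule tendstoI)
      fix e :: real assume "e > 0"
      then have "\<forall>\<^sub>F k in sequentially. inverse (Suc k) < e"
        using order_tendstoD(2)[OF LIMSEQ_inverse_real_of_nat] by simp
      then show "\<forall>\<^sub>F k in sequentially. dist (fst (p k)) y < e"
        by eventually_elim (use p(3) in \<open>auto intro: less_trans\<close>)
    qed
    from LIMSEQ_subseq_LIMSEQ[OF this r] show ?thesis by (simp add: o_def)
  qed
  ultimately have "(\<lambda>k. (fst (p (r k)), snd (p (r k)))) \<longlonglongrightarrow> (y, s)"
    by (intro tendsto_Pair)
  moreover have "\<forall>k. (fst (p (r k)), snd (p (r k))) \<in> S" using p(1) by simp
  ultimately have "(y, s) \<in> S"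
    using assms closed_sequentially[of S "\<lambda>k. (fst (p (r k)), snd (p (r k)))"] by blast
  then show "y \<in> fst ` S" by force
qed

text \<open>Let \<open>\<Phi> B\<close> be the outer measure of the event of hitting
  \<open>B\<close>. It is continuous along increasing unions, so the coordinates of the witness can
  be bounded one at a time while \<open>\<Phi>\<close> stays above \<open>c\<close>. Continuity from
  above on closures keeps the bound in the limit.\<close>

lemma analytic_set_capacity:
  fixes X :: "'a::{metric_space, second_countable_topology} \<Rightarrow> 'w \<Rightarrow> 'b::euclidean_space"
  assumes "compact K" and X: "\<And>x. X x \<in> borel_measurable P"
    and cont: "\<And>\<omega>. \<omega> \<in> space P \<Longrightarrow> continuous_on K (\<lambda>x. X x \<omega>)"
    and fin: "finite_measure P"
    and "analytic_set A" and c: "c < outer_measure_of P (hitting_event P X K A)"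
  shows "\<exists>L. closed L \<and> L \<subseteq> A \<and> c \<le> emeasure P (hitting_event P X K L)"
proof -
  interpret finite_measure P by fact
  obtain S :: "('b \<times> (nat \<Rightarrow> nat)) set" where S: "closed S" "A = fst ` S"
    using assms unfolding analytic_set_def by auto
  define \<Phi> where "\<Phi> B = outer_measure_of P (hitting_event P X K B)" for B
  define B where "B k m = fst ` (S \<inter> {p. \<forall>i<k. snd p i \<le> m i})" for k and m :: "nat \<Rightarrow> nat"
  have step: "\<exists>j. c < \<Phi> (B (Suc k) (m(k := j)))" if "c < \<Phi> (B k m)" for k m
  proof -
    have "B k m = (\<Union>j. B (Suc k) (m(k := j)))"
    proof -
      have "{p :: 'b \<times> (nat \<Rightarrow> nat). \<forall>i<k. snd p i \<le> m i} = (\<Union>j. {p. \<forall>i<Suc k. snd p i \<le> (m(k := j)) i})"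
        by (auto simp: less_Suc_eq)
      note eq = this
      show ?thesis unfolding B_def by (simp only: eq Int_UN_distrib image_UN)
    qed
    then have "hitting_event P X K (B k m) = (\<Union>j. hitting_event P X K (B (Suc k) (m(k := j))))"
      by (auto simp: hitting_event_def)
    moreover have "incseq (\<lambda>j. hitting_event P X K (B (Suc k) (m(k := j))))"
    proof (rule monoI)
      fix j j' :: nat assume "j \<le> j'"
      then have "B (Suc k) (m(k := j)) \<subseteq> B (Suc k) (m(k := j'))"
        unfolding B_def by (intro image_mono Int_mono subset_refl) (auto simp: less_Suc_eq)
      then show "hitting_event P X K (B (Suc k) (m(k := j))) \<subseteq> hitting_event P X K (B (Suc k) (m(k := j')))"
        unfolding hitting_event_def by blast
    qed
    moreover have "hitting_event P X K (B (Suc k) (m(k := j))) \<subseteq> space P" for j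
      by (auto simp: hitting_event_def)
    ultimately have "\<Phi> (B k m) = (SUP j. \<Phi> (B (Suc k) (m(k := j))))"
      unfolding \<Phi>_def by (subst SUP_outer_measure_of_incseq) auto
    then show ?thesis using that by (simp add: less_SUP_iff)
  qed
  \<comment> \<open>Stage \<open>k\<close> fixes coordinate \<open>k\<close> only. The starting
    value is immaterial, since \<open>B 0\<close> imposes no bound.\<close>
  define ms where "ms = rec_nat (\<lambda>_. 0) (\<lambda>k m. m(k := SOME j. c < \<Phi> (B (Suc k) (m(k := j)))))"
  have ms_Suc: "ms (Suc k) = (ms k)(k := SOME j. c < \<Phi> (B (Suc k) ((ms k)(k := j))))" for k
    by (simp add: ms_def)
  have ms: "c < \<Phi> (B k (ms k))" for k
  proof (induction k)
    case 0
    then show ?case using c S by (simp add: B_def \<Phi>_def)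
  next
    case (Suc k)
    then show ?case unfolding ms_Suc by (intro someI_ex[OF step])
  qed
  define m where "m i = ms (Suc i) i" for i
  have ms_eq: "ms k i = m i" if "i < k" for k i
    using that by (induction k) (auto simp: ms_Suc m_def less_Suc_eq)
  have B_eq: "B k (ms k) = B k m" for k
    unfolding B_def using ms_eq by auto
  \<comment> \<open>Closures are taken because measurability and continuity from above are available
    for closed sets; by \<open>closed_analytic_bounded_part\<close> their intersection still lies in
    \<open>A\<close>.\<close>
  define F where "F k = closure (B k m)" for k
  have "closed (F k)" for k by (simp add: F_def)
  moreover have "decseq F"
    unfolding decseq_def F_def B_def by (intro allI impI closure_mono image_mono Int_mono subset_refl) auto
  ultimately have F: "hitting_event P X K (\<Inter>k. F k) = (\<Inter>k. hitting_event P X K (F k))"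
    by (intro hitting_event_Inter_closed assms) auto
  have "c \<le> emeasure P (hitting_event P X K (F k))" for k
  proof -
    have "hitting_event P X K (B k m) \<subseteq> hitting_event P X K (F k)"
      unfolding hitting_event_def F_def using closure_subset[of "B k m"] by auto
    then have "\<Phi> (B k m) \<le> \<Phi> (F k)"
      unfolding \<Phi>_def by (rule outer_measure_of_mono)
    also have "\<Phi> (F k) = emeasure P (hitting_event P X K (F k))"
      unfolding \<Phi>_def by (intro outer_measure_of_eq hitting_event_closed_sets assms \<open>closed (F k)\<close>) auto
    finally show ?thesis using ms[of k] B_eq by auto
  qed
  moreover have "emeasure P (\<Inter>k. hitting_event P X K (F k)) = (INF k. emeasure P (hitting_event P X K (F k)))"
  proof (intro INF_emeasure_decseq[symmetric])
    show "range (\<lambda>k. hitting_event P X K (F k)) \<subseteq> sets P"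
      using \<open>\<And>k. closed (F k)\<close> by (auto intro!: hitting_event_closed_sets assms)
    show "decseq (\<lambda>k. hitting_event P X K (F k))"
      using \<open>decseq F\<close> unfolding decseq_def hitting_event_def by blast
  qed auto
  ultimately have "c \<le> emeasure P (hitting_event P X K (\<Inter>k. F k))"
    unfolding F by (auto intro: INF_greatest)
  moreover have "closed (\<Inter>k. F k)" using \<open>\<And>k. closed (F k)\<close> by auto
  moreover have "(\<Inter>k. F k) \<subseteq> A"
    unfolding F_def B_def S(2) by (rule closed_analytic_bounded_part[OF S(1)])
  ultimately show ?thesis by blast
qed

text \<open>A measurable hull from outside and a union of the approximating sets from inside have
  the same finite measure, so they differ by a null set.\<close>

lemma sets_completion_outer_approx:
  assumes fin: "finite_measure P" and "H \<subseteq> space P"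
    and approx: "\<And>c. c < outer_measure_of P H \<Longrightarrow> \<exists>B\<in>sets P. B \<subseteq> H \<and> c \<le> emeasure P B"
  shows "H \<in> sets (completion P)"
proof -
  interpret finite_measure P by fact
  obtain V where V: "V \<in> sets P" "H \<subseteq> V" "outer_measure_of P H = emeasure P V"
    using outer_measure_of_attain[of H P] assms(2) by auto
  have "\<exists>U\<in>sets P. U \<subseteq> H \<and> emeasure P V \<le> emeasure P U"
  proof (cases "emeasure P V = 0")
    case True
    then show ?thesis by (intro bexI[of _ "{}"]) auto
  next
    case False
    \<comment> \<open>These levels increase to \<open>P(V)\<close> and must lie strictly below it,
      hence the separate case \<open>P(V) = 0\<close>.\<close>
    define c where "c n = ennreal (measure P V - measure P V / Suc n)" for n :: nat
    have pos: "measure P V > 0"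
      using False by (simp add: emeasure_eq_measure zero_less_measure_iff measure_eq_0_null_sets)
    have "c n < emeasure P V" for n
      unfolding c_def emeasure_eq_measure using pos by (intro ennreal_lessI) (auto simp: field_simps)
    then have "\<exists>B\<in>sets P. B \<subseteq> H \<and> c n \<le> emeasure P B" for n
      using approx V by auto
    then obtain B where B: "\<And>n. B n \<in> sets P" "\<And>n. B n \<subseteq> H" "\<And>n. c n \<le> emeasure P (B n)"
      by metis
    have "emeasure P V \<le> emeasure P (\<Union>n. B n)"
    proof (rule LIMSEQ_le_const2)
      have "(\<lambda>n. measure P V - measure P V * inverse (real (Suc n))) \<longlonglongrightarrow> measure P V - measure P V * 0"
        by (intro tendsto_intros LIMSEQ_inverse_real_of_nat)
      then show "c \<longlonglongrightarrow> emeasure P V"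
        unfolding c_def emeasure_eq_measure by (intro tendsto_ennrealI) (simp add: divide_inverse)
      show "\<exists>N. \<forall>n\<ge>N. c n \<le> emeasure P (\<Union>n. B n)"
        using B by (auto intro!: order_trans[OF B(3)] emeasure_mono)
    qed
    then show ?thesis using B by (intro bexI[of _ "\<Union>n. B n"]) auto
  qed
  then obtain U where U: "U \<in> sets P" "U \<subseteq> H" "emeasure P V \<le> emeasure P U" by auto
  have "emeasure P (V - U) = emeasure P V - emeasure P U"
    using U V by (intro emeasure_Diff) auto
  also have "\<dots> = 0" using U by (simp add: diff_eq_0_iff_ennreal less_top[symmetric])
  finally have "V - U \<in> null_sets P" using U V by auto
  moreover have "H - U \<subseteq> V - U" using V by auto
  ultimately show ?thesis
    using U by (intro sets_completionI[of H U "H - U" "V - U"]) auto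
qed

lemma hitting_event_completion:
  fixes X :: "'a::{metric_space, second_countable_topology} \<Rightarrow> 'w \<Rightarrow> 'b::euclidean_space"
  assumes "compact K" and "\<And>x. X x \<in> borel_measurable P"
    and "\<And>\<omega>. \<omega> \<in> space P \<Longrightarrow> continuous_on K (\<lambda>x. X x \<omega>)"
    and "finite_measure P" and "A \<in> sets borel"
  shows "hitting_event P X K A \<in> sets (completion P)"
proof (rule sets_completion_outer_approx[OF assms(4)])
  show "hitting_event P X K A \<subseteq> space P" by (auto simp: hitting_event_def)
  fix c assume "c < outer_measure_of P (hitting_event P X K A)"
  from analytic_set_capacity[OF assms(1-4) analytic_set_borel[OF assms(5)] this]
  obtain L where L: "closed L" "L \<subseteq> A" "c \<le> emeasure P (hitting_event P X K L)" by blast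
  then show "\<exists>B\<in>sets P. B \<subseteq> hitting_event P X K A \<and> c \<le> emeasure P B"
    by (intro bexI[of _ "hitting_event P X K L"] conjI hitting_event_closed_sets assms)
      (auto simp: hitting_event_def)
qed

section \<open>The second moment method\<close>

text \<open>Rounding \<open>x\<close> down to a grid of mesh \<open>1 / (n + 1)\<close> leaves
  countably many random variables, which gives joint measurability; path continuity passes to the
  limit. The grid is that of the whole space, so continuity on \<open>UNIV\<close> is used.\<close>

lemma borel_measurable_continuous_paths:
  fixes X :: "real ^ 'd \<Rightarrow> 'w \<Rightarrow> 'b::metric_space"
  assumes X: "\<And>x. X x \<in> borel_measurable P"
    and cont: "\<And>\<omega>. \<omega> \<in> space P \<Longrightarrow> continuous_on UNIV (\<lambda>x. X x \<omega>)"
  shows "(\<lambda>p. X (snd p) (fst p)) \<in> borel_measurable (P \<Otimes>\<^sub>M borel)"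
proof (rule borel_measurable_LIMSEQ_metric)
  define k where "k n x = (\<lambda>i. \<lfloor>real (Suc n) * x $ i\<rfloor>)" for n and x :: "real ^ 'd"
  define g where "g n j = (\<chi> i. real_of_int (j i) / real (Suc n))" for n and j :: "'d \<Rightarrow> int"
  fix n :: nat
  have [measurable]: "k n \<in> measurable borel (count_space UNIV)"
    unfolding measurable_count_space_eq2_countable
  proof safe
    fix a :: "'d \<Rightarrow> int"
    have "k n -` {a} = {x. \<forall>i. \<lfloor>real (Suc n) * x $ i\<rfloor> = a i}"
      by (auto simp: k_def)
    also have "\<dots> \<in> sets borel" by measurable
    finally show "k n -` {a} \<inter> space borel \<in> sets borel" by simp
  qed auto
  show "(\<lambda>p. X (g n (k n (snd p))) (fst p)) \<in> borel_measurable (P \<Otimes>\<^sub>M borel)"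
  proof (rule measurable_compose_countable[of "\<lambda>j p. X (g n j) (fst p)" _ _ "\<lambda>p. k n (snd p)"])
    show "(\<lambda>p. X (g n j) (fst p)) \<in> borel_measurable (P \<Otimes>\<^sub>M borel)" for j
      using X[of "g n j"] by measurable
  qed measurable
next
  define k where "k n x = (\<lambda>i. \<lfloor>real (Suc n) * x $ i\<rfloor>)" for n and x :: "real ^ 'd"
  define g where "g n j = (\<chi> i. real_of_int (j i) / real (Suc n))" for n and j :: "'d \<Rightarrow> int"
  fix p assume p: "p \<in> space (P \<Otimes>\<^sub>M (borel :: (real ^ 'd) measure))"
  have "(\<lambda>n. g n (k n (snd p))) \<longlonglongrightarrow> snd p"
  proof (rule vec_tendstoI)
    fix i
    have "(\<lambda>n. snd p $ i - inverse (real (Suc n))) \<longlonglongrightarrow> snd p $ i - 0"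
      by (intro tendsto_intros LIMSEQ_inverse_real_of_nat)
    then have lower: "(\<lambda>n. snd p $ i - inverse (real (Suc n))) \<longlonglongrightarrow> snd p $ i" by simp
    have between: "snd p $ i - inverse (real (Suc n)) \<le> g n (k n (snd p)) $ i \<and> g n (k n (snd p)) $ i \<le> snd p $ i" for n
    proof -
      define c where "c = real (Suc n)"
      have "c > 0" by (simp add: c_def)
      moreover have "c * snd p $ i - 1 \<le> real_of_int \<lfloor>c * snd p $ i\<rfloor>"
          "real_of_int \<lfloor>c * snd p $ i\<rfloor> \<le> c * snd p $ i"
        by linarith+
      ultimately have "(c * snd p $ i - 1) / c \<le> real_of_int \<lfloor>c * snd p $ i\<rfloor> / c"
          "real_of_int \<lfloor>c * snd p $ i\<rfloor> / c \<le> c * snd p $ i / c"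
        by (intro divide_right_mono; simp)+
      moreover have "(c * snd p $ i - 1) / c = snd p $ i - inverse c" "c * snd p $ i / c = snd p $ i"
        using \<open>c > 0\<close> by (simp_all add: field_simps)
      ultimately show ?thesis
        unfolding g_def k_def c_def[symmetric] by simp
    qed
    show "(\<lambda>n. g n (k n (snd p)) $ i) \<longlonglongrightarrow> snd p $ i"
      by (rule tendsto_sandwich[OF _ _ lower tendsto_const]) (rule always_eventually, use between in blast)+
  qed
  moreover have "isCont (\<lambda>x. X x (fst p)) (snd p)"
    using cont[of "fst p"] p by (auto simp: space_pair_measure continuous_on_eq_continuous_at)
  ultimately show "(\<lambda>n. X (g n (k n (snd p))) (fst p)) \<longlonglongrightarrow> X (snd p) (fst p)"
    by (rule continuous_imp_tendsto[unfolded o_def, rotated])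
qed

text \<open>Let \<open>J\<close> be the \<open>\<nu>\<close>-measure of the section of
  \<open>H\<close>. It vanishes off \<open>U\<close>, so Cauchy-Schwarz applies to the product of
  \<open>J\<close> and the indicator of \<open>U\<close>, and Tonelli expands both moments. No
  division occurs, so infinite values are harmless.\<close>

lemma second_moment:
  assumes "sigma_finite_measure P" "sigma_finite_measure \<nu>"
    and H[measurable]: "H \<in> sets (P \<Otimes>\<^sub>M \<nu>)"
    and U[measurable]: "U \<in> sets P" and HU: "\<And>\<omega> p. (\<omega>, p) \<in> H \<Longrightarrow> \<omega> \<in> U"
  shows "(\<integral>\<^sup>+p. emeasure P {\<omega>\<in>space P. (\<omega>, p) \<in> H} \<partial>\<nu>)\<^sup>2 \<le>
    emeasure P U * (\<integral>\<^sup>+p. \<integral>\<^sup>+p'. emeasure P {\<omega>\<in>space P. (\<omega>, p) \<in> H \<and> (\<omega>, p') \<in> H} \<partial>\<nu> \<partial>\<nu>)"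
proof -
  interpret P: sigma_finite_measure P by fact
  interpret \<nu>: sigma_finite_measure \<nu> by fact
  interpret pair_sigma_finite P \<nu> ..
  define J where "J \<omega> = (\<integral>\<^sup>+p. indicator H (\<omega>, p) \<partial>\<nu>)" for \<omega>
  have [measurable]: "J \<in> borel_measurable P"
    unfolding J_def by measurable
  have 1: "(\<integral>\<^sup>+p. emeasure P {\<omega>\<in>space P. (\<omega>, p) \<in> H} \<partial>\<nu>) = (\<integral>\<^sup>+\<omega>. indicator U \<omega> * J \<omega> \<partial>P)"
  proof -
    have "(\<integral>\<^sup>+p. emeasure P {\<omega>\<in>space P. (\<omega>, p) \<in> H} \<partial>\<nu>) = (\<integral>\<^sup>+p. \<integral>\<^sup>+\<omega>. indicator H (\<omega>, p) \<partial>P \<partial>\<nu>)"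
    proof (intro nn_integral_cong)
      fix p assume [measurable]: "p \<in> space \<nu>"
      have "emeasure P {\<omega>\<in>space P. (\<omega>, p) \<in> H} = (\<integral>\<^sup>+\<omega>. indicator {\<omega>\<in>space P. (\<omega>, p) \<in> H} \<omega> \<partial>P)"
        by (intro nn_integral_indicator[symmetric]) measurable
      also have "\<dots> = (\<integral>\<^sup>+\<omega>. indicator H (\<omega>, p) \<partial>P)"
        by (intro nn_integral_cong) (auto split: split_indicator)
      finally show "emeasure P {\<omega>\<in>space P. (\<omega>, p) \<in> H} = (\<integral>\<^sup>+\<omega>. indicator H (\<omega>, p) \<partial>P)" .
    qed
    also have "\<dots> = (\<integral>\<^sup>+\<omega>. J \<omega> \<partial>P)"
      unfolding J_def by (rule Fubini') measurable
    also have "\<dots> = (\<integral>\<^sup>+\<omega>. indicator U \<omega> * J \<omega> \<partial>P)"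
    proof (intro nn_integral_cong)
      fix \<omega>
      show "J \<omega> = indicator U \<omega> * J \<omega>"
      proof (cases "\<omega> \<in> U")
        case False
        then have "J \<omega> = (\<integral>\<^sup>+p. 0 \<partial>\<nu>)"
          unfolding J_def using HU by (intro nn_integral_cong) (auto split: split_indicator)
        then show ?thesis by simp
      qed simp
    qed
    finally show ?thesis .
  qed
  have 2: "(\<integral>\<^sup>+\<omega>. J \<omega> ^ 2 \<partial>P) =
    (\<integral>\<^sup>+p. \<integral>\<^sup>+p'. emeasure P {\<omega>\<in>space P. (\<omega>, p) \<in> H \<and> (\<omega>, p') \<in> H} \<partial>\<nu> \<partial>\<nu>)"
  proof -
    have "J \<omega> ^ 2 = (\<integral>\<^sup>+p. \<integral>\<^sup>+p'. indicator H (\<omega>, p) * indicator H (\<omega>, p') \<partial>\<nu> \<partial>\<nu>)" if "\<omega> \<in> space P" for \<omega>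
      using that unfolding J_def power2_eq_square
      by (simp add: nn_integral_cmult nn_integral_multc[symmetric])
    then have "(\<integral>\<^sup>+\<omega>. J \<omega> ^ 2 \<partial>P) =
        (\<integral>\<^sup>+\<omega>. \<integral>\<^sup>+p. \<integral>\<^sup>+p'. indicator H (\<omega>, p) * indicator H (\<omega>, p') \<partial>\<nu> \<partial>\<nu> \<partial>P)"
      by (intro nn_integral_cong) auto
    also have "\<dots> = (\<integral>\<^sup>+p. \<integral>\<^sup>+\<omega>. \<integral>\<^sup>+p'. indicator H (\<omega>, p) * indicator H (\<omega>, p') \<partial>\<nu> \<partial>P \<partial>\<nu>)"
      by (rule Fubini'[symmetric]) measurable
    also have "\<dots> = (\<integral>\<^sup>+p. \<integral>\<^sup>+p'. \<integral>\<^sup>+\<omega>. indicator H (\<omega>, p) * indicator H (\<omega>, p') \<partial>P \<partial>\<nu> \<partial>\<nu>)"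
      by (intro nn_integral_cong Fubini'[symmetric]) measurable
    also have "\<dots> = (\<integral>\<^sup>+p. \<integral>\<^sup>+p'. emeasure P {\<omega>\<in>space P. (\<omega>, p) \<in> H \<and> (\<omega>, p') \<in> H} \<partial>\<nu> \<partial>\<nu>)"
    proof (intro nn_integral_cong)
      fix p p' assume [measurable]: "p \<in> space \<nu>" "p' \<in> space \<nu>"
      have "emeasure P {\<omega>\<in>space P. (\<omega>, p) \<in> H \<and> (\<omega>, p') \<in> H} =
          (\<integral>\<^sup>+\<omega>. indicator {\<omega>\<in>space P. (\<omega>, p) \<in> H \<and> (\<omega>, p') \<in> H} \<omega> \<partial>P)"
        by (intro nn_integral_indicator[symmetric]) measurable
      also have "\<dots> = (\<integral>\<^sup>+\<omega>. indicator H (\<omega>, p) * indicator H (\<omega>, p') \<partial>P)"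
        by (intro nn_integral_cong) (auto split: split_indicator)
      finally show "(\<integral>\<^sup>+\<omega>. indicator H (\<omega>, p) * indicator H (\<omega>, p') \<partial>P) =
        emeasure P {\<omega>\<in>space P. (\<omega>, p) \<in> H \<and> (\<omega>, p') \<in> H}" by simp
    qed
    finally show ?thesis .
  qed
  have "(\<integral>\<^sup>+\<omega>. indicator U \<omega> * J \<omega> \<partial>P)\<^sup>2 \<le> (\<integral>\<^sup>+\<omega>. indicator U \<omega> ^ 2 \<partial>P) * (\<integral>\<^sup>+\<omega>. J \<omega> ^ 2 \<partial>P)"
    by (rule Cauchy_Schwarz_nn_integral) measurable
  also have "(\<integral>\<^sup>+\<omega>. indicator U \<omega> ^ 2 \<partial>P) = (\<integral>\<^sup>+\<omega>. indicator U \<omega> \<partial>P)"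
    by (intro nn_integral_cong) (auto split: split_indicator)
  finally show ?thesis unfolding 1 2 by simp
qed

section \<open>Gaussian estimates\<close>

lemma (in prob_space) gaussian_var_integrable:
  assumes "gaussian_var M X"
  shows "integrable M X" "integrable M (\<lambda>\<omega>. (X \<omega>)\<^sup>2)"
proof -
  have [measurable]: "X \<in> borel_measurable M" using assms by (simp add: gaussian_var_def)
  from assms consider m s where "0 < s" "distributed M lborel X (normal_density m s)" | m where "AE \<omega> in M. X \<omega> = m"
    unfolding gaussian_var_def by blast
  then have "integrable M X \<and> integrable M (\<lambda>\<omega>. (X \<omega>)\<^sup>2)"
  proof cases
    case 1
    have *: "integrable M (\<lambda>\<omega>. (X \<omega> - m) ^ k)" for k
      using 1 integrable_normal_moment[of s m k]
      by (subst distributed_integrable[OF 1(2), symmetric]) auto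
    have "integrable M (\<lambda>\<omega>. (X \<omega> - m) ^ 1 + m)" "integrable M (\<lambda>\<omega>. (X \<omega> - m) ^ 2 + 2 * m * (X \<omega> - m) ^ 1 + m\<^sup>2)"
      by (intro Bochner_Integration.integrable_add integrable_mult_right * integrable_const)+
    moreover have "(\<lambda>\<omega>. (X \<omega> - m) ^ 2 + 2 * m * (X \<omega> - m) ^ 1 + m\<^sup>2) = (\<lambda>\<omega>. (X \<omega>)\<^sup>2)"
      by (auto simp: power2_eq_square algebra_simps)
    ultimately show ?thesis by simp
  next
    case 2
    have "integrable M X \<longleftrightarrow> integrable M (\<lambda>_. m)" "integrable M (\<lambda>\<omega>. (X \<omega>)\<^sup>2) \<longleftrightarrow> integrable M (\<lambda>_. m\<^sup>2)"
      using 2 by (intro integrable_cong_AE; auto)+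
    then show ?thesis by simp
  qed
  then show "integrable M X" "integrable M (\<lambda>\<omega>. (X \<omega>)\<^sup>2)" by auto
qed

lemma (in prob_space) gaussian_var_cases:
  assumes "gaussian_var M X"
  obtains (normal) s where "0 < s" "var M X = s\<^sup>2" "distributed M lborel X (normal_density (expectation X) s)"
  | (const) "var M X = 0" "AE \<omega> in M. X \<omega> = expectation X"
proof -
  have [measurable]: "X \<in> borel_measurable M" using assms by (simp add: gaussian_var_def)
  from assms consider m s where "0 < s" "distributed M lborel X (normal_density m s)" | m where "AE \<omega> in M. X \<omega> = m"
    unfolding gaussian_var_def by blast
  then show thesis
  proof cases
    case 1
    then have "expectation X = m" "variance X = s\<^sup>2"
      by (auto intro: normal_distributed_expectation normal_distributed_variance)
    then show thesis using 1 by (intro normal[of s]) (auto simp: var_def)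
  next
    case 2
    then have "expectation X = expectation (\<lambda>_. m)"
      by (intro integral_cong_AE) auto
    then have m: "expectation X = m" by (simp add: prob_space)
    have "var M X = expectation (\<lambda>_. 0)"
      unfolding var_def m using 2 by (intro integral_cong_AE) auto
    then show thesis using 2 m by (intro const) auto
  qed
qed

lemma (in prob_space) integrable_product_of_squares:
  fixes X W :: "'a \<Rightarrow> real"
  assumes [measurable]: "X \<in> borel_measurable M" "W \<in> borel_measurable M"
    and "integrable M (\<lambda>\<omega>. (X \<omega>)\<^sup>2)" "integrable M (\<lambda>\<omega>. (W \<omega>)\<^sup>2)"
  shows "integrable M (\<lambda>\<omega>. X \<omega> * W \<omega>)"
proof (rule Bochner_Integration.integrable_bound)
  show "integrable M (\<lambda>\<omega>. (X \<omega>)\<^sup>2 + (W \<omega>)\<^sup>2)" using assms by auto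
  have "\<bar>X \<omega> * W \<omega>\<bar> \<le> (X \<omega>)\<^sup>2 + (W \<omega>)\<^sup>2" for \<omega>
  proof -
    have "2 * \<bar>X \<omega>\<bar> * \<bar>W \<omega>\<bar> \<le> \<bar>X \<omega>\<bar>\<^sup>2 + \<bar>W \<omega>\<bar>\<^sup>2" by (rule sum_squares_bound)
    moreover have "0 \<le> \<bar>X \<omega>\<bar> * \<bar>W \<omega>\<bar>" by simp
    ultimately show ?thesis unfolding abs_mult power2_abs by linarith
  qed
  then show "AE \<omega> in M. norm (X \<omega> * W \<omega>) \<le> norm ((X \<omega>)\<^sup>2 + (W \<omega>)\<^sup>2)" by auto
qed auto

lemma (in prob_space) var_cov_linear:
  assumes X: "gaussian_var M X" and W: "gaussian_var M W"
  shows "var M (\<lambda>\<omega>. g * X \<omega> + h * W \<omega>) = g\<^sup>2 * var M X + 2 * g * h * cov M X W + h\<^sup>2 * var M W"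
    and "cov M X (\<lambda>\<omega>. g * X \<omega> + h * W \<omega>) = g * var M X + h * cov M X W"
proof -
  have [measurable]: "X \<in> borel_measurable M" "W \<in> borel_measurable M"
    using X W by (simp_all add: gaussian_var_def)
  note iX = gaussian_var_integrable[OF X] and iW = gaussian_var_integrable[OF W]
  have iXW: "integrable M (\<lambda>\<omega>. X \<omega> * W \<omega>)"
    using iX iW by (intro integrable_product_of_squares) auto
  define mx mw where "mx = expectation X" and "mw = expectation W"
  have mean: "expectation (\<lambda>\<omega>. g * X \<omega> + h * W \<omega>) = g * mx + h * mw"
    using iX iW by (simp add: mx_def mw_def)
  have sq: "(X \<omega> - mx)\<^sup>2 = (X \<omega>)\<^sup>2 - 2 * mx * X \<omega> + mx\<^sup>2" "(W \<omega> - mw)\<^sup>2 = (W \<omega>)\<^sup>2 - 2 * mw * W \<omega> + mw\<^sup>2"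
    "(X \<omega> - mx) * (W \<omega> - mw) = X \<omega> * W \<omega> - mw * X \<omega> - mx * W \<omega> + mx * mw" for \<omega>
    by (simp_all add: power2_eq_square algebra_simps)
  have i: "integrable M (\<lambda>\<omega>. (X \<omega> - mx)\<^sup>2)" "integrable M (\<lambda>\<omega>. (W \<omega> - mw)\<^sup>2)"
    "integrable M (\<lambda>\<omega>. (X \<omega> - mx) * (W \<omega> - mw))"
    unfolding sq using iX iW iXW by simp_all
  have "var M (\<lambda>\<omega>. g * X \<omega> + h * W \<omega>) =
    expectation (\<lambda>\<omega>. g\<^sup>2 * (X \<omega> - mx)\<^sup>2 + (2 * g * h) * ((X \<omega> - mx) * (W \<omega> - mw)) + h\<^sup>2 * (W \<omega> - mw)\<^sup>2)"
    unfolding var_def mean by (intro Bochner_Integration.integral_cong) (auto simp: power2_eq_square algebra_simps)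
  also have "\<dots> = g\<^sup>2 * expectation (\<lambda>\<omega>. (X \<omega> - mx)\<^sup>2) + (2 * g * h) * expectation (\<lambda>\<omega>. (X \<omega> - mx) * (W \<omega> - mw)) + h\<^sup>2 * expectation (\<lambda>\<omega>. (W \<omega> - mw)\<^sup>2)"
    by (subst Bochner_Integration.integral_add; (intro Bochner_Integration.integrable_add integrable_mult_right i)?)+
      (simp only: integral_mult_right_zero)
  finally show "var M (\<lambda>\<omega>. g * X \<omega> + h * W \<omega>) = g\<^sup>2 * var M X + 2 * g * h * cov M X W + h\<^sup>2 * var M W"
    by (simp add: var_def cov_def mx_def mw_def)
  have "cov M X (\<lambda>\<omega>. g * X \<omega> + h * W \<omega>) =
    expectation (\<lambda>\<omega>. g * (X \<omega> - mx)\<^sup>2 + h * ((X \<omega> - mx) * (W \<omega> - mw)))"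
    unfolding cov_def mean mx_def[symmetric]
    by (intro Bochner_Integration.integral_cong) (auto simp: power2_eq_square algebra_simps)
  also have "\<dots> = g * expectation (\<lambda>\<omega>. (X \<omega> - mx)\<^sup>2) + h * expectation (\<lambda>\<omega>. (X \<omega> - mx) * (W \<omega> - mw))"
    by (subst Bochner_Integration.integral_add; (intro integrable_mult_right i)?)
      (simp only: integral_mult_right_zero)
  finally show "cov M X (\<lambda>\<omega>. g * X \<omega> + h * W \<omega>) = g * var M X + h * cov M X W"
    by (simp add: var_def cov_def mx_def mw_def)
qed

text \<open>In terms of mean and variance the formula needs no separate degenerate case, so it
  applies to every linear combination of jointly Gaussian variables.\<close>

lemma (in prob_space) gaussian_var_char:
  assumes "gaussian_var M X"
  shows "(CLINT \<omega>|M. iexp (X \<omega>)) = iexp (expectation X) * complex_of_real (exp (- var M X / 2))"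
proof -
  have [measurable]: "X \<in> borel_measurable M" using assms by (simp add: gaussian_var_def)
  from assms show ?thesis
  proof (cases rule: gaussian_var_cases)
    case (normal s)
    define m where "m = expectation X"
    define Z where "Z \<omega> = (X \<omega> - m) / s" for \<omega>
    have [measurable]: "Z \<in> borel_measurable M" unfolding Z_def by measurable
    have Z: "distributed M lborel Z std_normal_density"
      using normal normal_standard_normal_convert[of s X m] unfolding Z_def m_def by simp
    have "distr M borel Z = distr M lborel Z" by (rule distr_cong) auto
    also have "\<dots> = std_normal_distribution"
      using Z by (simp add: distributed_def)
    finally have dZ: "distr M borel Z = std_normal_distribution" .
    have "(CLINT \<omega>|M. iexp (X \<omega>)) = (CLINT \<omega>|M. iexp m * iexp (s * Z \<omega>))"
    proof (intro Bochner_Integration.integral_cong refl)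
      fix \<omega>
      have "X \<omega> = m + s * Z \<omega>" unfolding Z_def using normal by simp
      then show "iexp (X \<omega>) = iexp m * iexp (s * Z \<omega>)" by (simp add: exp_add ring_distribs)
    qed
    also have "\<dots> = iexp m * (CLINT \<omega>|M. iexp (s * Z \<omega>))"
      by simp
    also have "(CLINT \<omega>|M. iexp (s * Z \<omega>)) = (CLINT z|distr M borel Z. iexp (s * z))"
      by (subst integral_distr) auto
    also have "\<dots> = complex_of_real (exp (- s\<^sup>2 / 2))"
      unfolding dZ using fun_cong[OF char_std_normal_distribution, of s] by (simp add: char_def)
    finally show ?thesis using normal by (simp add: m_def)
  next
    case const
    then have "(CLINT \<omega>|M. iexp (X \<omega>)) = (CLINT \<omega>|M. iexp (expectation X))"
      by (intro integral_cong_AE) auto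
    then show ?thesis using const by (simp add: prob_space)
  qed
qed

lemma integral_swap_bounded:
  fixes F :: "'a \<Rightarrow> 'b \<Rightarrow> complex"
  assumes "prob_space M" "prob_space N"
    and [measurable]: "(\<lambda>p. F (fst p) (snd p)) \<in> borel_measurable (M \<Otimes>\<^sub>M N)"
    and "\<And>x y. norm (F x y) \<le> 1"
  shows "(\<integral>x. (\<integral>y. F x y \<partial>N) \<partial>M) = (\<integral>y. (\<integral>x. F x y \<partial>M) \<partial>N)"
proof -
  interpret M: prob_space M by fact
  interpret N: prob_space N by fact
  interpret pair_prob_space M N ..
  have "integrable (M \<Otimes>\<^sub>M N) (case_prod F)"
    using assms by (intro P.integrable_const_bound[of _ 1]) (auto simp: split_beta')
  then show ?thesis by (rule Fubini_integral[symmetric])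
qed

text \<open>The characteristic function of the standard normal law is a Gaussian bell; read from
  right to left, the bell is an average of characters.\<close>

lemma gaussian_kernel_char:
  "complex_of_real (exp (- (x\<^sup>2) / 2)) = (CLINT s|std_normal_distribution. iexp (s * x))"
  using fun_cong[OF char_std_normal_distribution, of x] by (simp add: char_def mult.commute)

text \<open>The Gaussian kernel is a mixture of characters, so Fubini's theorem turns the joint
  expectation into the joint characteristic function, which factorises.\<close>

lemma (in prob_space) gaussian_uncorrelated_kernel:
  assumes lin: "\<And>g h. gaussian_var M (\<lambda>\<omega>. g * X \<omega> + h * W \<omega>)" and cov: "cov M X W = 0"
  shows "expectation (\<lambda>\<omega>. exp (- (((X \<omega> - z) / u)\<^sup>2) / 2) * exp (- (((W \<omega> - w) / v)\<^sup>2) / 2)) =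
    expectation (\<lambda>\<omega>. exp (- (((X \<omega> - z) / u)\<^sup>2) / 2)) * expectation (\<lambda>\<omega>. exp (- (((W \<omega> - w) / v)\<^sup>2) / 2))"
proof -
  let ?N = "std_normal_distribution"
  interpret N: real_distribution ?N by (rule real_dist_normal_dist)
  have X: "gaussian_var M X" using lin[of 1 0] by simp
  have W: "gaussian_var M W" using lin[of 0 1] by simp
  have [measurable]: "X \<in> borel_measurable M" "W \<in> borel_measurable M"
    using X W by (simp_all add: gaussian_var_def)
  note iX = gaussian_var_integrable[OF X] and iW = gaussian_var_integrable[OF W]
  define A where "A \<omega> = (X \<omega> - z) / u" for \<omega>
  define B where "B \<omega> = (W \<omega> - w) / v" for \<omega>
  have [measurable]: "A \<in> borel_measurable M" "B \<in> borel_measurable M" unfolding A_def B_def by measurable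
  define F where "F s = (CLINT \<omega>|M. iexp (s * A \<omega>))" for s
  define G where "G t = (CLINT \<omega>|M. iexp (t * B \<omega>))" for t
  define mx mw where "mx = expectation X" and "mw = expectation W"
  have mean: "expectation (\<lambda>\<omega>. g * X \<omega> + h * W \<omega>) = g * mx + h * mw" for g h
    using iX iW by (simp add: mx_def mw_def)
  have var: "var M (\<lambda>\<omega>. g * X \<omega> + h * W \<omega>) = g\<^sup>2 * var M X + h\<^sup>2 * var M W" for g h
    using var_cov_linear(1)[OF X W] cov by simp
  have char: "(CLINT \<omega>|M. iexp (g * X \<omega> + h * W \<omega>)) =
      (iexp (g * mx) * complex_of_real (exp (- (g\<^sup>2 * var M X) / 2))) * (iexp (h * mw) * complex_of_real (exp (- (h\<^sup>2 * var M W) / 2)))" for g h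
  proof -
    have "iexp (g * mx + h * mw) = iexp (g * mx) * iexp (h * mw)"
      by (simp add: exp_add ring_distribs)
    moreover have "exp (- (g\<^sup>2 * var M X + h\<^sup>2 * var M W) / 2) = exp (- (g\<^sup>2 * var M X) / 2) * exp (- (h\<^sup>2 * var M W) / 2)"
      by (simp add: exp_add[symmetric] add_divide_distrib)
    ultimately show ?thesis
      unfolding gaussian_var_char[OF lin] var mean by (simp only: of_real_mult mult_ac)
  qed
  \<comment> \<open>Since \<open>X\<close> and \<open>W\<close> are uncorrelated, variances of
    combinations add and the joint characteristic function splits. Centring contributes only the
    constant factors \<open>c1\<close> and \<open>c2\<close>.\<close>
  have fac: "(CLINT \<omega>|M. iexp (s * A \<omega>) * iexp (t * B \<omega>)) = F s * G t" for s t
  proof -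
    define c1 c2 where "c1 = iexp (- s * z / u)" and "c2 = iexp (- t * w / v)"
    have sA: "s * A \<omega> = - s * z / u + (s / u * X \<omega> + 0 * W \<omega>)" for \<omega>
      unfolding A_def by (simp add: diff_divide_distrib right_diff_distrib)
    have tB: "t * B \<omega> = - t * w / v + (0 * X \<omega> + t / v * W \<omega>)" for \<omega>
      unfolding B_def by (simp add: diff_divide_distrib right_diff_distrib)
    have eA: "iexp (s * A \<omega>) = c1 * iexp (s / u * X \<omega> + 0 * W \<omega>)" for \<omega>
      unfolding c1_def sA of_real_add ring_distribs exp_add ..
    have eB: "iexp (t * B \<omega>) = c2 * iexp (0 * X \<omega> + t / v * W \<omega>)" for \<omega>
      unfolding c2_def tB of_real_add ring_distribs exp_add ..
    have eAB: "iexp (s * A \<omega>) * iexp (t * B \<omega>) = c1 * c2 * iexp (s / u * X \<omega> + t / v * W \<omega>)" for \<omega>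
      unfolding eA eB by (simp add: exp_add ring_distribs)
    have "F s = c1 * (CLINT \<omega>|M. iexp (s / u * X \<omega> + 0 * W \<omega>))"
      unfolding F_def eA by (rule integral_mult_right_zero)
    moreover have "G t = c2 * (CLINT \<omega>|M. iexp (0 * X \<omega> + t / v * W \<omega>))"
      unfolding G_def eB by (rule integral_mult_right_zero)
    moreover have "(CLINT \<omega>|M. iexp (s * A \<omega>) * iexp (t * B \<omega>)) =
        c1 * c2 * (CLINT \<omega>|M. iexp (s / u * X \<omega> + t / v * W \<omega>))"
      unfolding eAB by (rule integral_mult_right_zero)
    ultimately show ?thesis
      unfolding char by simp
  qed
  have n: "norm (iexp a) = 1" for a by simp
  have EB: "(CLINT \<omega>|M. complex_of_real (exp (- ((B \<omega>)\<^sup>2) / 2))) = (CLINT t|?N. G t)"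
    unfolding gaussian_kernel_char G_def
    by (intro integral_swap_bounded prob_space_axioms N.prob_space_axioms) (auto simp: n)
  have EA: "(CLINT \<omega>|M. complex_of_real (exp (- ((A \<omega>)\<^sup>2) / 2))) = (CLINT t|?N. F t)"
    unfolding gaussian_kernel_char F_def
    by (intro integral_swap_bounded prob_space_axioms N.prob_space_axioms) (auto simp: n)
  have inner: "(CLINT \<omega>|M. iexp (s * A \<omega>) * complex_of_real (exp (- ((B \<omega>)\<^sup>2) / 2))) = F s * (CLINT t|?N. G t)" for s
  proof -
    have "(CLINT \<omega>|M. iexp (s * A \<omega>) * complex_of_real (exp (- ((B \<omega>)\<^sup>2) / 2))) =
        (CLINT \<omega>|M. CLINT t|?N. iexp (s * A \<omega>) * iexp (t * B \<omega>))"
      unfolding gaussian_kernel_char by simp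
    also have "\<dots> = (CLINT t|?N. CLINT \<omega>|M. iexp (s * A \<omega>) * iexp (t * B \<omega>))"
      by (intro integral_swap_bounded prob_space_axioms N.prob_space_axioms) (auto simp: n norm_mult)
    finally show ?thesis unfolding fac by simp
  qed
  have "(CLINT \<omega>|M. complex_of_real (exp (- ((A \<omega>)\<^sup>2) / 2)) * complex_of_real (exp (- ((B \<omega>)\<^sup>2) / 2))) =
      (CLINT \<omega>|M. CLINT s|?N. iexp (s * A \<omega>) * complex_of_real (exp (- ((B \<omega>)\<^sup>2) / 2)))"
    unfolding gaussian_kernel_char[of "A _"] by simp
  also have "\<dots> = (CLINT s|?N. CLINT \<omega>|M. iexp (s * A \<omega>) * complex_of_real (exp (- ((B \<omega>)\<^sup>2) / 2)))"
    by (intro integral_swap_bounded prob_space_axioms N.prob_space_axioms) (auto simp: n norm_mult)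
  also have "\<dots> = (CLINT s|?N. F s) * (CLINT t|?N. G t)"
    unfolding inner by simp
  finally have "(CLINT \<omega>|M. complex_of_real (exp (- ((A \<omega>)\<^sup>2) / 2)) * complex_of_real (exp (- ((B \<omega>)\<^sup>2) / 2))) =
     (CLINT \<omega>|M. complex_of_real (exp (- ((A \<omega>)\<^sup>2) / 2))) * (CLINT \<omega>|M. complex_of_real (exp (- ((B \<omega>)\<^sup>2) / 2)))"
    unfolding EA EB .
  then have "complex_of_real (expectation (\<lambda>\<omega>. exp (- ((A \<omega>)\<^sup>2) / 2) * exp (- ((B \<omega>)\<^sup>2) / 2))) =
     complex_of_real (expectation (\<lambda>\<omega>. exp (- ((A \<omega>)\<^sup>2) / 2)) * expectation (\<lambda>\<omega>. exp (- ((B \<omega>)\<^sup>2) / 2)))"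
    by (simp only: of_real_mult[symmetric] integral_complex_of_real)
  then show ?thesis unfolding A_def B_def of_real_eq_iff .
qed

text \<open>Up to the factor \<open>v sqrt (2 pi)\<close> the kernel is a normal density of variance
  \<open>v^2\<close>, so its mean is a convolution of two normal densities; for constant
  \<open>W\<close> it is a point evaluation, and the same formula holds with variance 0.\<close>

lemma (in prob_space) gaussian_expectation_kernel:
  assumes "gaussian_var M W" and v: "0 < v"
  shows "expectation (\<lambda>\<omega>. exp (- (((W \<omega> - w) / v)\<^sup>2) / 2)) =
    v / sqrt (v\<^sup>2 + var M W) * exp (- (w - expectation W)\<^sup>2 / (2 * (v\<^sup>2 + var M W)))"
proof -
  have [measurable]: "W \<in> borel_measurable M" using assms by (simp add: gaussian_var_def)
  define m where "m = expectation W"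
  have k: "exp (- (((a - w) / v)\<^sup>2) / 2) = v * sqrt (2 * pi) * normal_density 0 v (w - a)" for a
    using v by (simp add: normal_density_def real_sqrt_mult power_divide power2_commute)
  from assms(1) show ?thesis
  proof (cases rule: gaussian_var_cases)
    case (normal s)
    define S where "S = sqrt (v\<^sup>2 + s\<^sup>2)"
    have S: "S > 0" "S\<^sup>2 = v\<^sup>2 + s\<^sup>2" using v by (auto simp: S_def add_pos_nonneg)
    have "(\<integral>\<^sup>+\<omega>. ennreal (normal_density 0 v (w - W \<omega>)) \<partial>M) =
        (\<integral>\<^sup>+y. ennreal (normal_density m s y) * ennreal (normal_density 0 v (w - y)) \<partial>lborel)"
      using normal(3) unfolding m_def by (intro distributed_nn_integral[symmetric]) auto
    also have "\<dots> = (\<integral>\<^sup>+y. ennreal (normal_density m s (m + 1 * y)) * ennreal (normal_density 0 v (w - (m + 1 * y))) \<partial>lborel)"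
      by (subst nn_integral_real_affine[where c = 1 and t = m]) auto
    also have "\<dots> = (\<integral>\<^sup>+y. ennreal (normal_density 0 v ((w - m) - y) * normal_density 0 s y) \<partial>lborel)"
      by (intro nn_integral_cong) (auto simp: normal_density_def ennreal_mult[symmetric] algebra_simps)
    also have "\<dots> = ennreal (normal_density 0 S (w - m))"
      using fun_cong[OF conv_normal_density_zero_mean[OF v normal(1)], of "w - m"] by (simp add: S_def)
    finally have "expectation (\<lambda>\<omega>. normal_density 0 v (w - W \<omega>)) = normal_density 0 S (w - m)"
      by (subst integral_eq_nn_integral) (auto simp: normal_density_nonneg)
    then have "expectation (\<lambda>\<omega>. exp (- (((W \<omega> - w) / v)\<^sup>2) / 2)) = v * sqrt (2 * pi) * normal_density 0 S (w - m)"
      unfolding k by (simp only: integral_mult_right_zero)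
    also have "\<dots> = v / S * exp (- (w - m)\<^sup>2 / (2 * S\<^sup>2))"
      using S(1) by (simp add: normal_density_def real_sqrt_mult)
    finally show ?thesis
      unfolding normal(2) S(2)[symmetric] m_def[symmetric] using S(1) by simp
  next
    case const
    have "expectation (\<lambda>\<omega>. exp (- (((W \<omega> - w) / v)\<^sup>2) / 2)) = expectation (\<lambda>\<omega>. exp (- (((m - w) / v)\<^sup>2) / 2))"
    proof (rule integral_cong_AE)
      show "AE \<omega> in M. exp (- (((W \<omega> - w) / v)\<^sup>2) / 2) = exp (- (((m - w) / v)\<^sup>2) / 2)"
        using const(2) by eventually_elim (simp add: m_def)
    qed auto
    then show ?thesis using v const(1)
      by (simp add: prob_space m_def[symmetric] power_divide power2_commute[of m w])
  qed
qed

section \<open>Two-point and one-point probabilities of a component\<close>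

lemma power_le_fact_exp:
  fixes x :: real
  assumes "0 \<le> x"
  shows "x ^ n \<le> fact n * exp x"
proof -
  have "(\<Sum>k\<in>{n}. x ^ k /\<^sub>R fact k) \<le> (\<Sum>k. x ^ k /\<^sub>R fact k)"
    using assms by (intro sum_le_suminf summable_exp_generic) auto
  then have "x ^ n / fact n \<le> exp x"
    by (simp add: exp_def divide_inverse mult.commute)
  then show ?thesis by (simp add: field_simps)
qed

text \<open>After \<open>t^n \<le> n! exp t\<close>, the quadratic exponent absorbs the linear one:
  \<open>u - u^2 / 2 \<le> 1 / 2\<close>.\<close>

lemma gaussian_tail_power:
  fixes t u K :: real
  assumes "0 \<le> t" "t \<le> u + K"
  shows "exp (- (u\<^sup>2) / 2) * t ^ n \<le> fact n * exp (K + 1 / 2)"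
proof -
  have "t ^ n \<le> fact n * exp t" using assms by (intro power_le_fact_exp)
  also have "\<dots> \<le> fact n * exp (u + K)" using assms by simp
  finally have "exp (- (u\<^sup>2) / 2) * t ^ n \<le> exp (- (u\<^sup>2) / 2) * (fact n * exp (u + K))"
    by (intro mult_left_mono) auto
  also have "\<dots> = fact n * exp (- (u\<^sup>2) / 2 + (u + K))"
    by (simp only: exp_add mult_ac)
  also have "- (u\<^sup>2) / 2 + (u + K) \<le> K + 1 / 2"
    using zero_le_power2[of "u - 1"] by (simp add: power2_eq_square algebra_simps)
  finally show ?thesis by simp
qed

text \<open>The residual \<open>W = Y - \<beta> X\<close> is uncorrelated with \<open>X\<close>.
  Dominating the indicators by Gaussian bells makes the joint mean factorise without any density,
  even if \<open>W\<close> is constant. The bell for \<open>W\<close>, of width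
  \<open>\<kappa> \<epsilon>\<close>, adds its square to the residual variance; this is the origin
  of \<open>S\<close>.\<close>

lemma (in prob_space) gaussian_two_point:
  assumes lin: "\<And>g h. gaussian_var M (\<lambda>\<omega>. g * X \<omega> + h * Y \<omega>)"
    and pos: "0 < var M X" and \<epsilon>: "0 < \<epsilon>"
  defines "\<beta> \<equiv> cov M X Y / var M X"
  assumes \<kappa>: "1 + \<bar>\<beta>\<bar> \<le> \<kappa>"
  defines "S \<equiv> sqrt ((\<kappa> * \<epsilon>)\<^sup>2 + (var M Y - \<beta>\<^sup>2 * var M X))"
  shows "prob {\<omega>\<in>space M. \<bar>X \<omega> - z\<bar> < \<epsilon> \<and> \<bar>Y \<omega> - z'\<bar> < \<epsilon>} \<le>
    exp 1 * (\<epsilon> / sqrt (var M X)) * (\<kappa> * \<epsilon> / S *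
      exp (- (z' - expectation Y - \<beta> * (z - expectation X))\<^sup>2 / (2 * S\<^sup>2)))"
    and "0 \<le> var M Y - \<beta>\<^sup>2 * var M X"
proof -
  have X: "gaussian_var M X" and Y: "gaussian_var M Y" using lin[of 1 0] lin[of 0 1] by simp_all
  have [measurable]: "X \<in> borel_measurable M" "Y \<in> borel_measurable M"
    using X Y by (simp_all add: gaussian_var_def)
  note iX = gaussian_var_integrable[OF X] and iY = gaussian_var_integrable[OF Y]
  define W where "W \<omega> = - \<beta> * X \<omega> + 1 * Y \<omega>" for \<omega>
  have [measurable]: "W \<in> borel_measurable M" unfolding W_def by measurable
  have W: "gaussian_var M W" unfolding W_def by (rule lin)
  have covW: "cov M X W = 0"
    unfolding W_def var_cov_linear(2)[OF X Y] using pos by (simp add: \<beta>_def)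
  have varW: "var M W = var M Y - \<beta>\<^sup>2 * var M X"
    unfolding W_def var_cov_linear(1)[OF X Y] using pos by (simp add: \<beta>_def power2_eq_square field_simps)
  have meanW: "expectation W = expectation Y - \<beta> * expectation X"
    unfolding W_def using iX iY by simp
  have "0 \<le> var M W" unfolding var_def by simp
  then show "0 \<le> var M Y - \<beta>\<^sup>2 * var M X" by (simp add: varW)
  have lin': "gaussian_var M (\<lambda>\<omega>. g * X \<omega> + h * W \<omega>)" for g h
  proof -
    have "(\<lambda>\<omega>. g * X \<omega> + h * W \<omega>) = (\<lambda>\<omega>. (g - h * \<beta>) * X \<omega> + h * Y \<omega>)"
      by (auto simp: W_def algebra_simps)
    then show ?thesis using lin by simp
  qed
  define w where "w = z' - \<beta> * z"
  define v where "v = \<kappa> * \<epsilon>"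
  have v: "0 < v" using \<epsilon> \<kappa> unfolding v_def by (intro mult_pos_pos) auto
  have S: "S = sqrt (v\<^sup>2 + var M W)" by (simp add: S_def v_def varW)
  have "prob {\<omega>\<in>space M. \<bar>X \<omega> - z\<bar> < \<epsilon> \<and> \<bar>Y \<omega> - z'\<bar> < \<epsilon>} =
      expectation (\<lambda>\<omega>. indicator {\<omega>\<in>space M. \<bar>X \<omega> - z\<bar> < \<epsilon> \<and> \<bar>Y \<omega> - z'\<bar> < \<epsilon>} \<omega>)"
    by simp
  \<comment> \<open>On the event \<open>W\<close> is within
    \<open>(1 + |\<beta>|) \<epsilon>\<close> of \<open>w = z' - \<beta> z\<close>, so both
    arguments are at most 1 in absolute value and each bell is at least
    \<open>exp (- 1 / 2)\<close>. The factor \<open>exp 1\<close> compensates for this.\<close>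
  also have "\<dots> \<le> expectation (\<lambda>\<omega>. exp 1 * (exp (- (((X \<omega> - z) / \<epsilon>)\<^sup>2) / 2) * exp (- (((W \<omega> - w) / v)\<^sup>2) / 2)))"
  proof (rule integral_mono)
    fix \<omega>
    show "(indicator {\<omega>\<in>space M. \<bar>X \<omega> - z\<bar> < \<epsilon> \<and> \<bar>Y \<omega> - z'\<bar> < \<epsilon>} \<omega> :: real) \<le>
      exp 1 * (exp (- (((X \<omega> - z) / \<epsilon>)\<^sup>2) / 2) * exp (- (((W \<omega> - w) / v)\<^sup>2) / 2))"
    proof (cases "\<bar>X \<omega> - z\<bar> < \<epsilon> \<and> \<bar>Y \<omega> - z'\<bar> < \<epsilon>")
      case True
      have "\<bar>W \<omega> - w\<bar> = \<bar>(Y \<omega> - z') - \<beta> * (X \<omega> - z)\<bar>"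
        by (simp add: W_def w_def algebra_simps)
      also have "\<dots> \<le> \<bar>Y \<omega> - z'\<bar> + \<bar>\<beta>\<bar> * \<bar>X \<omega> - z\<bar>"
        by (metis abs_mult abs_triangle_ineq4)
      also have "\<dots> \<le> \<epsilon> + \<bar>\<beta>\<bar> * \<epsilon>"
        using True by (intro add_mono mult_left_mono) auto
      also have "\<dots> \<le> v"
        using mult_right_mono[OF \<kappa>, of \<epsilon>] \<epsilon> by (simp add: v_def algebra_simps)
      finally have "((W \<omega> - w) / v)\<^sup>2 \<le> 1"
        using v by (simp add: abs_square_le_1 abs_divide)
      moreover have "((X \<omega> - z) / \<epsilon>)\<^sup>2 \<le> 1"
        using True \<epsilon> by (simp add: abs_square_le_1 abs_divide)
      ultimately have "0 \<le> 1 + - (((X \<omega> - z) / \<epsilon>)\<^sup>2) / 2 + - (((W \<omega> - w) / v)\<^sup>2) / 2" by simp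
      then have "1 \<le> exp (1 + - (((X \<omega> - z) / \<epsilon>)\<^sup>2) / 2 + - (((W \<omega> - w) / v)\<^sup>2) / 2)"
        by (simp only: one_le_exp_iff)
      then show ?thesis by (simp only: exp_add mult.assoc) (simp add: indicator_def)
    qed auto
  next
    show "integrable M (\<lambda>\<omega>. exp 1 * (exp (- (((X \<omega> - z) / \<epsilon>)\<^sup>2) / 2) * exp (- (((W \<omega> - w) / v)\<^sup>2) / 2)))"
      by (intro integrable_mult_right integrable_const_bound[of _ 1]) (auto simp: exp_add[symmetric])
    show "integrable M (indicat_real {\<omega> \<in> space M. \<bar>X \<omega> - z\<bar> < \<epsilon> \<and> \<bar>Y \<omega> - z'\<bar> < \<epsilon>})"
      by (intro integrable_real_indicator) (measurable, simp add: emeasure_eq_measure)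
  qed
  also have "\<dots> = exp 1 * (expectation (\<lambda>\<omega>. exp (- (((X \<omega> - z) / \<epsilon>)\<^sup>2) / 2)) * expectation (\<lambda>\<omega>. exp (- (((W \<omega> - w) / v)\<^sup>2) / 2)))"
    using gaussian_uncorrelated_kernel[OF lin' covW, of z \<epsilon> w v] by simp
  also have "expectation (\<lambda>\<omega>. exp (- (((W \<omega> - w) / v)\<^sup>2) / 2)) = v / S * exp (- (w - expectation W)\<^sup>2 / (2 * S\<^sup>2))"
    unfolding gaussian_expectation_kernel[OF W v] S using \<open>0 \<le> var M W\<close> by simp
  finally have le: "prob {\<omega>\<in>space M. \<bar>X \<omega> - z\<bar> < \<epsilon> \<and> \<bar>Y \<omega> - z'\<bar> < \<epsilon>} \<le>
    exp 1 * (expectation (\<lambda>\<omega>. exp (- (((X \<omega> - z) / \<epsilon>)\<^sup>2) / 2)) * (v / S * exp (- (w - expectation W)\<^sup>2 / (2 * S\<^sup>2))))" .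
  have "expectation (\<lambda>\<omega>. exp (- (((X \<omega> - z) / \<epsilon>)\<^sup>2) / 2)) \<le> \<epsilon> / sqrt (var M X)"
  proof -
    have "expectation (\<lambda>\<omega>. exp (- (((X \<omega> - z) / \<epsilon>)\<^sup>2) / 2)) \<le> \<epsilon> / sqrt (\<epsilon>\<^sup>2 + var M X) * 1"
      unfolding gaussian_expectation_kernel[OF X \<epsilon>] using pos \<epsilon> by (intro mult_left_mono) auto
    also have "\<dots> \<le> \<epsilon> / sqrt (var M X)"
      using pos \<epsilon> by (auto intro!: divide_left_mono mult_pos_pos add_pos_pos)
    finally show ?thesis .
  qed
  then have "exp 1 * (expectation (\<lambda>\<omega>. exp (- (((X \<omega> - z) / \<epsilon>)\<^sup>2) / 2)) * (v / S * exp (- (w - expectation W)\<^sup>2 / (2 * S\<^sup>2)))) \<le>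
      exp 1 * (\<epsilon> / sqrt (var M X) * (v / S * exp (- (w - expectation W)\<^sup>2 / (2 * S\<^sup>2))))"
    (is "_ \<le> ?R")
    using v \<open>0 \<le> var M W\<close> unfolding S by (intro mult_left_mono mult_right_mono) auto
  with le have "prob {\<omega>\<in>space M. \<bar>X \<omega> - z\<bar> < \<epsilon> \<and> \<bar>Y \<omega> - z'\<bar> < \<epsilon>} \<le> ?R"
    by (rule order_trans)
  moreover have "w - expectation W = z' - expectation Y - \<beta> * (z - expectation X)"
    by (simp add: w_def meanW algebra_simps)
  ultimately show "prob {\<omega>\<in>space M. \<bar>X \<omega> - z\<bar> < \<epsilon> \<and> \<bar>Y \<omega> - z'\<bar> < \<epsilon>} \<le>
    exp 1 * (\<epsilon> / sqrt (var M X)) * (\<kappa> * \<epsilon> / S *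
      exp (- (z' - expectation Y - \<beta> * (z - expectation X))\<^sup>2 / (2 * S\<^sup>2)))"
    unfolding v_def by (simp only: mult.assoc)
qed

text \<open>Here \<open>r\<close> is the covariance and \<open>\<delta>\<close> the variance of the
  difference. The slope satisfies \<open>1 - r / vx = (vx - vy + \<delta>) / (2 vx)\<close>; the
  residual variance is \<open>(vx vy - r^2) / vx\<close>, and 4 times its numerator equals
  \<open>\<delta> (2 (vx + vy) - \<delta>) - (vx - vy)^2\<close>.\<close>

lemma regression_bounds:
  fixes vx vy r \<delta> a b c1 c2 Q :: real
  assumes vx: "c1 \<le> vx" "vx \<le> c2" and vy: "c1 \<le> vy" and pos: "0 < c1" "0 < a" "0 < b" "0 < Q"
    and \<delta>: "\<delta> = vx + vy - 2 * r" "(a * Q)\<^sup>2 \<le> \<delta>" "\<delta> \<le> (b * Q)\<^sup>2"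
    and small: "(b * Q)\<^sup>2 \<le> c1" "\<bar>vx - vy\<bar> \<le> sqrt c1 * a * Q"
  shows "\<bar>1 - r / vx\<bar> \<le> (a + b) / (2 * sqrt c1) * Q" "\<bar>r / vx\<bar> \<le> 2"
    "(sqrt (c1 / (2 * c2)) * a * Q)\<^sup>2 \<le> vy - (r / vx)\<^sup>2 * vx"
proof -
  define s where "s = sqrt c1"
  have s: "s > 0" "s\<^sup>2 = c1" using pos by (simp_all add: s_def)
  have "b * Q \<le> s" using small(1) s pos by (auto intro: power2_le_imp_le)
  have "\<delta> \<ge> 0" using \<delta>(2) zero_le_power2[of "a * Q"] by linarith
  have "(a * Q)\<^sup>2 \<le> (b * Q)\<^sup>2" using \<delta> by linarith
  then have "a * Q \<le> b * Q" using pos by (auto intro: power2_le_imp_le)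
  have "(b * Q)\<^sup>2 \<le> s * (b * Q)"
    unfolding power2_eq_square using \<open>b * Q \<le> s\<close> pos by (intro mult_right_mono) auto
  then have d: "\<delta> \<le> s * b * Q" using \<delta>(3) by (simp add: mult.assoc)
  have "1 - r / vx = (vx - vy + \<delta>) / (2 * vx)"
    unfolding \<delta>(1) using vx pos by (simp add: field_simps)
  then have "\<bar>1 - r / vx\<bar> = \<bar>vx - vy + \<delta>\<bar> / (2 * vx)"
    using vx pos by (simp add: abs_divide)
  also have "\<dots> \<le> (s * a * Q + s * b * Q) / (2 * c1)"
    using d small(2) \<open>\<delta> \<ge> 0\<close> vx pos s unfolding s_def[symmetric] by (intro frac_le) auto
  also have "\<dots> = (a + b) / (2 * s) * Q"
    using s by (simp add: s(2)[symmetric] field_simps power2_eq_square)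
  finally show *: "\<bar>1 - r / vx\<bar> \<le> (a + b) / (2 * sqrt c1) * Q" by (simp add: s_def)
  have "(a + b) / (2 * s) * Q = (a * Q + b * Q) / (2 * s)" by (simp add: field_simps)
  also have "\<dots> \<le> 1" using \<open>a * Q \<le> b * Q\<close> \<open>b * Q \<le> s\<close> s by simp
  finally show "\<bar>r / vx\<bar> \<le> 2" using * by (simp add: s_def)
  have "vx - vy \<le> s * a * Q" "vy - vx \<le> s * a * Q" using small(2) by (auto simp: s_def)
  then have "\<bar>vx - vy\<bar>\<^sup>2 \<le> (s * a * Q)\<^sup>2" by (intro power_mono) auto
  then have D: "(vx - vy)\<^sup>2 \<le> c1 * (a * Q)\<^sup>2" by (simp add: s power_mult_distrib mult.assoc)
  have "2 * r = vx + vy - \<delta>" using \<delta>(1) by simp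
  then have "4 * r\<^sup>2 = (vx + vy - \<delta>)\<^sup>2" by (metis four_x_squared)
  then have id: "4 * (vx * vy - r\<^sup>2) = \<delta> * (2 * (vx + vy) - \<delta>) - (vx - vy)\<^sup>2"
    by (simp add: power2_eq_square algebra_simps)
  \<comment> \<open>The second factor is at least \<open>4 c1 - c1\<close>. Subtracting the squared
    variance difference, at most \<open>c1 (a Q)^2\<close>, leaves \<open>2 c1 (a Q)^2\<close>;
    division by 4 and by \<open>vx \<le> c2\<close> then yields the constant
    \<open>c1 / (2 c2)\<close>.\<close>
  have "(a * Q)\<^sup>2 * (3 * c1) \<le> \<delta> * (2 * (vx + vy) - \<delta>)"
    using \<delta>(2,3) \<open>\<delta> \<ge> 0\<close> small(1) vx vy pos by (intro mult_mono) auto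
  then have "(a * Q)\<^sup>2 * (2 * c1) \<le> 4 * (vx * vy - r\<^sup>2)"
    unfolding id using D by (simp add: algebra_simps)
  then have "(a * Q)\<^sup>2 * c1 / 2 \<le> vx * vy - r\<^sup>2" by simp
  then have "(a * Q)\<^sup>2 * c1 / 2 / vx \<le> (vx * vy - r\<^sup>2) / vx"
    using vx pos by (intro divide_right_mono) auto
  also have "(vx * vy - r\<^sup>2) / vx = vy - (r / vx)\<^sup>2 * vx"
    using vx pos by (simp add: field_simps power2_eq_square)
  finally have "(a * Q)\<^sup>2 * c1 / 2 / vx \<le> vy - (r / vx)\<^sup>2 * vx" .
  moreover have "(a * Q)\<^sup>2 * c1 / 2 / c2 \<le> (a * Q)\<^sup>2 * c1 / 2 / vx"
    using vx pos by (intro divide_left_mono) auto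
  moreover have "(sqrt (c1 / (2 * c2)) * a * Q)\<^sup>2 = (a * Q)\<^sup>2 * c1 / 2 / c2"
    using vx pos by (simp add: power_mult_distrib)
  ultimately show "(sqrt (c1 / (2 * c2)) * a * Q)\<^sup>2 \<le> vy - (r / vx)\<^sup>2 * vx" by linarith
qed

text \<open>Gaussian decay in \<open>|w| / S\<close> is traded for the power \<open>n\<close>. The
  displacement \<open>z' - z\<close> differs from \<open>w\<close> by at most \<open>L Q\<close>,
  and \<open>Q \<le> S / c\<close>, so this costs only \<open>exp (L / c)\<close>. While
  \<open>S\<close> depends on \<open>\<epsilon>\<close>, the constant \<open>H\<close> does
  not.\<close>

lemma (in prob_space) two_point_estimate:
  fixes n :: nat
  assumes lin: "\<And>g h. gaussian_var M (\<lambda>\<omega>. g * X \<omega> + h * Y \<omega>)"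
    and vx: "c1 \<le> var M X" "var M X \<le> c2" and vy: "c1 \<le> var M Y"
    and pos: "0 < c1" "0 < a" "0 < b" "0 < Q" "0 < \<epsilon>" and nonneg: "0 \<le> C0" "0 \<le> N" "0 \<le> B"
    and \<delta>: "(a * Q)\<^sup>2 \<le> var M (\<lambda>\<omega>. X \<omega> - Y \<omega>)" "var M (\<lambda>\<omega>. X \<omega> - Y \<omega>) \<le> (b * Q)\<^sup>2"
    and small: "(b * Q)\<^sup>2 \<le> c1" "\<bar>var M X - var M Y\<bar> \<le> sqrt c1 * a * Q"
    and mean: "\<bar>expectation X - expectation Y\<bar> \<le> C0 * Q" "\<bar>expectation X\<bar> \<le> B"
  defines "c \<equiv> sqrt (c1 / (2 * c2)) * a"
  defines "L \<equiv> C0 + (a + b) / (2 * sqrt c1) * (N + B)"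
  defines "H \<equiv> 3 * exp 1 / sqrt c1 * (fact n * exp (L / c + 1 / 2))"
  shows "\<exists>S. c * Q \<le> S \<and> 0 < S \<and> (\<forall>z z'. \<bar>z\<bar> \<le> N \<longrightarrow>
    prob {\<omega>\<in>space M. \<bar>X \<omega> - z\<bar> < \<epsilon> \<and> \<bar>Y \<omega> - z'\<bar> < \<epsilon>} \<le> H * \<epsilon>\<^sup>2 / S \<and>
    prob {\<omega>\<in>space M. \<bar>X \<omega> - z\<bar> < \<epsilon> \<and> \<bar>Y \<omega> - z'\<bar> < \<epsilon>} * \<bar>z - z'\<bar> ^ n \<le> H * \<epsilon>\<^sup>2 / S * S ^ n)"
proof -
  have X: "gaussian_var M X" and Y: "gaussian_var M Y" using lin[of 1 0] lin[of 0 1] by simp_all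
  define \<beta> where "\<beta> = cov M X Y / var M X"
  have "var M (\<lambda>\<omega>. X \<omega> - Y \<omega>) = var M X + var M Y - 2 * cov M X Y"
    using var_cov_linear(1)[OF X Y, of 1 "-1"] by simp
  note reg = regression_bounds[OF vx vy pos(1-4) this \<delta> small, folded \<beta>_def]
  \<comment> \<open>The 3 is the width \<open>\<kappa>\<close> of \<open>gaussian_two_point\<close>,
    as the slope is at most 2 in absolute value.\<close>
  define S where "S = sqrt ((3 * \<epsilon>)\<^sup>2 + (var M Y - \<beta>\<^sup>2 * var M X))"
  have "c2 > 0" using vx pos by linarith
  then have c: "c > 0" using pos by (simp add: c_def)
  have s2: "0 \<le> var M Y - \<beta>\<^sup>2 * var M X"
    using reg(3) zero_le_power2[of "sqrt (c1 / (2 * c2)) * a * Q"] by linarith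
  have S2: "S\<^sup>2 = (3 * \<epsilon>)\<^sup>2 + (var M Y - \<beta>\<^sup>2 * var M X)"
    unfolding S_def using s2 by (intro real_sqrt_pow2 add_nonneg_nonneg) auto
  have "(c * Q)\<^sup>2 \<le> S\<^sup>2"
    using reg(3) zero_le_power2[of "3 * \<epsilon>"] unfolding S2 c_def by linarith
  then have cS: "c * Q \<le> S"
    by (rule power2_le_imp_le) (use s2 in \<open>simp add: S_def\<close>)
  moreover have "0 < c * Q" using c pos by simp
  ultimately have S: "S > 0" by linarith
  have L: "L \<ge> 0" using pos nonneg by (simp add: L_def)
  have Q: "Q \<le> S / c" using cS c by (simp add: field_simps)
  define p where "p z z' = prob {\<omega>\<in>space M. \<bar>X \<omega> - z\<bar> < \<epsilon> \<and> \<bar>Y \<omega> - z'\<bar> < \<epsilon>}" for z z'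
  define T where "T = 3 * exp 1 / sqrt c1 * \<epsilon>\<^sup>2 / S"
  have T: "0 \<le> T" using S pos by (simp add: T_def)
  define G where "G = (fact n :: real) * exp (L / c + 1 / 2)"
  have HT: "H * \<epsilon>\<^sup>2 / S = T * G" by (simp add: H_def T_def G_def)
  have "1 \<le> exp (L / c + 1 / 2)" using L c by simp
  then have G: "1 \<le> G"
    unfolding G_def using mult_mono[of 1 "fact n :: real" 1 "exp (L / c + 1 / 2)"] by simp
  have "p z z' \<le> T * G \<and> p z z' * \<bar>z - z'\<bar> ^ n \<le> T * G * S ^ n" if z: "\<bar>z\<bar> \<le> N" for z z'
  proof -
    define w where "w = z' - expectation Y - \<beta> * (z - expectation X)"
    define E where "E = exp (- ((\<bar>w\<bar> / S)\<^sup>2) / 2)"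
    have E: "exp (- w\<^sup>2 / (2 * S\<^sup>2)) = E"
      unfolding E_def by (simp add: power_divide)
    have "p z z' \<le> exp 1 * (\<epsilon> / sqrt (var M X)) * (3 * \<epsilon> / S * E)"
      unfolding p_def E[symmetric] w_def S_def \<beta>_def
      using reg(2) vx pos by (intro gaussian_two_point(1)[OF lin]) (auto simp: \<beta>_def)
    also have "\<dots> \<le> exp 1 * (\<epsilon> / sqrt c1) * (3 * \<epsilon> / S * E)"
      using vx pos S by (intro mult_right_mono mult_left_mono divide_left_mono mult_pos_pos) (auto simp: E_def)
    also have "\<dots> = T * E" by (simp add: T_def power2_eq_square)
    finally have p: "p z z' \<le> T * E" .
    have "E \<le> 1" by (simp add: E_def)
    then have "T * E \<le> T * G" using T G by (intro mult_left_mono) auto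
    with p have 1: "p z z' \<le> T * G" by linarith
    \<comment> \<open>The error of the slope is multiplied by \<open>z - E X\<close>; boundedness of
      the targets by \<open>N\<close> keeps this product of order \<open>Q\<close>.\<close>
    have "z' - z = w - (expectation X - expectation Y) - (1 - \<beta>) * (z - expectation X)"
      by (simp add: w_def algebra_simps)
    then have "\<bar>z - z'\<bar> \<le> \<bar>w\<bar> + \<bar>expectation X - expectation Y\<bar> + \<bar>1 - \<beta>\<bar> * \<bar>z - expectation X\<bar>"
      unfolding abs_mult[symmetric] by linarith
    also have "\<dots> \<le> \<bar>w\<bar> + C0 * Q + (a + b) / (2 * sqrt c1) * Q * (N + B)"
      using mean z reg(1) pos nonneg by (intro add_mono mult_mono) auto
    also have "\<dots> = \<bar>w\<bar> + L * Q" by (simp add: L_def algebra_simps)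
    also have "\<dots> \<le> \<bar>w\<bar> + L * (S / c)" using Q L by (intro add_mono mult_left_mono) auto
    finally have "\<bar>z - z'\<bar> / S \<le> (\<bar>w\<bar> + L * (S / c)) / S"
      using S by (intro divide_right_mono) auto
    also have "\<dots> = \<bar>w\<bar> / S + L / c" using S by (simp add: field_simps)
    finally have "E * (\<bar>z - z'\<bar> / S) ^ n \<le> G"
      unfolding E_def G_def using S by (intro gaussian_tail_power) auto
    then have "E * \<bar>z - z'\<bar> ^ n \<le> G * S ^ n"
      using S by (simp add: power_divide field_simps)
    then have "T * (E * \<bar>z - z'\<bar> ^ n) \<le> T * (G * S ^ n)"
      using T by (intro mult_left_mono) auto
    moreover have "p z z' * \<bar>z - z'\<bar> ^ n \<le> T * E * \<bar>z - z'\<bar> ^ n"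
      using p by (intro mult_right_mono) auto
    ultimately show ?thesis using 1 by (simp add: mult.assoc)
  qed
  then have "\<forall>z z'. \<bar>z\<bar> \<le> N \<longrightarrow> p z z' \<le> T * G \<and> p z z' * \<bar>z - z'\<bar> ^ n \<le> T * G * S ^ n"
    by (intro allI impI)
  then show ?thesis using cS S unfolding p_def HT[symmetric] by (intro exI[of _ S] conjI)
qed

text \<open>The normal density is bounded below on the interval of length
  \<open>2 \<epsilon>\<close>, whose points are within \<open>N + 1 + B\<close> of the mean because
  \<open>\<epsilon> \<le> 1\<close>. A constant variable is excluded by \<open>c1\<close>.\<close>

lemma (in prob_space) one_point_estimate:
  assumes X: "gaussian_var M X" and vx: "c1 \<le> var M X" "var M X \<le> c2" "0 < c1"
    and mean: "\<bar>expectation X\<bar> \<le> B" and z: "\<bar>z\<bar> \<le> N" and \<epsilon>: "0 < \<epsilon>" "\<epsilon> \<le> 1"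
  shows "2 / sqrt (2 * pi * c2) * exp (- (N + 1 + B)\<^sup>2 / (2 * c1)) * \<epsilon> \<le> prob {\<omega>\<in>space M. \<bar>X \<omega> - z\<bar> < \<epsilon>}"
  using X
proof (cases rule: gaussian_var_cases)
  case const
  then show ?thesis using vx by simp
next
  case (normal s)
  have [measurable]: "X \<in> borel_measurable M" using X by (simp add: gaussian_var_def)
  define m where "m = expectation X"
  define l where "l = 1 / sqrt (2 * pi * c2) * exp (- (N + 1 + B)\<^sup>2 / (2 * c1))"
  have "0 < c2" using vx by linarith
  have l: "l \<le> normal_density m s x" if x: "x \<in> {z - \<epsilon><..<z + \<epsilon>}" for x
  proof -
    have "\<bar>x - m\<bar> \<le> \<bar>N + 1 + B\<bar>" using x mean z \<epsilon> unfolding m_def by (simp add: abs_le_iff)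
    then have "(x - m)\<^sup>2 \<le> (N + 1 + B)\<^sup>2" by (simp add: abs_le_square_iff)
    then have "(x - m)\<^sup>2 / (2 * s\<^sup>2) \<le> (N + 1 + B)\<^sup>2 / (2 * c1)"
      using vx normal by (intro frac_le) auto
    then show ?thesis
      unfolding l_def normal_density_def using vx normal \<open>0 < c2\<close>
      by (intro mult_mono divide_left_mono real_sqrt_le_mono) (auto intro!: mult_pos_pos)
  qed
  have "ennreal (l * (2 * \<epsilon>)) = ennreal l * emeasure lborel {z - \<epsilon><..<z + \<epsilon>}"
  proof -
    have "emeasure lborel {z - \<epsilon><..<z + \<epsilon>} = ennreal (2 * \<epsilon>)"
      using \<epsilon> by (subst emeasure_lborel_Ioo) auto
    moreover have "0 \<le> l" using \<open>0 < c2\<close> by (simp add: l_def)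
    ultimately show ?thesis using \<epsilon> by (simp only: ennreal_mult)
  qed
  also have "\<dots> = (\<integral>\<^sup>+x. ennreal l * indicator {z - \<epsilon><..<z + \<epsilon>} x \<partial>lborel)"
    by (rule nn_integral_cmult_indicator[symmetric]) auto
  also have "\<dots> \<le> (\<integral>\<^sup>+x. ennreal (normal_density m s x) * indicator {z - \<epsilon><..<z + \<epsilon>} x \<partial>lborel)"
    using l by (intro nn_integral_mono) (auto split: split_indicator intro!: ennreal_leI)
  also have "\<dots> = emeasure M (X -` {z - \<epsilon><..<z + \<epsilon>} \<inter> space M)"
    using normal(3) unfolding m_def by (intro distributed_emeasure[symmetric]) auto
  also have "X -` {z - \<epsilon><..<z + \<epsilon>} \<inter> space M = {\<omega>\<in>space M. \<bar>X \<omega> - z\<bar> < \<epsilon>}"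
    by auto
  finally show ?thesis by (simp add: emeasure_eq_measure l_def mult_ac)
qed

section \<open>Products over independent components\<close>

lemma (in prob_space) iid_components_prob:
  fixes X :: "'i \<Rightarrow> 'a \<Rightarrow> real ^ 'n"
  assumes iid: "iid_components M X" and A: "\<And>j. A j \<in> sets (\<Pi>\<^sub>M x\<in>UNIV. borel)"
  shows "prob {\<omega>\<in>space M. \<forall>j. (\<lambda>x. X x \<omega> $ j) \<in> A j} =
    (\<Prod>j\<in>UNIV. prob {\<omega>\<in>space M. (\<lambda>x. X x \<omega> $ k) \<in> A j})"
proof -
  have ind: "indep_vars (\<lambda>_. \<Pi>\<^sub>M x\<in>UNIV. borel) (\<lambda>j \<omega> x. X x \<omega> $ j) UNIV"
    and dist: "distr M (\<Pi>\<^sub>M x\<in>UNIV. borel) (\<lambda>\<omega> x. X x \<omega> $ j) = distr M (\<Pi>\<^sub>M x\<in>UNIV. borel) (\<lambda>\<omega> x. X x \<omega> $ k)" for j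
    using iid unfolding iid_components_def by auto
  have rv: "(\<lambda>\<omega> x. X x \<omega> $ j) \<in> measurable M (\<Pi>\<^sub>M x\<in>UNIV. borel)" for j
    using ind unfolding indep_vars_def by auto
  have "{\<omega>\<in>space M. \<forall>j. (\<lambda>x. X x \<omega> $ j) \<in> A j} = (\<Inter>j\<in>UNIV. (\<lambda>\<omega> x. X x \<omega> $ j) -` A j \<inter> space M)"
    by auto
  then have "prob {\<omega>\<in>space M. \<forall>j. (\<lambda>x. X x \<omega> $ j) \<in> A j} =
      (\<Prod>j\<in>UNIV. prob ((\<lambda>\<omega> x. X x \<omega> $ j) -` A j \<inter> space M))"
    using indep_varsD_finite[OF ind _ _ A] by simp
  also have "\<dots> = (\<Prod>j\<in>UNIV. prob {\<omega>\<in>space M. (\<lambda>x. X x \<omega> $ k) \<in> A j})"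
  proof (rule prod.cong)
    fix j
    have "prob ((\<lambda>\<omega> x. X x \<omega> $ j) -` A j \<inter> space M) = measure (distr M (\<Pi>\<^sub>M x\<in>UNIV. borel) (\<lambda>\<omega> x. X x \<omega> $ j)) (A j)"
      by (rule measure_distr[OF rv A, symmetric])
    also have "\<dots> = prob ((\<lambda>\<omega> x. X x \<omega> $ k) -` A j \<inter> space M)"
      unfolding dist[of j] by (rule measure_distr[OF rv A])
    also have "(\<lambda>\<omega> x. X x \<omega> $ k) -` A j \<inter> space M = {\<omega>\<in>space M. (\<lambda>x. X x \<omega> $ k) \<in> A j}"
      by auto
    finally show "prob ((\<lambda>\<omega> x. X x \<omega> $ j) -` A j \<inter> space M) = prob {\<omega>\<in>space M. (\<lambda>x. X x \<omega> $ k) \<in> A j}" .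
  qed simp
  finally show ?thesis .
qed

text \<open>Applied with \<open>x = y\<close> and \<open>z = z'\<close>, it also yields the
  one-point product formula.\<close>

lemma (in prob_space) iid_components_two_point:
  fixes X :: "'i \<Rightarrow> 'a \<Rightarrow> real ^ 'n"
  assumes iid: "iid_components M X"
  shows "prob {\<omega>\<in>space M. \<forall>j. \<bar>X x \<omega> $ j - z $ j\<bar> < \<epsilon> \<and> \<bar>X y \<omega> $ j - z' $ j\<bar> < \<epsilon>} =
    (\<Prod>j\<in>UNIV. prob {\<omega>\<in>space M. \<bar>X x \<omega> $ k - z $ j\<bar> < \<epsilon> \<and> \<bar>X y \<omega> $ k - z' $ j\<bar> < \<epsilon>})"
proof -
  have "{\<phi>\<in>space (\<Pi>\<^sub>M x\<in>UNIV. borel). \<bar>\<phi> x - z $ j\<bar> < \<epsilon> \<and> \<bar>\<phi> y - z' $ j\<bar> < \<epsilon>} \<in> sets (\<Pi>\<^sub>M (x :: 'i)\<in>UNIV. borel)" for j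
    by measurable
  from iid_components_prob[OF iid this, where k = k] show ?thesis by (simp add: space_PiM)
qed

text \<open>The single factor \<open>p j\<close> absorbs the whole power of \<open>t\<close>; each
  of the others is bounded by \<open>T\<close>.\<close>

lemma prod_le_with_power:
  fixes p :: "'n::finite \<Rightarrow> real"
  assumes p: "\<And>j. 0 \<le> p j" "\<And>j. p j \<le> T" and j: "p j * t ^ CARD('n) \<le> T * S ^ CARD('n)" and t: "0 \<le> t"
  shows "prod p UNIV * t ^ CARD('n) \<le> (T * S) ^ CARD('n)"
proof -
  have T: "0 \<le> T" using p[of j] by linarith
  have "prod p UNIV = p j * prod p (UNIV - {j})"
    by (simp add: prod.remove)
  moreover have "prod p (UNIV - {j}) \<le> (\<Prod>_\<in>UNIV - {j}. T)"
    using p by (intro prod_mono) auto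
  moreover have "(\<Prod>_\<in>UNIV - {j}. T) = T ^ (CARD('n) - 1)"
    by (simp add: card_Diff_singleton)
  ultimately have "prod p UNIV * t ^ CARD('n) \<le> (p j * t ^ CARD('n)) * T ^ (CARD('n) - 1)"
    using p t by (simp add: mult_left_mono mult_ac)
  also have "\<dots> \<le> (T * S ^ CARD('n)) * T ^ (CARD('n) - 1)"
    using j T by (intro mult_right_mono) auto
  also have "\<dots> = (T * S) ^ CARD('n)"
    using power_Suc[of T "CARD('n) - 1"] by (simp add: power_mult_distrib mult_ac)
  finally show ?thesis .
qed

section \<open>Gauge functions and radial integrals\<close>

lemma emeasure_cball_annulus:
  fixes x R :: real
  assumes "0 \<le> R"
  shows "emeasure lborel (cball (0 :: 'a::euclidean_space) R \<inter> {w. x < norm w}) =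
    ennreal (unit_ball_vol DIM('a) * R ^ DIM('a) - unit_ball_vol DIM('a) * min R (max x 0) ^ DIM('a))"
proof (cases "0 \<le> x")
  case True
  define y where "y = min R x"
  have y: "0 \<le> y" "y \<le> R" using True assms by (auto simp: y_def)
  have "cball (0 :: 'a) R \<inter> {w. x < norm w} = cball 0 R - cball 0 y"
    by (auto simp: y_def)
  moreover have "emeasure lborel (cball (0 :: 'a) R - cball 0 y) = emeasure lborel (cball (0 :: 'a) R) - emeasure lborel (cball (0 :: 'a) y)"
    using y by (intro emeasure_Diff) (auto simp: emeasure_cball)
  ultimately show ?thesis
    using y True by (simp add: emeasure_cball y_def[symmetric] ennreal_minus max_def)
next
  case False
  then have "cball (0 :: 'a) R \<inter> {w. x < norm w} = cball 0 R"
    by auto (smt (verit) norm_ge_zero)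
  then show ?thesis using assms False by (simp add: emeasure_cball max_def min_def zero_power)
qed

text \<open>The image of Lebesgue measure under the norm is determined by its values on half-lines,
  that is, by volumes of annuli. Restricting to a ball keeps these finite, as the uniqueness of
  measures requires.\<close>

lemma nn_integral_radial:
  fixes h :: "real \<Rightarrow> ennreal"
  assumes [measurable]: "h \<in> borel_measurable borel" and R: "0 \<le> R"
  shows "(\<integral>\<^sup>+w. h (norm w) * indicator (cball (0 :: 'a::euclidean_space) R) w \<partial>lborel) =
    (\<integral>\<^sup>+\<rho>. h \<rho> * (ennreal (unit_ball_vol DIM('a) * (DIM('a) * \<rho> ^ (DIM('a) - 1))) * indicator {0..R} \<rho>) \<partial>lborel)"
proof -
  define V where "V = unit_ball_vol DIM('a)"
  have V: "0 \<le> V" by (simp add: V_def)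
  define m where "m = density lborel (indicator (cball (0 :: 'a) R) :: 'a \<Rightarrow> ennreal)"
  define f where "f \<rho> = V * (DIM('a) * \<rho> ^ (DIM('a) - 1))" for \<rho> :: real
  have "distr m borel norm = density lborel (\<lambda>\<rho>. ennreal (f \<rho>) * indicator {0..R} \<rho>)"
  proof (rule measure_eqI_lessThan)
    fix x :: real
    have 1: "emeasure (distr m borel norm) {x<..} = ennreal (V * R ^ DIM('a) - V * min R (max x 0) ^ DIM('a))"
    proof -
      have "emeasure (distr m borel norm) {x<..} = emeasure m {w. x < norm w}"
        by (subst emeasure_distr) (auto simp: m_def vimage_def)
      also have "\<dots> = emeasure lborel (cball 0 R \<inter> {w :: 'a. x < norm w})"
      proof -
        have [measurable]: "cball (0 :: 'a) R \<in> sets borel" "{w :: 'a. x < norm w} \<in> sets borel"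
          by (auto intro!: borel_open open_Collect_less continuous_intros)
        have "emeasure m {w. x < norm w} = (\<integral>\<^sup>+w. indicator (cball (0 :: 'a) R) w * indicator {w. x < norm w} w \<partial>lborel)"
          unfolding m_def by (rule emeasure_density) simp_all
        also have "\<dots> = (\<integral>\<^sup>+w. indicator (cball (0 :: 'a) R \<inter> {w. x < norm w}) w \<partial>lborel)"
          by (simp add: indicator_inter_arith)
        also have "\<dots> = emeasure lborel (cball 0 R \<inter> {w :: 'a. x < norm w})"
          by (rule nn_integral_indicator) simp
        finally show ?thesis .
      qed
      finally show ?thesis using emeasure_cball_annulus[OF R, where 'a='a] by (simp add: V_def)
    qed
    then show "emeasure (distr m borel norm) {x<..} < \<infinity>" by simp
    define y where "y = min R (max x 0)"
    have y: "0 \<le> y" "y \<le> R" using R by (auto simp: y_def)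
    have "emeasure (density lborel (\<lambda>\<rho>. ennreal (f \<rho>) * indicator {0..R} \<rho>)) {x<..} =
        (\<integral>\<^sup>+\<rho>. ennreal (f \<rho>) * indicator {0..R} \<rho> * indicator {x<..} \<rho> \<partial>lborel)"
      by (subst emeasure_density) (auto simp: f_def)
    also have "\<dots> = (\<integral>\<^sup>+\<rho>. ennreal (f \<rho>) * indicator {y..R} \<rho> \<partial>lborel)"
    proof (rule nn_integral_cong_AE)
      have "AE \<rho> in lborel. \<rho> \<noteq> y" by (rule AE_lborel_singleton)
      then show "AE \<rho> in lborel. ennreal (f \<rho>) * indicator {0..R} \<rho> * indicator {x<..} \<rho> = ennreal (f \<rho>) * indicator {y..R} \<rho>"
        by eventually_elim (auto simp: y_def min_def max_def split: split_indicator if_splits)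
    qed
    also have "\<dots> = ennreal (V * R ^ DIM('a) - V * y ^ DIM('a))"
      using y V by (intro nn_integral_FTC_Icc) (auto simp: f_def intro!: derivative_eq_intros)
    finally show "emeasure (distr m borel norm) {x<..} = emeasure (density lborel (\<lambda>\<rho>. ennreal (f \<rho>) * indicator {0..R} \<rho>)) {x<..}"
      using 1 by (simp add: y_def)
  qed auto
  then have "(\<integral>\<^sup>+\<rho>. h \<rho> \<partial>distr m borel norm) = (\<integral>\<^sup>+\<rho>. h \<rho> \<partial>density lborel (\<lambda>\<rho>. ennreal (f \<rho>) * indicator {0..R} \<rho>))"
    by simp
  also have "\<dots> = (\<integral>\<^sup>+\<rho>. (ennreal (f \<rho>) * indicator {0..R} \<rho>) * h \<rho> \<partial>lborel)"
    unfolding f_def by (rule nn_integral_density) simp_all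
  also have "(\<integral>\<^sup>+\<rho>. h \<rho> \<partial>distr m borel norm) = (\<integral>\<^sup>+w. h (norm w) \<partial>m)"
    by (rule nn_integral_distr) (simp_all add: m_def)
  also have "\<dots> = (\<integral>\<^sup>+w. indicator (cball (0 :: 'a) R) w * h (norm w) \<partial>lborel)"
  proof -
    have [measurable]: "cball (0 :: 'a) R \<in> sets borel" by simp
    show ?thesis unfolding m_def by (rule nn_integral_density) simp_all
  qed
  finally show ?thesis by (simp add: f_def V_def mult_ac)
qed

section \<open>The functions \<open>q\<close>, \<open>v_q\<close> and \<open>g_q\<close>\<close>

lemma
  assumes "gauge_function q"
  shows gauge_pos: "0 < \<rho> \<Longrightarrow> 0 < q \<rho>" and gauge_mono: "0 \<le> \<rho> \<Longrightarrow> \<rho> \<le> \<sigma> \<Longrightarrow> q \<rho> \<le> q \<sigma>"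
    and gauge_nonneg: "0 \<le> \<rho> \<Longrightarrow> 0 \<le> q \<rho>"
proof -
  have q: "q 0 = 0" "strict_mono_on {0..} q" using assms by (auto simp: gauge_function_def)
  show "0 < \<rho> \<Longrightarrow> 0 < q \<rho>" using strict_mono_onD[OF q(2), of 0 \<rho>] q(1) by simp
  then show "0 \<le> \<rho> \<Longrightarrow> 0 \<le> q \<rho>" using q(1) by (cases "\<rho> = 0") auto
  show "0 \<le> \<rho> \<Longrightarrow> \<rho> \<le> \<sigma> \<Longrightarrow> q \<rho> \<le> q \<sigma>"
    using strict_mono_onD[OF q(2), of \<rho> \<sigma>] by (cases "\<rho> = \<sigma>") auto
qed

lemma gauge_invD:
  assumes q: "gauge_function q"
  shows gauge_inv_right: "0 \<le> \<tau> \<Longrightarrow> q (gauge_inv q \<tau>) = \<tau>" and gauge_inv_nonneg: "0 \<le> \<tau> \<Longrightarrow> 0 \<le> gauge_inv q \<tau>"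
    and gauge_inv_pos: "0 < \<tau> \<Longrightarrow> 0 < gauge_inv q \<tau>"
    and gauge_inv_le_iff: "0 \<le> \<tau> \<Longrightarrow> 0 \<le> \<rho> \<Longrightarrow> gauge_inv q \<tau> \<le> \<rho> \<longleftrightarrow> \<tau> \<le> q \<rho>"
proof -
  have im: "q ` {0..} = {0..}" and q0: "q 0 = 0" and sm: "strict_mono_on {0..} q" using q by (auto simp: gauge_function_def)
  show r: "q (gauge_inv q \<tau>) = \<tau>" if "0 \<le> \<tau>" for \<tau>
    unfolding gauge_inv_def using im that by (intro f_inv_into_f) auto
  show n: "0 \<le> gauge_inv q \<tau>" if "0 \<le> \<tau>" for \<tau>
    using inv_into_into[of \<tau> q "{0..}"] im that unfolding gauge_inv_def by auto
  show "0 < \<tau> \<Longrightarrow> 0 < gauge_inv q \<tau>" using r[of \<tau>] n[of \<tau>] q0 by (cases "gauge_inv q \<tau> = 0") auto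
  show "gauge_inv q \<tau> \<le> \<rho> \<longleftrightarrow> \<tau> \<le> q \<rho>" if "0 \<le> \<tau>" "0 \<le> \<rho>"
    using r[of \<tau>] n[of \<tau>] that gauge_mono[OF q, of "gauge_inv q \<tau>" \<rho>] strict_mono_onD[OF sm, of \<rho> "gauge_inv q \<tau>"]
    by (metis atLeast_iff linorder_not_le order_less_le_trans order_less_irrefl)
qed

text \<open>Nothing is known of \<open>q\<close> on negative arguments, hence the truncation by
  \<open>max 0\<close>. The inverse is measurable because it is monotone.\<close>

lemma gauge_measurable:
  assumes "gauge_function q"
  shows "(\<lambda>\<rho>. q (max 0 \<rho>)) \<in> borel_measurable borel" "(\<lambda>\<tau>. gauge_inv q (max 0 \<tau>)) \<in> borel_measurable borel"
proof -
  have "continuous_on UNIV (\<lambda>\<rho>. q (max 0 \<rho>))"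
    using assms by (intro continuous_on_compose2[of "{0..}" q UNIV "\<lambda>\<rho>. max 0 \<rho>"] continuous_intros) (auto simp: gauge_function_def)
  then show "(\<lambda>\<rho>. q (max 0 \<rho>)) \<in> borel_measurable borel"
    by (rule borel_measurable_continuous_onI)
  have "mono (\<lambda>\<tau>. gauge_inv q (max 0 \<tau>))"
  proof (rule monoI)
    fix x y :: real assume "x \<le> y"
    then show "gauge_inv q (max 0 x) \<le> gauge_inv q (max 0 y)"
      using gauge_invD[OF assms] by (subst gauge_inv_le_iff[OF assms]) auto
  qed
  then show "(\<lambda>\<tau>. gauge_inv q (max 0 \<tau>)) \<in> borel_measurable borel"
    by (rule borel_measurable_mono)
qed

text \<open>Under \<open>gauge_inv q \<tau> \<le> R\<close> the oriented integral runs forwards,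
  over an interval that stays away from 0, where the integrand could be singular.\<close>

lemma gauge_v_eq_nn_integral:
  assumes q: "gauge_function q" and \<tau>: "0 < \<tau>" "gauge_inv q \<tau> \<le> R"
  shows "ennreal (gauge_v q d D R \<tau>) = (\<integral>\<^sup>+\<rho>. ennreal (\<rho> ^ (d - 1) / q \<rho> ^ D) * indicator {gauge_inv q \<tau>..R} \<rho> \<partial>lborel)"
    and "0 \<le> gauge_v q d D R \<tau>"
proof -
  define r where "r = gauge_inv q \<tau>"
  have r: "0 < r" "r \<le> R" using gauge_inv_pos[OF q] \<tau> by (auto simp: r_def)
  have v: "gauge_v q d D R \<tau> = (LBINT \<rho>:{r..R}. \<rho> ^ (d - 1) / q \<rho> ^ D)"
    unfolding gauge_v_def r_def[symmetric] using r by (simp add: interval_integral_Icc divide_inverse mult.commute)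
  have "continuous_on {r..R} q"
  proof (rule continuous_on_subset)
    show "continuous_on {0..} q" using q by (simp add: gauge_function_def)
    show "{r..R} \<subseteq> {0..}" using r by auto
  qed
  moreover have "\<forall>\<rho>\<in>{r..R}. q \<rho> ^ D \<noteq> 0"
  proof
    fix \<rho> assume "\<rho> \<in> {r..R}"
    then show "q \<rho> ^ D \<noteq> 0" using gauge_pos[OF q, of \<rho>] r by auto
  qed
  ultimately have "continuous_on {r..R} (\<lambda>\<rho>. \<rho> ^ (d - 1) / q \<rho> ^ D)"
    by (intro continuous_on_divide continuous_on_power continuous_on_id)
  then have "set_integrable lborel {r..R} (\<lambda>\<rho>. \<rho> ^ (d - 1) / q \<rho> ^ D)"
    by (rule borel_integrable_atLeastAtMost')
  moreover have nn: "0 \<le> \<rho> ^ (d - 1) / q \<rho> ^ D" if "\<rho> \<in> {r..R}" for \<rho>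
    using gauge_nonneg[OF q, of \<rho>] r that by auto
  ultimately have *: "(\<integral>\<^sup>+\<rho>. ennreal (indicator {r..R} \<rho> *\<^sub>R (\<rho> ^ (d - 1) / q \<rho> ^ D)) \<partial>lborel) = ennreal (gauge_v q d D R \<tau>)"
    unfolding v set_lebesgue_integral_def set_integrable_def
    by (intro nn_integral_eq_integral) (auto split: split_indicator)
  show "ennreal (gauge_v q d D R \<tau>) = (\<integral>\<^sup>+\<rho>. ennreal (\<rho> ^ (d - 1) / q \<rho> ^ D) * indicator {gauge_inv q \<tau>..R} \<rho> \<partial>lborel)"
  proof -
    have "ennreal (indicator {r..R} \<rho> *\<^sub>R (\<rho> ^ (d - 1) / q \<rho> ^ D)) = ennreal (\<rho> ^ (d - 1) / q \<rho> ^ D) * indicator {r..R} \<rho>" for \<rho>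
      by (auto split: split_indicator)
    then show "ennreal (gauge_v q d D R \<tau>) = (\<integral>\<^sup>+\<rho>. ennreal (\<rho> ^ (d - 1) / q \<rho> ^ D) * indicator {gauge_inv q \<tau>..R} \<rho> \<partial>lborel)"
      using * unfolding r_def[symmetric] by simp
  qed
  show "0 \<le> gauge_v q d D R \<tau>"
    unfolding v set_lebesgue_integral_def using nn by (intro Bochner_Integration.integral_nonneg) (auto split: split_indicator)
qed

lemma gauge_inv_left:
  assumes "gauge_function q" "0 \<le> \<rho>"
  shows "gauge_inv q (q \<rho>) = \<rho>"
proof -
  have "inj_on q {0..}"
    using assms by (intro strict_mono_on_imp_inj_on) (simp add: gauge_function_def)
  then show ?thesis unfolding gauge_inv_def using assms by (intro inv_into_f_f) auto
qed

lemma gauge_SUP_bound: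
  fixes F :: "real \<Rightarrow> real"
  assumes "(SUP \<tau>\<in>{0<..R}. ereal (F \<tau>)) \<in> {0<..<\<infinity>}"
  obtains S where "0 < S" "\<And>\<tau>. 0 < \<tau> \<Longrightarrow> \<tau> \<le> R \<Longrightarrow> F \<tau> \<le> S"
proof -
  define s where "s = (SUP \<tau>\<in>{0<..R}. ereal (F \<tau>))"
  obtain S where S: "s = ereal S" using assms unfolding s_def[symmetric] by (cases s) auto
  have "0 < S" using assms unfolding s_def[symmetric] S by simp
  moreover have "F \<tau> \<le> S" if "0 < \<tau>" "\<tau> \<le> R" for \<tau>
  proof -
    have "ereal (F \<tau>) \<le> s" unfolding s_def using that by (intro SUP_upper) auto
    then show ?thesis by (simp add: S)
  qed
  ultimately show thesis using that by blast
qed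

lemma gauge_g_pos:
  assumes "gauge_function q" "0 < \<tau>"
  shows "0 < gauge_g q d D \<tau>"
  unfolding gauge_g_def using assms gauge_inv_pos by (intro divide_pos_pos) auto

text \<open>With \<open>V(r)\<close> the integral from \<open>r\<close> and \<open>G(r) = r^d / q(r)^D\<close>, the hypothesis reads
  \<open>V \<le> S G\<close>, while \<open>V' = - G / r\<close>. So \<open>G\<close> is bounded below near \<open>0\<close>, hence \<open>V\<close> grows at
  least like \<open>ln (1 / r)\<close>, and so does \<open>G\<close>.\<close>

lemma recip_gauge_tendsto_top:
  assumes q: "gauge_function q" and S: "0 < S" and R: "0 < R" and d: "0 < d"
    and bound: "\<And>\<tau>. 0 < \<tau> \<Longrightarrow> \<tau> \<le> R \<Longrightarrow> gauge_v q d D R \<tau> * gauge_g q d D \<tau> \<le> S"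
  shows "((\<lambda>\<tau>. ennreal (1 / gauge_g q d D \<tau>)) \<longlongrightarrow> \<infinity>) (at_right 0)"
proof -
  define G where "G r = r ^ d / q r ^ D" for r
  define V where "V r = gauge_v q d D R (q r)" for r
  define I where "I \<rho> = \<rho> ^ (d - 1) / q \<rho> ^ D" for \<rho>
  \<comment> \<open>Up to \<open>gauge_inv q R\<close> the hypothesis can be applied with
    \<open>\<tau> = q r\<close>; staying below \<open>R / 2\<close> leaves a nontrivial interval of
    integration, so that \<open>V r2\<close> is positive.\<close>
  define r2 where "r2 = min (gauge_inv q R) (R / 2)"
  have r2: "0 < r2" "r2 < R" "r2 \<le> gauge_inv q R" using gauge_inv_pos[OF q R] R by (auto simp: r2_def)
  have V: "ennreal (V r) = (\<integral>\<^sup>+\<rho>. ennreal (I \<rho>) * indicator {r..R} \<rho> \<partial>lborel)" "0 \<le> V r" if "0 < r" "r \<le> r2" for r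
    unfolding V_def I_def using gauge_v_eq_nn_integral[OF q, of "q r" R d D] gauge_inv_left[OF q, of r] gauge_pos[OF q, of r] that r2
    by auto
  have VG: "V r \<le> S * G r" if "0 < r" "r \<le> r2" for r
  proof -
    have "q r \<le> R"
      using gauge_mono[OF q, of r "gauge_inv q R"] gauge_inv_right[OF q, of R] that r2 R by auto
    then have "V r * (q r ^ D / r ^ d) \<le> S"
      using bound[of "q r"] gauge_pos[OF q, of r] gauge_inv_left[OF q, of r] that by (simp add: V_def gauge_g_def)
    then show ?thesis
      using gauge_pos[OF q, of r] that by (simp add: G_def field_simps)
  qed
  have IG: "I \<rho> = G \<rho> / \<rho>" if "0 < \<rho>" for \<rho>
    using that d unfolding I_def G_def by (cases d) auto
  have "0 < V r2"
  proof -
    define k where "k = r2 ^ (d - 1) / q R ^ D"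
    have k: "0 < k" using gauge_pos[OF q R] r2 by (simp add: k_def)
    have "ennreal (k * (R - r2)) = (\<integral>\<^sup>+\<rho>. ennreal k * indicator {r2..R} \<rho> \<partial>lborel)"
      using k r2 by (subst nn_integral_cmult_indicator) (auto simp: ennreal_mult)
    also have "\<dots> \<le> (\<integral>\<^sup>+\<rho>. ennreal (I \<rho>) * indicator {r2..R} \<rho> \<partial>lborel)"
    proof (intro nn_integral_mono)
      fix \<rho>
      show "ennreal k * indicator {r2..R} \<rho> \<le> ennreal (I \<rho>) * indicator {r2..R} \<rho>"
      proof (cases "\<rho> \<in> {r2..R}")
        case True
        then have "k \<le> I \<rho>"
          unfolding k_def I_def using r2 gauge_pos[OF q, of \<rho>] gauge_mono[OF q, of \<rho> R]
          by (intro frac_le power_mono) auto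
        then show ?thesis using True by (simp add: ennreal_leI)
      qed auto
    qed
    also have "\<dots> = ennreal (V r2)" using V[of r2] r2 by simp
    finally have "k * (R - r2) \<le> V r2" using V(2)[of r2] r2 by simp
    moreover have "0 < k * (R - r2)" using k r2 by simp
    ultimately show ?thesis by linarith
  qed
  define m where "m = V r2 / S"
  have m: "0 < m" using \<open>0 < V r2\<close> S by (simp add: m_def)
  have Gm: "m \<le> G r" if r: "0 < r" "r \<le> r2" for r
  proof -
    have "ennreal (V r2) \<le> ennreal (V r)"
      unfolding V(1)[OF r] V(1)[OF r2(1) order_refl] using r by (intro nn_integral_mono) (auto split: split_indicator)
    then have "V r2 \<le> V r" using V(2)[OF r] by simp
    also have "\<dots> \<le> S * G r" by (rule VG[OF r])
    finally show ?thesis using S by (simp add: m_def field_simps)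
  qed
  have log: "m / S * (ln r2 - ln r) \<le> G r" if r: "0 < r" "r \<le> r2" for r
  proof -
    have "ennreal (m * ln r2 - m * ln r) = (\<integral>\<^sup>+\<rho>. ennreal (m / \<rho>) * indicator {r..r2} \<rho> \<partial>lborel)"
      using r m by (intro nn_integral_FTC_Icc[symmetric]) (auto intro!: derivative_eq_intros)
    also have "\<dots> \<le> (\<integral>\<^sup>+\<rho>. ennreal (I \<rho>) * indicator {r..R} \<rho> \<partial>lborel)"
    proof (intro nn_integral_mono)
      fix \<rho>
      show "ennreal (m / \<rho>) * indicator {r..r2} \<rho> \<le> ennreal (I \<rho>) * indicator {r..R} \<rho>"
      proof (cases "\<rho> \<in> {r..r2}")
        case True
        then have "m / \<rho> \<le> I \<rho>" using Gm[of \<rho>] r by (subst IG) (auto intro!: divide_right_mono)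
        then show ?thesis using True r2 by (simp add: ennreal_leI)
      qed auto
    qed
    also have "\<dots> = ennreal (V r)" using V(1)[OF r] by simp
    finally have "m * ln r2 - m * ln r \<le> V r" using V(2)[OF r] by simp
    also have "\<dots> \<le> S * G r" by (rule VG[OF r])
    finally show ?thesis using S by (simp add: field_simps)
  qed
  have "filterlim (\<lambda>\<tau>. 1 / gauge_g q d D \<tau>) at_top (at_right 0)"
    unfolding filterlim_at_top
  proof
    fix B :: real
    \<comment> \<open>Chosen so that the logarithmic lower bound at \<open>r3\<close> is at least
      \<open>B\<close>.\<close>
    define r3 where "r3 = min r2 (r2 * exp (- (B * S / m)))"
    have r3: "0 < r3" "r3 \<le> r2" using r2 by (auto simp: r3_def)
    have "ln r3 \<le> ln (r2 * exp (- (B * S / m)))" using r3 r2 by (subst ln_le_cancel_iff) (auto simp: r3_def)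
    also have "\<dots> = ln r2 - B * S / m" using r2 by (simp add: ln_mult)
    finally have B: "B \<le> m / S * (ln r2 - ln r3)" using m S by (simp add: field_simps)
    have "\<forall>\<^sub>F \<tau> in at_right 0. \<tau> \<in> {0<..<q r3}"
      using gauge_pos[OF q r3(1)] by (rule eventually_at_right_real)
    then show "\<forall>\<^sub>F \<tau> in at_right 0. B \<le> 1 / gauge_g q d D \<tau>"
    proof eventually_elim
      case (elim \<tau>)
      define r where "r = gauge_inv q \<tau>"
      have r: "0 < r" "r \<le> r3" using elim gauge_inv_pos[OF q] gauge_inv_le_iff[OF q, of \<tau> r3] r3 by (auto simp: r_def)
      have "m / S * (ln r2 - ln r3) \<le> m / S * (ln r2 - ln r)"
        using m S r r3 by (intro mult_left_mono) auto
      also have "\<dots> \<le> G r" using r r3 by (intro log) auto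
      also have "G r = 1 / gauge_g q d D \<tau>"
        using elim gauge_inv_right[OF q, of \<tau>] by (simp add: G_def gauge_g_def r_def)
      finally show ?case using B by linarith
    qed
  qed
  then show ?thesis by (simp add: ennreal_tendsto_top_eq_at_top)
qed

text \<open>Split at \<open>r = gauge_inv q \<tau>\<close>, where the two bounds are equal. Below
  \<open>r\<close> the bound \<open>1 / \<tau>^D\<close> integrates to
  \<open>W / g_q(\<tau>)\<close>; above \<open>r\<close> the bound \<open>1 / q^D\<close> integrates
  to \<open>W d v_q(\<tau>)\<close>, at most \<open>W d S / g_q(\<tau>)\<close>. If
  \<open>r > R\<close>, the second part is empty.\<close>

lemma radial_kernel_bound:
  assumes q: "gauge_function q" and d: "0 < d" and \<tau>: "0 < \<tau>" and pos: "0 \<le> S" "0 \<le> W"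
    and bound: "gauge_inv q \<tau> \<le> R \<Longrightarrow> gauge_v q d D R \<tau> * gauge_g q d D \<tau> \<le> S"
  shows "(\<integral>\<^sup>+\<rho>. ennreal (min (1 / q (max 0 \<rho>) ^ D) (1 / \<tau> ^ D)) * (ennreal (W * (real d * \<rho> ^ (d - 1))) * indicator {0..R} \<rho>) \<partial>lborel)
    \<le> ennreal (W * (1 + d * S) / gauge_g q d D \<tau>)"
proof -
  define r where "r = gauge_inv q \<tau>"
  have r: "0 < r" "q r = \<tau>" using gauge_inv_pos[OF q] gauge_inv_right[OF q] \<tau> by (auto simp: r_def)
  note [measurable] = gauge_measurable(1)[OF q]
  define A where "A \<rho> = ennreal (W * (real d * \<rho> ^ (d - 1)) / \<tau> ^ D) * indicator {0..r} \<rho>" for \<rho>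
  define B where "B \<rho> = ennreal (W * d) * (ennreal (\<rho> ^ (d - 1) / q (max 0 \<rho>) ^ D) * indicator {r..R} \<rho>)" for \<rho>
  have [measurable]: "A \<in> borel_measurable borel" "B \<in> borel_measurable borel"
    unfolding A_def B_def by measurable
  have "(\<integral>\<^sup>+\<rho>. ennreal (min (1 / q (max 0 \<rho>) ^ D) (1 / \<tau> ^ D)) * (ennreal (W * (real d * \<rho> ^ (d - 1))) * indicator {0..R} \<rho>) \<partial>lborel) \<le> (\<integral>\<^sup>+\<rho>. A \<rho> + B \<rho> \<partial>lborel)"
  proof (intro nn_integral_mono)
    fix \<rho>
    show "ennreal (min (1 / q (max 0 \<rho>) ^ D) (1 / \<tau> ^ D)) * (ennreal (W * (real d * \<rho> ^ (d - 1))) * indicator {0..R} \<rho>) \<le> A \<rho> + B \<rho>"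
    proof (cases "\<rho> \<in> {0..R}")
      case True
      then have \<rho>: "0 \<le> \<rho>" "\<rho> \<le> R" by auto
      let ?m = "min (1 / q \<rho> ^ D) (1 / \<tau> ^ D)"
      have m0: "0 \<le> ?m" using gauge_nonneg[OF q \<rho>(1)] \<tau> by simp
      have L: "ennreal ?m * ennreal (W * (real d * \<rho> ^ (d - 1))) = ennreal (?m * (W * (real d * \<rho> ^ (d - 1))))"
        using m0 pos \<rho> by (intro ennreal_mult[symmetric]) auto
      have E: "ennreal (min (1 / q (max 0 \<rho>) ^ D) (1 / \<tau> ^ D)) * (ennreal (W * (real d * \<rho> ^ (d - 1))) * indicator {0..R} \<rho>)
          = ennreal (?m * (W * (real d * \<rho> ^ (d - 1))))"
        unfolding L[symmetric] using \<rho> by (simp add: max_def)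
      show ?thesis
      proof (cases "\<rho> \<le> r")
        case True
        have "?m * (W * (real d * \<rho> ^ (d - 1))) \<le> 1 / \<tau> ^ D * (W * (real d * \<rho> ^ (d - 1)))"
          using pos \<rho> by (intro mult_right_mono) auto
        then have "ennreal (?m * (W * (real d * \<rho> ^ (d - 1)))) \<le> A \<rho>"
          unfolding A_def using True \<rho> by (simp add: ennreal_leI)
        also have "\<dots> \<le> A \<rho> + B \<rho>" by simp
        finally show ?thesis unfolding E .
      next
        case False
        have "?m * (W * (real d * \<rho> ^ (d - 1))) \<le> 1 / q \<rho> ^ D * (W * (real d * \<rho> ^ (d - 1)))"
          using pos \<rho> by (intro mult_right_mono) auto
        then have "ennreal (?m * (W * (real d * \<rho> ^ (d - 1)))) \<le> ennreal (W * d * (\<rho> ^ (d - 1) / q \<rho> ^ D))"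
          by (intro ennreal_leI) (simp add: field_simps)
        also have "\<dots> = B \<rho>"
          unfolding B_def using False \<rho> pos gauge_nonneg[OF q \<rho>(1)] by (simp add: max_def ennreal_mult[symmetric])
        also have "\<dots> \<le> A \<rho> + B \<rho>" by simp
        finally show ?thesis unfolding E .
      qed
    qed auto
  qed
  also have "\<dots> = (\<integral>\<^sup>+\<rho>. A \<rho> \<partial>lborel) + (\<integral>\<^sup>+\<rho>. B \<rho> \<partial>lborel)"
    by (intro nn_integral_add) auto
  also have "(\<integral>\<^sup>+\<rho>. A \<rho> \<partial>lborel) = ennreal (W * r ^ d / \<tau> ^ D - W * 0 ^ d / \<tau> ^ D)"
    unfolding A_def using pos r \<tau>
    by (intro nn_integral_FTC_Icc) (auto intro!: derivative_eq_intros simp: divide_simps)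
  also have "W * r ^ d / \<tau> ^ D - W * 0 ^ d / \<tau> ^ D = W / gauge_g q d D \<tau>"
    using d by (simp add: gauge_g_def r_def zero_power)
  also have "(\<integral>\<^sup>+\<rho>. B \<rho> \<partial>lborel) \<le> ennreal (W * d * (S / gauge_g q d D \<tau>))"
  proof (cases "r \<le> R")
    case True
    have "(\<integral>\<^sup>+\<rho>. B \<rho> \<partial>lborel) = ennreal (W * d) * (\<integral>\<^sup>+\<rho>. ennreal (\<rho> ^ (d - 1) / q (max 0 \<rho>) ^ D) * indicator {r..R} \<rho> \<partial>lborel)"
      unfolding B_def by (intro nn_integral_cmult) measurable
    also have "(\<integral>\<^sup>+\<rho>. ennreal (\<rho> ^ (d - 1) / q (max 0 \<rho>) ^ D) * indicator {r..R} \<rho> \<partial>lborel) =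
        (\<integral>\<^sup>+\<rho>. ennreal (\<rho> ^ (d - 1) / q \<rho> ^ D) * indicator {r..R} \<rho> \<partial>lborel)"
      using r by (intro nn_integral_cong) (auto split: split_indicator simp: max_def)
    also have "\<dots> = ennreal (gauge_v q d D R \<tau>)"
      using gauge_v_eq_nn_integral(1)[OF q \<tau>, of R d D] True by (simp add: r_def)
    also have "\<dots> \<le> ennreal (S / gauge_g q d D \<tau>)"
      using bound True gauge_g_pos[OF q \<tau>, of d D] by (intro ennreal_leI) (simp add: r_def field_simps)
    also have "ennreal (W * d) * ennreal (S / gauge_g q d D \<tau>) = ennreal (W * d * (S / gauge_g q d D \<tau>))"
      using pos gauge_g_pos[OF q \<tau>, of d D] by (intro ennreal_mult[symmetric]) auto
    finally show ?thesis by (simp add: mult_left_mono)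
  next
    case False
    then have "(\<integral>\<^sup>+\<rho>. B \<rho> \<partial>lborel) = 0" unfolding B_def by simp
    then show ?thesis by simp
  qed
  also have "ennreal (W / gauge_g q d D \<tau>) + ennreal (W * d * (S / gauge_g q d D \<tau>)) = ennreal (W * (1 + d * S) / gauge_g q d D \<tau>)"
    using pos gauge_g_pos[OF q \<tau>, of d D] by (subst ennreal_plus[symmetric]) (auto simp: field_simps)
  finally show ?thesis by simp
qed

text \<open>Beyond \<open>\<tau> = R\<close> the value of \<open>v_q\<close> only decreases, and
  \<open>g_q\<close> exceeds \<open>g_q(R)\<close> by a factor of at most
  \<open>(\<tau> / R)^D\<close>, because \<open>gauge_inv q\<close> is increasing. Distances between
  target points are not limited by \<open>diam(K)\<close>, so this range does occur.\<close>

lemma gauge_bound_extend: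
  assumes q: "gauge_function q" and S: "0 < S" and R: "0 < R"
    and bound: "\<And>\<tau>. 0 < \<tau> \<Longrightarrow> \<tau> \<le> R \<Longrightarrow> gauge_v q d D R \<tau> * gauge_g q d D \<tau> \<le> S"
    and \<tau>: "0 < \<tau>" "\<tau> \<le> T" "gauge_inv q \<tau> \<le> R"
  shows "gauge_v q d D R \<tau> * gauge_g q d D \<tau> \<le> S * max 1 ((T / R) ^ D)"
proof (cases "\<tau> \<le> R")
  case True
  have "S * 1 \<le> S * max 1 ((T / R) ^ D)" using S by (intro mult_left_mono) auto
  then show ?thesis using bound[OF \<tau>(1) True] by linarith
next
  case False
  define r where "r = gauge_inv q \<tau>"
  define s where "s = gauge_inv q R"
  have s: "0 < s" "q s = R" using gauge_inv_pos[OF q R] gauge_inv_right[OF q, of R] R by (auto simp: s_def)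
  have r: "0 < r" "q r = \<tau>" using gauge_inv_pos[OF q \<tau>(1)] gauge_inv_right[OF q, of \<tau>] \<tau> by (auto simp: r_def)
  have "s \<le> r" unfolding s_def using gauge_inv_le_iff[OF q, of R r] R r False by simp
  have gR: "0 < gauge_g q d D R" and g\<tau>: "0 < gauge_g q d D \<tau>"
    using gauge_g_pos[OF q] R \<tau> by auto
  have "ennreal (gauge_v q d D R \<tau>) \<le> ennreal (gauge_v q d D R R)"
    using gauge_v_eq_nn_integral(1)[OF q \<tau>(1,3), of d D] gauge_v_eq_nn_integral(1)[OF q R, of R d D] \<open>s \<le> r\<close> \<tau>
    by (auto simp: r_def s_def intro!: nn_integral_mono split: split_indicator)
  then have "gauge_v q d D R \<tau> \<le> gauge_v q d D R R"
    using gauge_v_eq_nn_integral(2)[OF q R, of R d D] \<open>s \<le> r\<close> \<tau> by (simp add: r_def s_def)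
  also have "\<dots> \<le> S / gauge_g q d D R"
    using bound[OF R order_refl] gR by (simp add: field_simps)
  finally have "gauge_v q d D R \<tau> * gauge_g q d D \<tau> \<le> S / gauge_g q d D R * gauge_g q d D \<tau>"
    using g\<tau> by (intro mult_right_mono) auto
  also have "\<dots> = S * (gauge_g q d D \<tau> / gauge_g q d D R)" by simp
  also have "gauge_g q d D \<tau> / gauge_g q d D R = (\<tau> / R) ^ D * (s / r) ^ d"
    unfolding gauge_g_def r_def[symmetric] s_def[symmetric] by (simp add: power_divide)
  also have "(\<tau> / R) ^ D * (s / r) ^ d \<le> (T / R) ^ D * 1"
    using \<open>s \<le> r\<close> s r \<tau> R by (intro mult_mono power_mono power_le_one divide_right_mono) auto
  also have "\<dots> \<le> max 1 ((T / R) ^ D)" by simp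
  finally show ?thesis using S by simp
qed

lemma recip_gauge_kernel_measurable:
  assumes "gauge_function q"
  shows "(recip_gauge_kernel q d :: real ^ 'n \<Rightarrow> ennreal) \<in> borel_measurable borel"
proof -
  note [measurable] = gauge_measurable[OF assms]
  have "(recip_gauge_kernel q d :: real ^ 'n \<Rightarrow> ennreal) = (\<lambda>z. if z = 0 then Lim (at_right 0) (\<lambda>\<tau>. ennreal (1 / gauge_g q d CARD('n) \<tau>))
      else ennreal (1 / (norm z ^ CARD('n) / gauge_inv q (max 0 (norm z)) ^ d)))"
    by (auto simp: recip_gauge_kernel_def gauge_g_def fun_eq_iff max_def)
  also have "\<dots> \<in> borel_measurable borel" by measurable
  finally show ?thesis .
qed

text \<open>Up to a constant, a bound for the probability of being close to \<open>z\<close> at time \<open>x\<close> and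
  close to \<open>z'\<close> at time \<open>y\<close>, where \<open>\<tau> = |z - z'|\<close> and \<open>\<rho> = |x - y|\<close>. It is infinite in the
  degenerate cases, which are negligible.\<close>

definition two_point_kernel :: "(real \<Rightarrow> real) \<Rightarrow> nat \<Rightarrow> real \<Rightarrow> real \<Rightarrow> ennreal" where
  "two_point_kernel q D \<tau> \<rho> = (if \<tau> = 0 \<or> \<rho> = 0 then \<infinity> else ennreal (min (1 / q (max 0 \<rho>) ^ D) (1 / \<tau> ^ D)))"

lemma two_point_kernel_measurable:
  assumes "gauge_function q"
  shows "(\<lambda>p. two_point_kernel q D (fst p) (snd p)) \<in> borel_measurable (borel \<Otimes>\<^sub>M borel)"
proof -
  note [measurable] = gauge_measurable[OF assms]
  show ?thesis unfolding two_point_kernel_def by measurable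
qed

text \<open>At \<open>z = 0\<close> the right side is infinite by
  \<open>recip_gauge_tendsto_top\<close>. Otherwise \<open>y = x\<close> is a null set, and
  translation by \<open>x\<close> places \<open>K\<close> in a ball of radius \<open>R\<close>,
  which leaves a radial integral.\<close>

lemma two_point_kernel_integral:
  fixes K :: "(real ^ 'd) set" and z :: "real ^ 'n" and W S' :: real
  assumes q: "gauge_function q" and S: "0 < S" and R: "0 < R"
    and bound: "\<And>\<tau>. 0 < \<tau> \<Longrightarrow> \<tau> \<le> R \<Longrightarrow> gauge_v q CARD('d) CARD('n) R \<tau> * gauge_g q CARD('d) CARD('n) \<tau> \<le> S"
    and K: "K \<in> sets borel" "\<And>y. y \<in> K \<Longrightarrow> norm (x - y) \<le> R" and z: "norm z \<le> T"
  defines "W \<equiv> unit_ball_vol (real CARD('d))"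
  defines "S' \<equiv> S * max 1 ((T / R) ^ CARD('n))"
  shows "(\<integral>\<^sup>+y. two_point_kernel q CARD('n) (norm z) (norm (x - y)) * indicator K y \<partial>lborel)
    \<le> ennreal (W * (1 + CARD('d) * S')) * recip_gauge_kernel q CARD('d) z"
proof (cases "z = 0")
  case True
  have "Lim (at_right 0) (\<lambda>\<tau>. ennreal (1 / gauge_g q CARD('d) CARD('n) \<tau>)) = \<infinity>"
    using S R bound by (intro tendsto_Lim recip_gauge_tendsto_top[OF q, of S R]) auto
  moreover have "0 < W * (1 + CARD('d) * S')"
    using S unfolding W_def S'_def by (intro mult_pos_pos add_pos_nonneg) auto
  moreover define c where "c = ennreal (W * (1 + CARD('d) * S'))"
  ultimately have "c \<noteq> 0" "recip_gauge_kernel q CARD('d) z = \<infinity>"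
    using True by (simp_all add: ennreal_eq_0_iff recip_gauge_kernel_def)
  then show ?thesis unfolding c_def[symmetric] by (simp add: ennreal_mult_top)
next
  case False
  define \<tau> where "\<tau> = norm z"
  have \<tau>: "0 < \<tau>" "\<tau> \<le> T" using False z by (auto simp: \<tau>_def)
  note [measurable] = gauge_measurable(1)[OF q]
  define h where "h \<rho> = ennreal (min (1 / q (max 0 \<rho>) ^ CARD('n)) (1 / \<tau> ^ CARD('n)))" for \<rho>
  have h[measurable]: "h \<in> borel_measurable borel" unfolding h_def by measurable
  have [measurable]: "cball (0 :: real ^ 'd) R \<in> sets borel" by simp
  have W: "0 \<le> W" by (simp add: W_def)
  have S': "0 \<le> S'" using S by (simp add: S'_def)
  have "(\<integral>\<^sup>+y. two_point_kernel q CARD('n) (norm z) (norm (x - y)) * indicator K y \<partial>lborel) \<le>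
      (\<integral>\<^sup>+y. h (norm (- x + y)) * indicator (cball 0 R) (- x + y) \<partial>lborel)"
  proof (rule nn_integral_mono_AE)
    have "AE y in lborel. y \<noteq> x" by (rule AE_lborel_singleton)
    then show "AE y in lborel. two_point_kernel q CARD('n) (norm z) (norm (x - y)) * indicator K y \<le>
        h (norm (- x + y)) * indicator (cball 0 R) (- x + y)"
    proof eventually_elim
      case (elim y)
      have "norm (- x + y) = norm (x - y)" by (simp add: norm_minus_commute)
      then show ?case using elim K(2)[of y] False
        by (auto simp: two_point_kernel_def h_def \<tau>_def split: split_indicator)
    qed
  qed
  also have "\<dots> = (\<integral>\<^sup>+w. h (norm w) * indicator (cball 0 R) w \<partial>distr lborel borel ((+) (- x)))"
    by (subst nn_integral_distr) auto
  also have "\<dots> = (\<integral>\<^sup>+w. h (norm w) * indicator (cball (0 :: real ^ 'd) R) w \<partial>lborel)"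
    by (simp add: lborel_distr_plus)
  also have "\<dots> = (\<integral>\<^sup>+\<rho>. h \<rho> * (ennreal (W * (CARD('d) * \<rho> ^ (CARD('d) - 1))) * indicator {0..R} \<rho>) \<partial>lborel)"
    using nn_integral_radial[OF h, of R, where 'a="real ^ 'd"] R by (simp add: W_def)
  also have "\<dots> \<le> ennreal (W * (1 + CARD('d) * S') / gauge_g q CARD('d) CARD('n) \<tau>)"
    unfolding h_def
  proof (rule radial_kernel_bound[OF q _ \<tau>(1) S' W])
    assume "gauge_inv q \<tau> \<le> R"
    then show "gauge_v q CARD('d) CARD('n) R \<tau> * gauge_g q CARD('d) CARD('n) \<tau> \<le> S'"
      unfolding S'_def using S R bound \<tau> by (intro gauge_bound_extend[OF q]) auto
  qed simp
  also have "\<dots> = ennreal (W * (1 + CARD('d) * S')) * ennreal (1 / gauge_g q CARD('d) CARD('n) \<tau>)"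
    using W S' gauge_g_pos[OF q \<tau>(1), of "CARD('d)" "CARD('n)"] by (subst ennreal_mult[symmetric]) auto
  finally show ?thesis using False by (simp add: recip_gauge_kernel_def \<tau>_def)
qed

section \<open>The capacity bound\<close>

lemma norm_le_card_sup:
  fixes x :: "real ^ 'n" and e :: real
  assumes "\<And>j. \<bar>x $ j\<bar> \<le> e"
  shows "norm x \<le> CARD('n) * e"
proof -
  have "norm x \<le> (\<Sum>j\<in>UNIV. \<bar>x $ j\<bar>)" by (rule norm_le_l1_cart)
  also have "\<dots> \<le> (\<Sum>j\<in>(UNIV :: 'n set). e)" using assms by (intro sum_mono) auto
  finally show ?thesis by simp
qed

text \<open>\<open>second_moment\<close> is applied to \<open>\<mu>\<close> on \<open>A\<close>
  times Lebesgue measure on \<open>K\<close>. With \<open>e = \<epsilon>^D\<close>, the first moment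
  is at least \<open>cl e L / 2\<close> and the second at most \<open>Cu e^2 C2 L I\<close>; the
  powers of \<open>\<epsilon>\<close> cancel, so the bound survives the limit. Stating it as a
  product with \<open>I\<close> avoids dividing by the energy.\<close>

lemma (in prob_space) hitting_event_thickened_bound:
  fixes X :: "real ^ 'd \<Rightarrow> 'a \<Rightarrow> real ^ 'n" and \<kappa> :: "real ^ 'n \<Rightarrow> ennreal"
    and \<epsilon> cl Cu C2 L I :: real
  assumes X: "\<And>x. X x \<in> borel_measurable M"
    and cont: "\<And>\<omega>. \<omega> \<in> space M \<Longrightarrow> continuous_on UNIV (\<lambda>x. X x \<omega>)"
    and K: "compact K" "measure lborel K = L" "0 < L" and A: "compact A"
    and \<mu>: "prob_space \<mu>" "sets \<mu> = sets borel" "1 / 2 \<le> measure \<mu> A"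
    and \<epsilon>: "0 < \<epsilon>"
    and one: "\<And>x z. x \<in> K \<Longrightarrow> z \<in> A \<Longrightarrow> cl * \<epsilon> ^ CARD('n) \<le> prob {\<omega>\<in>space M. \<forall>j. \<bar>X x \<omega> $ j - z $ j\<bar> < \<epsilon>}"
    and two: "\<And>x y z z'. x \<in> K \<Longrightarrow> y \<in> K \<Longrightarrow> z \<in> A \<Longrightarrow> z' \<in> A \<Longrightarrow>
      ennreal (prob {\<omega>\<in>space M. \<forall>j. \<bar>X x \<omega> $ j - z $ j\<bar> < \<epsilon> \<and> \<bar>X y \<omega> $ j - z' $ j\<bar> < \<epsilon>}) \<le>
        ennreal (Cu * (\<epsilon> ^ CARD('n))\<^sup>2) * two_point_kernel q CARD('n) (norm (z - z')) (norm (x - y))"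
    and q: "gauge_function q"
    and ker: "\<And>x z z'. x \<in> K \<Longrightarrow> z \<in> A \<Longrightarrow> z' \<in> A \<Longrightarrow>
      (\<integral>\<^sup>+y. two_point_kernel q CARD('n) (norm (z - z')) (norm (x - y)) * indicator K y \<partial>lborel) \<le> ennreal C2 * \<kappa> (z - z')"
    and \<kappa>[measurable]: "\<kappa> \<in> borel_measurable borel"
    and I: "(\<integral>\<^sup>+p. \<kappa> (fst p - snd p) \<partial>(\<mu> \<Otimes>\<^sub>M \<mu>)) = ennreal I"
    and pos: "0 < cl" "0 < Cu" "0 < C2" "0 \<le> I"
  shows "cl\<^sup>2 * L / (4 * Cu * C2) \<le> prob (hitting_event M X K {y. infdist y A \<le> CARD('n) * \<epsilon>}) * I"
proof -
  define e where "e = \<epsilon> ^ CARD('n)"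
  have e: "0 < e" using \<epsilon> by (simp add: e_def)
  interpret \<mu>: prob_space \<mu> by fact
  interpret \<mu>\<mu>: pair_prob_space \<mu> \<mu> ..
  note [measurable_cong] = \<mu>(2)
  have [measurable]: "A \<in> sets borel" "K \<in> sets borel" using A K(1) by (auto intro: borel_compact)
  have KL: "emeasure lborel K = ennreal L"
    using K emeasure_compact_finite[OF K(1)] by (simp add: emeasure_eq_ennreal_measure less_top[symmetric])
  \<comment> \<open>Densities are used instead of subspaces, so that both measures keep the full
    Borel sigma-algebra.\<close>
  define N1 where "N1 = density \<mu> (indicator A)"
  define N2 where "N2 = density lborel (indicator K :: real ^ 'd \<Rightarrow> ennreal)"
  have s1[measurable_cong]: "sets N1 = sets borel" by (simp add: N1_def \<mu>(2))
  have s2[measurable_cong]: "sets N2 = sets borel" by (simp add: N2_def)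
  have sp1: "space N1 = UNIV" using sets_eq_imp_space_eq[OF s1] by simp
  have sp2: "space N2 = UNIV" using sets_eq_imp_space_eq[OF s2] by simp
  have n1: "(\<integral>\<^sup>+z. g z \<partial>N1) = (\<integral>\<^sup>+z. indicator A z * g z \<partial>\<mu>)" if "g \<in> borel_measurable borel" for g
    unfolding N1_def using that by (intro nn_integral_density) measurable
  have n2: "(\<integral>\<^sup>+x. g x \<partial>N2) = (\<integral>\<^sup>+x. indicator K x * g x \<partial>lborel)" if "g \<in> borel_measurable borel" for g
    unfolding N2_def using that by (intro nn_integral_density) measurable
  have e1: "emeasure N1 B = emeasure \<mu> (A \<inter> B)" if "B \<in> sets borel" for B
    unfolding N1_def using that by (subst emeasure_density) (auto simp: indicator_inter_arith[symmetric] \<mu>(2))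
  have e2: "emeasure N2 B = emeasure lborel (K \<inter> B)" if "B \<in> sets borel" for B
    unfolding N2_def using that by (subst emeasure_density) (auto simp: indicator_inter_arith[symmetric])
  interpret N1: finite_measure N1
    by standard (simp add: sp1 e1 \<mu>.emeasure_eq_measure)
  interpret N2: finite_measure N2
    by standard (simp add: sp2 e2 KL)
  interpret N12: pair_sigma_finite N1 N2 ..
  define \<nu> where "\<nu> = N1 \<Otimes>\<^sub>M N2"
  have s\<nu>[measurable_cong]: "sets \<nu> = sets (borel \<Otimes>\<^sub>M borel)"
    unfolding \<nu>_def by (intro sets_pair_measure_cong s1 s2)
  have joint[measurable]: "(\<lambda>p. X (snd p) (fst p)) \<in> borel_measurable (M \<Otimes>\<^sub>M borel)"
    by (rule borel_measurable_continuous_paths[OF X cont])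
  define H where "H = {w \<in> space (M \<Otimes>\<^sub>M \<nu>). fst (snd w) \<in> A \<and> snd (snd w) \<in> K \<and>
      (\<forall>j. \<bar>X (snd (snd w)) (fst w) $ j - fst (snd w) $ j\<bar> < \<epsilon>)}"
  have [measurable]: "(\<lambda>w. X (snd (snd w)) (fst w)) \<in> borel_measurable (M \<Otimes>\<^sub>M \<nu>)"
    using measurable_compose[OF _ joint, of "\<lambda>w. (fst w, snd (snd w))" "M \<Otimes>\<^sub>M \<nu>"] by simp
  have nth: "(\<lambda>v. v $ j) \<in> borel_measurable borel" for j :: 'n
    by (intro borel_measurable_continuous_onI continuous_intros)
  have [measurable]: "(\<lambda>w. X (snd (snd w)) (fst w) $ j) \<in> borel_measurable (M \<Otimes>\<^sub>M \<nu>)"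
    "(\<lambda>w. fst (snd w) $ j) \<in> borel_measurable (M \<Otimes>\<^sub>M \<nu>)" for j
    by (rule measurable_compose[OF _ nth], measurable)+
  have H[measurable]: "H \<in> sets (M \<Otimes>\<^sub>M \<nu>)" unfolding H_def by measurable
  have Hin: "(\<omega>, (z, x)) \<in> H \<longleftrightarrow> \<omega> \<in> space M \<and> z \<in> A \<and> x \<in> K \<and> (\<forall>j. \<bar>X x \<omega> $ j - z $ j\<bar> < \<epsilon>)" for \<omega> z x
    by (auto simp: H_def space_pair_measure \<nu>_def sp1 sp2)
  define U where "U = hitting_event M X K {y. infdist y A \<le> CARD('n) * \<epsilon>}"
  have U: "U \<in> sets M"
    unfolding U_def using cont
    by (intro hitting_event_closed_sets K X closed_Collect_le continuous_intros)
      (auto intro: continuous_on_subset)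
  \<comment> \<open>Coordinatewise closeness by \<open>\<epsilon>\<close> gives Euclidean distance
    at most \<open>D \<epsilon>\<close>, which explains the radius in \<open>U\<close>.\<close>
  have HU: "\<omega> \<in> U" if "(\<omega>, p) \<in> H" for \<omega> p
  proof -
    obtain z x where p: "p = (z, x)" by (cases p)
    have *: "\<omega> \<in> space M" "z \<in> A" "x \<in> K" "\<And>j. \<bar>X x \<omega> $ j - z $ j\<bar> < \<epsilon>" using that unfolding p Hin by auto
    have "infdist (X x \<omega>) A \<le> dist (X x \<omega>) z" using * by (intro infdist_le)
    also have "\<dots> \<le> CARD('n) * \<epsilon>"
      unfolding dist_norm using *(4) by (intro norm_le_card_sup) (simp add: less_imp_le)
    finally show ?thesis using * by (auto simp: U_def hitting_event_def)
  qed
  have "sigma_finite_measure \<nu>" unfolding \<nu>_def by (rule N12.sigma_finite_measure_axioms)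
  from second_moment[OF sigma_finite_measure_axioms this H U HU]
  have SM: "(\<integral>\<^sup>+p. emeasure M {\<omega>\<in>space M. (\<omega>, p) \<in> H} \<partial>\<nu>)\<^sup>2 \<le>
    emeasure M U * (\<integral>\<^sup>+p. \<integral>\<^sup>+p'. emeasure M {\<omega>\<in>space M. (\<omega>, p) \<in> H \<and> (\<omega>, p') \<in> H} \<partial>\<nu> \<partial>\<nu>)" .
  have first: "ennreal (cl * e * (1 / 2) * L) \<le> (\<integral>\<^sup>+p. emeasure M {\<omega>\<in>space M. (\<omega>, p) \<in> H} \<partial>\<nu>)"
  proof -
    have AK: "A \<times> K \<in> sets \<nu>" by measurable
    have "ennreal (cl * e * (1 / 2) * L) = ennreal (cl * e) * ennreal (1 / 2 * L)"
      using pos e K by (subst ennreal_mult[symmetric]) (auto simp: mult.assoc)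
    also have "ennreal (1 / 2 * L) = ennreal (1 / 2) * ennreal L"
      using K by (intro ennreal_mult) auto
    also have "ennreal (cl * e) * (ennreal (1 / 2) * ennreal L) \<le> ennreal (cl * e) * (emeasure N1 A * emeasure N2 K)"
    proof -
      have "emeasure N1 A = ennreal (measure \<mu> A)" "emeasure N2 K = ennreal L"
        by (simp_all add: e1 e2 KL \<mu>.emeasure_eq_measure)
      then show ?thesis
        using ennreal_leI[OF \<mu>(3)] by (intro mult_left_mono mult_mono) simp_all
    qed
    also have "emeasure N1 A * emeasure N2 K = emeasure \<nu> (A \<times> K)"
      unfolding \<nu>_def by (intro N2.emeasure_pair_measure_Times[symmetric]) (simp_all add: s1 s2)
    also have "ennreal (cl * e) * emeasure \<nu> (A \<times> K) = (\<integral>\<^sup>+p. ennreal (cl * e) * indicator (A \<times> K) p \<partial>\<nu>)"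
      by (rule nn_integral_cmult_indicator[OF AK, symmetric])
    also have "\<dots> \<le> (\<integral>\<^sup>+p. emeasure M {\<omega>\<in>space M. (\<omega>, p) \<in> H} \<partial>\<nu>)"
    proof (intro nn_integral_mono)
      fix p :: "(real ^ 'n) \<times> (real ^ 'd)"
      obtain z x where p: "p = (z, x)" by (cases p)
      show "ennreal (cl * e) * indicator (A \<times> K) p \<le> emeasure M {\<omega>\<in>space M. (\<omega>, p) \<in> H}"
      proof (cases "z \<in> A \<and> x \<in> K")
        case True
        then have "{\<omega>\<in>space M. (\<omega>, p) \<in> H} = {\<omega>\<in>space M. \<forall>j. \<bar>X x \<omega> $ j - z $ j\<bar> < \<epsilon>}"
          by (auto simp: p Hin)
        then show ?thesis using one[of x z] True by (simp add: p emeasure_eq_measure e_def ennreal_leI)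
      qed (auto simp: p)
    qed
    finally show ?thesis .
  qed
  have second: "(\<integral>\<^sup>+p. \<integral>\<^sup>+p'. emeasure M {\<omega>\<in>space M. (\<omega>, p) \<in> H \<and> (\<omega>, p') \<in> H} \<partial>\<nu> \<partial>\<nu>) \<le> ennreal (Cu * e\<^sup>2 * C2 * L * I)"
  proof -
    define J where "J z = (\<integral>\<^sup>+z'. \<kappa> (z - z') \<partial>\<mu>)" for z
    have J[measurable]: "J \<in> borel_measurable borel"
      unfolding J_def by measurable
    define c where "c = ennreal (Cu * e\<^sup>2)"
    note tpk = two_point_kernel_measurable[OF q, of "CARD('n)"]
    \<comment> \<open>With \<open>(z, x)\<close> fixed, integrating the two-point bound over
      \<open>y\<close> produces \<open>\<kappa> (z - z')\<close>, and integrating over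
      \<open>z'\<close> produces the potential \<open>J z\<close>. Passing from \<open>A\<close> to
      the whole space only enlarges the result.\<close>
    have inner: "(\<integral>\<^sup>+p'. emeasure M {\<omega>\<in>space M. (\<omega>, (z, x)) \<in> H \<and> (\<omega>, p') \<in> H} \<partial>\<nu>) \<le> c * (ennreal C2 * J z)" for z x
    proof (cases "z \<in> A \<and> x \<in> K")
      case False
      then have "{\<omega>\<in>space M. (\<omega>, (z, x)) \<in> H \<and> (\<omega>, p') \<in> H} = {}" for p' by (auto simp: Hin)
      then show ?thesis by (simp only: emeasure_empty nn_integral_const mult_zero_left zero_le)
    next
      case True
      define k where "k z' y = two_point_kernel q CARD('n) (norm (z - z')) (norm (x - y))" for z' and y :: "real ^ 'd"
      have k[measurable]: "(\<lambda>p. k (fst p) (snd p)) \<in> borel_measurable (borel \<Otimes>\<^sub>M borel)"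
        unfolding k_def using measurable_compose[OF _ tpk, of "\<lambda>p. (norm (z - fst p), norm (x - snd p))" "borel \<Otimes>\<^sub>M borel"]
        by simp
      have "(\<integral>\<^sup>+p'. emeasure M {\<omega>\<in>space M. (\<omega>, (z, x)) \<in> H \<and> (\<omega>, p') \<in> H} \<partial>\<nu>) \<le>
        (\<integral>\<^sup>+p'. c * (indicator A (fst p') * (indicator K (snd p') * k (fst p') (snd p'))) \<partial>\<nu>)"
      proof (intro nn_integral_mono)
        fix p' :: "(real ^ 'n) \<times> (real ^ 'd)"
        obtain z' y where p': "p' = (z', y)" by (cases p')
        show "emeasure M {\<omega>\<in>space M. (\<omega>, (z, x)) \<in> H \<and> (\<omega>, p') \<in> H} \<le>
          c * (indicator A (fst p') * (indicator K (snd p') * k (fst p') (snd p')))"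
        proof (cases "z' \<in> A \<and> y \<in> K")
          case False
          then have "{\<omega>\<in>space M. (\<omega>, (z, x)) \<in> H \<and> (\<omega>, p') \<in> H} = {}" by (auto simp: p' Hin)
          then show ?thesis by (simp only: emeasure_empty zero_le)
        next
          case T: True
          have "{\<omega>\<in>space M. (\<omega>, (z, x)) \<in> H \<and> (\<omega>, p') \<in> H} =
              {\<omega>\<in>space M. \<forall>j. \<bar>X x \<omega> $ j - z $ j\<bar> < \<epsilon> \<and> \<bar>X y \<omega> $ j - z' $ j\<bar> < \<epsilon>}"
            using T True by (auto simp: p' Hin)
          then show ?thesis using two[of x y z z'] T True
            by (simp add: p' emeasure_eq_measure c_def k_def e_def)
        qed
      qed
      also have "\<dots> = c * (\<integral>\<^sup>+p'. indicator A (fst p') * (indicator K (snd p') * k (fst p') (snd p')) \<partial>\<nu>)"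
        by (rule nn_integral_cmult) measurable
      also have "(\<integral>\<^sup>+p'. indicator A (fst p') * (indicator K (snd p') * k (fst p') (snd p')) \<partial>\<nu>) =
          (\<integral>\<^sup>+z'. \<integral>\<^sup>+y. indicator A z' * (indicator K y * k z' y) \<partial>N2 \<partial>N1)"
        unfolding \<nu>_def by (subst N2.nn_integral_fst[symmetric]) (auto simp: s1 s2 cong: measurable_cong_sets)
      also have "\<dots> \<le> (\<integral>\<^sup>+z'. ennreal C2 * (indicator A z' * \<kappa> (z - z')) \<partial>N1)"
      proof (intro nn_integral_mono)
        fix z'
        have k'[measurable]: "k z' \<in> borel_measurable borel"
          using measurable_compose[OF _ k, of "\<lambda>y. (z', y)" borel] by simp
        have "(\<integral>\<^sup>+y. indicator A z' * (indicator K y * k z' y) \<partial>N2) = (\<integral>\<^sup>+y. indicator K y * (indicator A z' * (indicator K y * k z' y)) \<partial>lborel)"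
          by (rule n2) measurable
        also have "\<dots> = (\<integral>\<^sup>+y. indicator A z' * (k z' y * indicator K y) \<partial>lborel)"
          by (intro nn_integral_cong) (auto split: split_indicator)
        also have "\<dots> \<le> ennreal C2 * (indicator A z' * \<kappa> (z - z'))"
          using ker[of x z z'] True by (auto simp: k_def split: split_indicator)
        finally show "(\<integral>\<^sup>+y. indicator A z' * (indicator K y * k z' y) \<partial>N2) \<le> ennreal C2 * (indicator A z' * \<kappa> (z - z'))" .
      qed
      also have "\<dots> = (\<integral>\<^sup>+z'. indicator A z' * (ennreal C2 * (indicator A z' * \<kappa> (z - z'))) \<partial>\<mu>)"
        by (rule n1) measurable
      also have "\<dots> \<le> (\<integral>\<^sup>+z'. ennreal C2 * \<kappa> (z - z') \<partial>\<mu>)"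
        by (intro nn_integral_mono) (auto split: split_indicator)
      also have "\<dots> = ennreal C2 * J z"
        unfolding J_def by (rule nn_integral_cmult) measurable
      finally show ?thesis by (simp add: mult_left_mono)
    qed
    have "(\<integral>\<^sup>+p. \<integral>\<^sup>+p'. emeasure M {\<omega>\<in>space M. (\<omega>, p) \<in> H \<and> (\<omega>, p') \<in> H} \<partial>\<nu> \<partial>\<nu>) \<le> (\<integral>\<^sup>+p. c * (ennreal C2 * J (fst p)) \<partial>\<nu>)"
    proof (intro nn_integral_mono)
      fix p :: "(real ^ 'n) \<times> (real ^ 'd)"
      show "(\<integral>\<^sup>+p'. emeasure M {\<omega>\<in>space M. (\<omega>, p) \<in> H \<and> (\<omega>, p') \<in> H} \<partial>\<nu>) \<le> c * (ennreal C2 * J (fst p))"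
        using inner[of "fst p" "snd p"] by simp
    qed
    also have "\<dots> = (\<integral>\<^sup>+z. \<integral>\<^sup>+x. c * (ennreal C2 * J z) \<partial>N2 \<partial>N1)"
      unfolding \<nu>_def by (subst N2.nn_integral_fst[symmetric]) (auto simp: s1 s2 cong: measurable_cong_sets)
    also have "\<dots> = (\<integral>\<^sup>+z. (c * ennreal C2 * ennreal L) * J z \<partial>N1)"
      by (simp add: sp2 e2 KL mult_ac)
    also have "\<dots> = (\<integral>\<^sup>+z. indicator A z * ((c * ennreal C2 * ennreal L) * J z) \<partial>\<mu>)"
      by (rule n1) measurable
    also have "\<dots> \<le> (\<integral>\<^sup>+z. (c * ennreal C2 * ennreal L) * J z \<partial>\<mu>)"
      by (intro nn_integral_mono) (auto split: split_indicator)
    also have "\<dots> = (c * ennreal C2 * ennreal L) * (\<integral>\<^sup>+z. J z \<partial>\<mu>)"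
      by (rule nn_integral_cmult) measurable
    also have "(\<integral>\<^sup>+z. J z \<partial>\<mu>) = ennreal I"
      unfolding I[symmetric] J_def by (subst \<mu>.nn_integral_fst[symmetric]) auto
    also have "c * ennreal C2 * ennreal L * ennreal I = ennreal (Cu * e\<^sup>2 * C2 * L * I)"
      using pos e K unfolding c_def by (simp add: ennreal_mult[symmetric])
    finally show ?thesis .
  qed
  have "ennreal ((cl * e * (1 / 2) * L)\<^sup>2) = (ennreal (cl * e * (1 / 2) * L))\<^sup>2"
    using pos e K by (simp add: ennreal_power)
  also have "\<dots> \<le> (\<integral>\<^sup>+p. emeasure M {\<omega>\<in>space M. (\<omega>, p) \<in> H} \<partial>\<nu>)\<^sup>2"
    using first by (rule power_mono) simp
  also have "\<dots> \<le> emeasure M U * ennreal (Cu * e\<^sup>2 * C2 * L * I)"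
    using SM second by (meson mult_left_mono order_trans zero_le)
  also have "\<dots> = ennreal (prob U * (Cu * e\<^sup>2 * C2 * L * I))"
    using pos e K by (simp add: emeasure_eq_measure ennreal_mult)
  finally have "(cl * e * (1 / 2) * L)\<^sup>2 \<le> prob U * (Cu * e\<^sup>2 * C2 * L * I)"
    using pos e K by (subst (asm) ennreal_le_iff) auto
  then have "(e\<^sup>2 * L) * (cl\<^sup>2 * L / 4) \<le> (e\<^sup>2 * L) * (prob U * I * (Cu * C2))"
    by (simp add: power2_eq_square mult_ac)
  moreover have "0 < e\<^sup>2 * L" using e K by simp
  ultimately have "cl\<^sup>2 * L / 4 \<le> prob U * I * (Cu * C2)"
    by (simp only: mult_le_cancel_left_pos)
  then have "cl\<^sup>2 * L / 4 / (Cu * C2) \<le> prob U * I"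
    using pos by (simp add: pos_divide_le_eq)
  then show ?thesis by (simp add: U_def mult.assoc)
qed

text \<open>The closed thickenings decrease to the compact set \<open>A\<close>, and by compactness
  of the path image their hitting events decrease to that of \<open>A\<close>.\<close>

lemma (in prob_space) hitting_event_thickened_limit:
  fixes X :: "real ^ 'd \<Rightarrow> 'a \<Rightarrow> real ^ 'n" and c I :: real
  assumes X: "\<And>x. X x \<in> borel_measurable M"
    and cont: "\<And>\<omega>. \<omega> \<in> space M \<Longrightarrow> continuous_on K (\<lambda>x. X x \<omega>)"
    and K: "compact K" and A: "compact A" "A \<noteq> {}"
    and bound: "\<And>\<epsilon> :: real. 0 < \<epsilon> \<Longrightarrow> \<epsilon> \<le> 1 \<Longrightarrow> c \<le> prob (hitting_event M X K {y. infdist y A \<le> CARD('n) * \<epsilon>}) * I"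
  shows "c \<le> prob (hitting_event M X K A) * I"
proof -
  define F where "F n = {y. infdist y A \<le> CARD('n) * inverse (real (Suc n))}" for n
  have F: "closed (F n)" for n
    unfolding F_def by (intro closed_Collect_le continuous_intros)
  have "decseq F"
  proof (rule antimonoI, rule subsetI)
    fix m n :: nat and y assume "m \<le> n" "y \<in> F n"
    then have "infdist y A \<le> CARD('n) * inverse (real (Suc n))" by (simp add: F_def)
    also have "\<dots> \<le> CARD('n) * inverse (real (Suc m))"
      using \<open>m \<le> n\<close> by (intro mult_left_mono le_imp_inverse_le) auto
    finally show "y \<in> F m" by (simp add: F_def)
  qed
  have "(\<Inter>n. F n) = A"
  proof (intro set_eqI iffI)
    fix y assume "y \<in> (\<Inter>n. F n)"
    then have le: "\<forall>n. infdist y A \<le> CARD('n) * inverse (real (Suc n))" by (auto simp: F_def)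
    have lim: "(\<lambda>n. CARD('n) * inverse (real (Suc n))) \<longlonglongrightarrow> real CARD('n) * 0"
      by (intro tendsto_intros LIMSEQ_inverse_real_of_nat)
    have "infdist y A \<le> real CARD('n) * 0"
      by (rule LIMSEQ_le_const[OF lim]) (use le in blast)
    then have "infdist y A \<le> 0" by simp
    then show "y \<in> A"
      using A compact_imp_closed[OF A(1)] infdist_nonneg[of y A] by (simp add: in_closed_iff_infdist_zero)
  qed (auto simp: F_def)
  then have hit: "hitting_event M X K A = (\<Inter>n. hitting_event M X K (F n))"
    using hitting_event_Inter_closed[OF K F \<open>decseq F\<close> cont] by simp
  have "(\<lambda>n. prob (hitting_event M X K (F n))) \<longlonglongrightarrow> prob (\<Inter>n. hitting_event M X K (F n))"
  proof (rule finite_Lim_measure_decseq)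
    show "range (\<lambda>n. hitting_event M X K (F n)) \<subseteq> sets M"
      using hitting_event_closed_sets[OF K F X cont] by auto
    show "decseq (\<lambda>n. hitting_event M X K (F n))"
      using \<open>decseq F\<close> unfolding decseq_def hitting_event_def by blast
  qed
  then have "(\<lambda>n. prob (hitting_event M X K (F n)) * I) \<longlonglongrightarrow> prob (hitting_event M X K A) * I"
    unfolding hit by (intro tendsto_intros)
  moreover have "c \<le> prob (hitting_event M X K (F n)) * I" for n
    unfolding F_def by (rule bound) (auto simp: field_simps)
  ultimately show ?thesis by (intro LIMSEQ_le_const) auto
qed

text \<open>Measures of infinite energy need no estimate. If \<open>p = 0\<close>, the bound
  excludes finite energies altogether and the capacity vanishes; otherwise every energy is at least
  \<open>C / p\<close>.\<close>

lemma Cap_le_ennreal: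
  assumes C: "0 < C" and p: "0 \<le> p"
    and bound: "\<And>\<mu> I. \<mu> \<in> prob_measures_on A \<Longrightarrow>
      (\<integral>\<^sup>+p. g (fst p - snd p) \<partial>(\<mu> \<Otimes>\<^sub>M \<mu>)) = ennreal I \<Longrightarrow> 0 \<le> I \<Longrightarrow> C \<le> p * I"
  shows "ennreal C * Cap g A \<le> ennreal p"
proof -
  define E where "E \<mu> = (\<integral>\<^sup>+p. g (fst p - snd p) \<partial>(\<mu> \<Otimes>\<^sub>M \<mu>))" for \<mu>
  show ?thesis
  proof (cases "p = 0")
    case True
    have "E \<mu> = \<infinity>" if "\<mu> \<in> prob_measures_on A" for \<mu>
      using bound[OF that] C True unfolding E_def[symmetric] by (cases "E \<mu>") auto
    then have "(INF \<mu>\<in>prob_measures_on A. E \<mu>) = \<infinity>" by (auto intro!: antisym INF_greatest)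
    then show ?thesis unfolding Cap_def E_def[symmetric] by simp
  next
    case False
    then have p: "0 < p" using p by simp
    have "ennreal (C / p) \<le> E \<mu>" if "\<mu> \<in> prob_measures_on A" for \<mu>
      using bound[OF that] p unfolding E_def[symmetric]
      by (cases "E \<mu>") (auto simp: pos_divide_le_eq mult.commute intro!: ennreal_leI)
    then have le: "ennreal (C / p) \<le> (INF \<mu>\<in>prob_measures_on A. E \<mu>)" by (rule INF_greatest)
    have inv: "inverse e \<le> ennreal (p / C)" if "ennreal (C / p) \<le> e" for e
    proof (cases e)
      case (real x)
      then have "C / p \<le> x" using that C p by simp
      moreover have "0 < C / p" using C p by simp
      ultimately have "0 < x" "inverse x \<le> inverse (C / p)" by (linarith, intro le_imp_inverse_le)
      then show ?thesis using real by (simp add: inverse_ennreal ennreal_leI)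
    qed simp
    have "Cap g A \<le> ennreal (p / C)"
      unfolding Cap_def E_def[symmetric] by (rule inv[OF le])
    then have "ennreal C * Cap g A \<le> ennreal C * ennreal (p / C)" by (rule mult_left_mono) simp
    also have "\<dots> = ennreal p" using C p by (simp add: ennreal_mult[symmetric])
    finally show ?thesis .
  qed
qed

text \<open>As \<open>Q\<close> tends to 0, \<open>(b' Q) powr (1 + \<eta>)\<close> is of smaller
  order than \<open>Q\<close>. The inequalities obtained are the smallness conditions of
  \<open>regression_bounds\<close>.\<close>

lemma small_scale:
  fixes a b b' c1 c3 \<eta> :: real
  assumes "0 < a" "0 < b" "0 < c1" "0 < c3" "0 < \<eta>" "0 < b'"
  obtains Q0 where "0 < Q0" "\<And>Q. 0 < Q \<Longrightarrow> Q \<le> Q0 \<Longrightarrow> (b * Q)\<^sup>2 \<le> c1 \<and> c3 * (b' * Q) powr (1 + \<eta>) \<le> sqrt c1 * a * Q"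
proof -
  have "((\<lambda>Q. (b * Q)\<^sup>2) \<longlongrightarrow> (b * 0)\<^sup>2) (at_right 0)"
    by (intro tendsto_intros)
  then have 1: "\<forall>\<^sub>F Q in at_right 0. (b * Q)\<^sup>2 < c1"
    using assms by (intro order_tendstoD) auto
  have "((\<lambda>Q. Q powr \<eta>) \<longlongrightarrow> 0) (at_right 0)"
    using assms(5) by (intro tendsto_zero_powrI[where b = \<eta>] tendsto_const tendsto_ident_at) (auto simp: eventually_at_filter)
  then have "((\<lambda>Q. c3 * (b' powr (1 + \<eta>) * Q powr \<eta>)) \<longlongrightarrow> c3 * (b' powr (1 + \<eta>) * 0)) (at_right 0)"
    by (intro tendsto_mult tendsto_const)
  then have 2: "\<forall>\<^sub>F Q in at_right 0. c3 * (b' powr (1 + \<eta>) * Q powr \<eta>) < sqrt c1 * a"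
    using assms by (intro order_tendstoD) auto
  obtain Q1 where Q1: "0 < Q1" "\<And>Q. 0 < Q \<Longrightarrow> Q < Q1 \<Longrightarrow> (b * Q)\<^sup>2 < c1 \<and> c3 * (b' powr (1 + \<eta>) * Q powr \<eta>) < sqrt c1 * a"
    using eventually_conj[OF 1 2] unfolding eventually_at_right_field by auto
  show thesis
  proof (rule that[of "Q1 / 2"])
    fix Q assume Q: "0 < Q" "Q \<le> Q1 / 2"
    have q: "(b * Q)\<^sup>2 < c1" "c3 * (b' powr (1 + \<eta>) * Q powr \<eta>) < sqrt c1 * a"
      using Q1(2)[of Q] Q Q1(1) by auto
    have "(b' * Q) powr (1 + \<eta>) = b' powr (1 + \<eta>) * Q powr (1 + \<eta>)"
      using Q powr_mult[of "b'" Q "1 + \<eta>"] assms(6) by simp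
    also have "Q powr (1 + \<eta>) = Q * Q powr \<eta>" using Q by (simp add: powr_add)
    finally have "c3 * (b' * Q) powr (1 + \<eta>) = c3 * (b' powr (1 + \<eta>) * Q powr \<eta>) * Q" by simp
    also have "\<dots> \<le> sqrt c1 * a * Q" using q Q by (intro mult_right_mono) auto
    finally show "(b * Q)\<^sup>2 \<le> c1 \<and> c3 * (b' * Q) powr (1 + \<eta>) \<le> sqrt c1 * a * Q" using q by simp
  qed (use Q1 in simp)
qed

text \<open>Finitely many balls of radius \<open>r\<close> cover \<open>K\<close>, and the pieces
  cannot all be null.\<close>

lemma compact_positive_measure_small_part:
  fixes K :: "'a::euclidean_space set"
  assumes K: "compact K" "0 < emeasure lborel K" and r: "0 < r"
  obtains x where "0 < emeasure lborel (K \<inter> cball x r)"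
proof -
  obtain F where F: "finite F" "K \<subseteq> (\<Union>x\<in>F. ball x r)"
    using K(1) r unfolding compact_eq_totally_bounded by meson
  have "\<exists>x. 0 < emeasure lborel (K \<inter> cball x r)"
  proof (rule ccontr)
    assume "\<not> ?thesis"
    then have "K \<inter> cball x r \<in> null_sets lborel" for x
      using K(1) by (intro null_setsI) (auto intro!: sets.Int borel_compact simp: not_less)
    then have "(\<Union>x\<in>F. K \<inter> cball x r) \<in> null_sets lborel"
      using F(1) by (intro null_sets_UN' countable_finite) auto
    moreover have "K \<subseteq> (\<Union>x\<in>F. K \<inter> cball x r)"
    proof
      fix y assume "y \<in> K"
      then obtain x where "x \<in> F" "y \<in> ball x r" using F(2) by blast
      then show "y \<in> (\<Union>x\<in>F. K \<inter> cball x r)"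
        using \<open>y \<in> K\<close> by (auto intro!: bexI[of _ x])
    qed
    ultimately have "emeasure lborel K \<le> 0"
      using emeasure_mono[of K "\<Union>x\<in>F. K \<inter> cball x r" lborel] by (auto simp: null_sets_def)
    then show False using K(2) by simp
  qed
  then show thesis using that by blast
qed

lemma diameter_pos_of_emeasure:
  fixes K :: "'a::euclidean_space set"
  assumes K: "compact K" "0 < emeasure lborel K"
  shows "0 < diameter K"
proof (rule ccontr)
  assume "\<not> ?thesis"
  then have "diameter K \<le> 0" by simp
  then have "dist x y \<le> 0" if "x \<in> K" "y \<in> K" for x y
    using diameter_bounded_bound[OF compact_imp_bounded[OF K(1)] that] by linarith
  then have "\<exists>x. K \<subseteq> {x}" by (metis dist_le_zero_iff singletonI subsetI)
  then obtain x where "K \<subseteq> {x}" by blast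
  then have "K = {} \<or> K = {x}" by auto
  then show False using K(2) by auto
qed

text \<open>The two terms of the minimum arise differently. Bounding every factor by
  \<open>E / S\<close> and using \<open>S \<ge> c q \<rho>\<close> gives the power of
  \<open>q \<rho>\<close>; using the refined bound for the coordinate with the largest difference
  gives the power of \<open>|z - z'|\<close>, and there \<open>S\<close> cancels.\<close>

lemma two_point_box:
  fixes p :: "'n::finite \<Rightarrow> real" and z z' :: "real ^ 'n"
  assumes p: "\<And>j. 0 \<le> p j" "\<And>j. p j \<le> E / S" "\<And>j. p j * \<bar>z $ j - z' $ j\<bar> ^ CARD('n) \<le> E / S * S ^ CARD('n)"
    and S: "c * q \<rho> \<le> S" and pos: "0 < c" "0 < q \<rho>" "0 < S" "0 \<le> E" "0 \<le> \<rho>"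
  shows "ennreal (prod p UNIV) \<le> ennreal ((E * max (1 / c) CARD('n)) ^ CARD('n)) * two_point_kernel q CARD('n) (norm (z - z')) \<rho>"
proof (cases "norm (z - z') = 0 \<or> \<rho> = 0 \<or> E = 0")
  case True
  show ?thesis
  proof (cases "E = 0")
    case E: True
    have "p j = 0" for j using p(1,2)[of j] by (simp add: E)
    then have "prod p UNIV = 0" by simp
    then show ?thesis by (simp only: ennreal_0 zero_le)
  next
    case False
    have "0 < (E * max (1 / c) CARD('n)) ^ CARD('n)"
      using False pos by (intro zero_less_power mult_pos_pos) (auto simp: less_max_iff_disj)
    moreover define m where "m = ennreal ((E * max (1 / c) CARD('n)) ^ CARD('n))"
    ultimately have "m \<noteq> 0" by (simp add: ennreal_eq_0_iff)
    moreover have "two_point_kernel q CARD('n) (norm (z - z')) \<rho> = \<infinity>" using True False by (auto simp: two_point_kernel_def)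
    ultimately show ?thesis unfolding m_def[symmetric] by (simp add: ennreal_mult_top)
  qed
next
  case False
  define D where "D = CARD('n)"
  define \<tau> where "\<tau> = norm (z - z')"
  \<comment> \<open>\<open>1 / c\<close> serves the bound in \<open>q \<rho>\<close>;
    \<open>D\<close> compares the Euclidean norm with the largest coordinate.\<close>
  define m where "m = max (1 / c) (real D)"
  have \<tau>: "0 < \<tau>" using False by (simp add: \<tau>_def)
  have prod: "0 \<le> prod p UNIV" using p(1) by (intro prod_nonneg) auto
  have "prod p UNIV \<le> (\<Prod>j\<in>(UNIV :: 'n set). E / S)" using p(1,2) by (intro prod_mono) auto
  also have "\<dots> = (E / S) ^ D" by (simp add: D_def)
  finally have "prod p UNIV * q \<rho> ^ D \<le> (E / S) ^ D * q \<rho> ^ D" using pos by (intro mult_right_mono) auto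
  also have "\<dots> = (E / S * q \<rho>) ^ D" by (rule power_mult_distrib[symmetric])
  also have "\<dots> \<le> (E * m) ^ D"
  proof (rule power_mono)
    have "q \<rho> / S \<le> 1 / c" using S pos by (simp add: field_simps)
    then have "E * (q \<rho> / S) \<le> E * m" using pos by (intro mult_left_mono) (auto simp: m_def)
    then show "E / S * q \<rho> \<le> E * m" by simp
  qed (use pos in auto)
  finally have 1: "prod p UNIV \<le> (E * m) ^ D * (1 / q \<rho> ^ D)"
    using pos by (simp add: field_simps)
  have "finite (range (\<lambda>j. \<bar>z $ j - z' $ j\<bar>))" by simp
  then have "Max (range (\<lambda>j. \<bar>z $ j - z' $ j\<bar>)) \<in> range (\<lambda>j. \<bar>z $ j - z' $ j\<bar>)" by (intro Max_in) auto
  then obtain j0 where j0: "Max (range (\<lambda>j. \<bar>z $ j - z' $ j\<bar>)) = \<bar>z $ j0 - z' $ j0\<bar>" by blast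
  define t where "t = \<bar>z $ j0 - z' $ j0\<bar>"
  have "\<bar>(z - z') $ j\<bar> \<le> t" for j
    unfolding t_def j0[symmetric] by (auto intro!: Max_ge)
  then have \<tau>t: "\<tau> \<le> D * t" unfolding \<tau>_def D_def by (rule norm_le_card_sup)
  have "prod p UNIV * t ^ D \<le> (E / S * S) ^ D"
    unfolding D_def by (rule prod_le_with_power[OF p(1,2)]) (use p(3) in \<open>auto simp: t_def\<close>)
  then have t: "prod p UNIV * t ^ D \<le> E ^ D" using pos by simp
  have "prod p UNIV * \<tau> ^ D \<le> prod p UNIV * (D * t) ^ D"
    using \<tau>t \<tau> prod by (intro mult_left_mono power_mono) auto
  also have "\<dots> = D ^ D * (prod p UNIV * t ^ D)" by (simp add: power_mult_distrib)
  also have "\<dots> \<le> D ^ D * E ^ D" using t by (intro mult_left_mono) auto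
  also have "\<dots> = (E * real D) ^ D" by (simp add: power_mult_distrib)
  also have "\<dots> \<le> (E * m) ^ D" using pos by (intro power_mono mult_left_mono) (auto simp: m_def)
  finally have 2: "prod p UNIV \<le> (E * m) ^ D * (1 / \<tau> ^ D)" using \<tau> by (simp add: field_simps)
  have "0 < m" using pos by (simp add: m_def less_max_iff_disj)
  have "prod p UNIV \<le> (E * m) ^ D * min (1 / q \<rho> ^ D) (1 / \<tau> ^ D)"
    using 1 2 by (simp add: min_def)
  then have "ennreal (prod p UNIV) \<le> ennreal ((E * m) ^ D * min (1 / q \<rho> ^ D) (1 / \<tau> ^ D))" by (rule ennreal_leI)
  also have "\<dots> = ennreal ((E * m) ^ D) * ennreal (min (1 / q \<rho> ^ D) (1 / \<tau> ^ D))"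
    using pos \<tau> \<open>0 < m\<close> by (intro ennreal_mult) auto
  finally show ?thesis
    using False pos by (simp add: two_point_kernel_def max_def D_def \<tau>_def m_def)
qed

text \<open>Component \<open>k\<close> is picked by the inner product with \<open>axis k 1\<close>.
  The points must differ because the defining sum runs over the set \<open>{x, y}\<close>, which
  would collapse otherwise.\<close>

lemma gaussian_process_linear:
  fixes X :: "'i \<Rightarrow> 'w \<Rightarrow> real ^ 'n"
  assumes "gaussian_process P X"
  shows "gaussian_var P (\<lambda>\<omega>. X x \<omega> $ k)"
    and "x \<noteq> y \<Longrightarrow> gaussian_var P (\<lambda>\<omega>. g * X x \<omega> $ k + h * X y \<omega> $ k)"
proof -
  have lin: "gaussian_var P (\<lambda>\<omega>. \<Sum>u\<in>F. (c u *\<^sub>R axis k 1) \<bullet> X u \<omega>)" if "finite F" for F c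
    using assms[unfolded gaussian_process_def, THEN conjunct2, rule_format, OF that, of "\<lambda>u. c u *\<^sub>R axis k 1"] .
  show "gaussian_var P (\<lambda>\<omega>. X x \<omega> $ k)"
    using lin[of "{x}" "\<lambda>_. 1"] by (simp add: inner_axis')
  assume "x \<noteq> y"
  then show "gaussian_var P (\<lambda>\<omega>. g * X x \<omega> $ k + h * X y \<omega> $ k)"
    using lin[of "{x, y}" "\<lambda>u. if u = x then g else h"] by (simp add: inner_axis')
qed

text \<open>Integrability of the vector is established first, since the Bochner integral of a
  non-integrable function is 0 by convention and need not respect coordinates.\<close>

lemma (in prob_space) gaussian_process_mean:
  fixes X :: "'i \<Rightarrow> 'a \<Rightarrow> real ^ 'n"
  assumes "gaussian_process M X"
  shows "(LINT \<omega>|M. X x \<omega>) $ k = expectation (\<lambda>\<omega>. X x \<omega> $ k)"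
proof -
  have "integrable M (\<lambda>\<omega>. \<Sum>j\<in>UNIV. \<bar>X x \<omega> $ j\<bar>)"
    using gaussian_var_integrable(1)[OF gaussian_process_linear(1)[OF assms]]
    by (intro Bochner_Integration.integrable_sum integrable_abs)
  then have "integrable M (X x)"
  proof (rule Bochner_Integration.integrable_bound)
    show "X x \<in> borel_measurable M" using assms by (simp add: gaussian_process_def)
    show "AE \<omega> in M. norm (X x \<omega>) \<le> norm (\<Sum>j\<in>UNIV. \<bar>X x \<omega> $ j\<bar>)"
      using norm_le_l1_cart by (intro AE_I2) (auto intro: order_trans[OF _ abs_ge_self])
  qed
  then show ?thesis
    by (rule integral_bounded_linear[OF bounded_linear_vec_nth, symmetric])
qed

text \<open>The hypothesis on increments uses centred norms, the one on variances uncentred norms.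
  Their squares differ by the squared difference of means, which the hypothesis on \<open>f\<close>
  controls.\<close>

lemma (in prob_space) L2norm_diff:
  assumes X: "integrable M X" "integrable M Y" and XY: "integrable M (\<lambda>\<omega>. (X \<omega> - Y \<omega>)\<^sup>2)"
  shows "(L2norm M (\<lambda>\<omega>. (X \<omega> - expectation X) - (Y \<omega> - expectation Y)))\<^sup>2 = var M (\<lambda>\<omega>. X \<omega> - Y \<omega>)"
    and "(L2norm M (\<lambda>\<omega>. X \<omega> - Y \<omega>))\<^sup>2 = var M (\<lambda>\<omega>. X \<omega> - Y \<omega>) + (expectation X - expectation Y)\<^sup>2"
proof -
  define m where "m = expectation X - expectation Y"
  have m: "expectation (\<lambda>\<omega>. X \<omega> - Y \<omega>) = m" using X by (simp add: m_def)
  have v: "var M (\<lambda>\<omega>. X \<omega> - Y \<omega>) = expectation (\<lambda>\<omega>. (X \<omega> - Y \<omega> - m)\<^sup>2)"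
    by (simp add: var_def m)
  have eq: "(X \<omega> - expectation X) - (Y \<omega> - expectation Y) = X \<omega> - Y \<omega> - m" for \<omega> by (simp add: m_def)
  show "(L2norm M (\<lambda>\<omega>. (X \<omega> - expectation X) - (Y \<omega> - expectation Y)))\<^sup>2 = var M (\<lambda>\<omega>. X \<omega> - Y \<omega>)"
    unfolding L2norm_def v eq by simp
  have "(X \<omega> - Y \<omega> - m)\<^sup>2 = (X \<omega> - Y \<omega>)\<^sup>2 - 2 * m * (X \<omega> - Y \<omega>) + m\<^sup>2" for \<omega>
    by (simp add: power2_eq_square algebra_simps)
  then have "var M (\<lambda>\<omega>. X \<omega> - Y \<omega>) = expectation (\<lambda>\<omega>. (X \<omega> - Y \<omega>)\<^sup>2) - 2 * m * expectation (\<lambda>\<omega>. X \<omega> - Y \<omega>) + m\<^sup>2"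
    unfolding v using X XY by (simp add: prob_space)
  then show "(L2norm M (\<lambda>\<omega>. X \<omega> - Y \<omega>))\<^sup>2 = var M (\<lambda>\<omega>. X \<omega> - Y \<omega>) + (expectation X - expectation Y)\<^sup>2"
    unfolding L2norm_def m by (simp add: power2_eq_square m_def[symmetric])
qed

theorem theorem3p4:
  fixes K :: "(real ^ 'd) set"
    and f :: "real ^ 'd \<Rightarrow> real ^ 'n"
    and q :: "real \<Rightarrow> real"
    and N c1 c2 c3 \<eta> C0 a b :: real
  assumes "compact K" and "0 < emeasure lborel K"
    and "0 < N" and "0 < c1" and "0 < c2" and "0 < \<eta>" and "0 < c3" and "0 < a" and "0 < b"
    and "gauge_function q"
    and "\<forall>x\<in>K. \<forall>y\<in>K. norm (f x - f y) \<le> C0 * q (norm (x - y))"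
    and "(SUP \<tau>\<in>{0<..diameter K}.
            ereal (gauge_v q CARD('d) CARD('n) (diameter K) \<tau> * gauge_g q CARD('d) CARD('n) \<tau>))
          \<in> {0<..<\<infinity>}"
  shows "\<exists>C>0. \<forall>(P :: 'w measure) (M :: real ^ 'd \<Rightarrow> 'w \<Rightarrow> real ^ 'n) (k :: 'n).
    prob_space P \<longrightarrow>
    gaussian_process P M \<longrightarrow>
    (\<forall>\<omega>\<in>space P. continuous_on UNIV (\<lambda>x. M x \<omega>)) \<longrightarrow>
    iid_components P M \<longrightarrow>
    (\<forall>x. f x = (LINT \<omega>|P. M x \<omega>)) \<longrightarrow>
    (\<forall>x\<in>K. c1 \<le> var P (\<lambda>\<omega>. M x \<omega> $ k) \<and> var P (\<lambda>\<omega>. M x \<omega> $ k) \<le> c2) \<longrightarrow>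
    (\<forall>x\<in>K. \<forall>y\<in>K. x \<noteq> y \<longrightarrow> corr P (\<lambda>\<omega>. M x \<omega> $ k) (\<lambda>\<omega>. M y \<omega> $ k) < 1) \<longrightarrow>
    (\<forall>x\<in>K. \<forall>y\<in>K. \<bar>var P (\<lambda>\<omega>. M x \<omega> $ k) - var P (\<lambda>\<omega>. M y \<omega> $ k)\<bar>
        \<le> c3 * L2norm P (\<lambda>\<omega>. M x \<omega> $ k - M y \<omega> $ k) powr (1 + \<eta>)) \<longrightarrow>
    (\<forall>x\<in>K. \<forall>y\<in>K.
        a * q (norm (x - y)) \<le> L2norm P (\<lambda>\<omega>. (M x \<omega> - f x) $ k - (M y \<omega> - f y) $ k) \<and>
        L2norm P (\<lambda>\<omega>. (M x \<omega> - f x) $ k - (M y \<omega> - f y) $ k) \<le> b * q (norm (x - y))) \<longrightarrow>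
    (\<forall>A. A \<in> sets borel \<longrightarrow> A \<subseteq> ball 0 N \<longrightarrow>
        ennreal C * Cap (recip_gauge_kernel q CARD('d)) A
          \<le> emeasure (completion P) (hitting_event P M K A))"
proof -
  note K = assms(1,2) and N = assms(3) and c1 = assms(4) and c2 = assms(5) and \<eta> = assms(6) and c3 = assms(7)
    and a = assms(8) and b = assms(9) and q = assms(10) and f = assms(11) and sup = assms(12)
  define R where "R = diameter K"
  have R: "0 < R" unfolding R_def by (rule diameter_pos_of_emeasure[OF K])
  have diam: "norm (x - y) \<le> R" if "x \<in> K" "y \<in> K" for x y
    using diameter_bounded_bound[OF compact_imp_bounded[OF K(1)] that] by (simp add: R_def dist_norm)
  obtain S where S: "0 < S"
    "\<And>\<tau>. 0 < \<tau> \<Longrightarrow> \<tau> \<le> R \<Longrightarrow> gauge_v q CARD('d) CARD('n) R \<tau> * gauge_g q CARD('d) CARD('n) \<tau> \<le> S"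
    using gauge_SUP_bound[OF sup] unfolding R_def by blast
  \<comment> \<open>The sign of \<open>C0\<close> is not prescribed, whereas the estimates use a
    nonnegative constant.\<close>
  define C' where "C' = \<bar>C0\<bar>"
  have C': "0 \<le> C'" by (simp add: C'_def)
  have fC': "norm (f x - f y) \<le> C' * q (norm (x - y))" if "x \<in> K" "y \<in> K" for x y
  proof -
    have "C0 * q (norm (x - y)) \<le> C' * q (norm (x - y))"
      unfolding C'_def using gauge_nonneg[OF q, of "norm (x - y)"] by (intro mult_right_mono) auto
    then show ?thesis using f that by force
  qed
  have bC': "0 < b + C'" using b C' by linarith
  obtain Q0 where Q0: "0 < Q0"
    "\<And>Q. 0 < Q \<Longrightarrow> Q \<le> Q0 \<Longrightarrow> (b * Q)\<^sup>2 \<le> c1 \<and> c3 * ((b + C') * Q) powr (1 + \<eta>) \<le> sqrt c1 * a * Q"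
    using small_scale[OF a b c1 c3 \<eta> bC'] by blast
  \<comment> \<open>Points of a ball of radius \<open>r0\<close> are at most
    \<open>gauge_inv q Q0\<close> apart, so \<open>q\<close> of their distance is at most
    \<open>Q0\<close>.\<close>
  define r0 where "r0 = gauge_inv q Q0 / 2"
  have r0: "0 < r0" using gauge_inv_pos[OF q Q0(1)] by (simp add: r0_def)
  obtain x0 where x0: "0 < emeasure lborel (K \<inter> cball x0 r0)"
    using compact_positive_measure_small_part[OF K r0] by blast
  define K' where "K' = K \<inter> cball x0 r0"
  have K': "compact K'" "K' \<subseteq> K" using K(1) by (auto simp: K'_def intro: compact_Int_closed)
  have qK': "q (norm (x - y)) \<le> Q0" if "x \<in> K'" "y \<in> K'" for x y
  proof -
    have "norm (x - y) \<le> norm (x - x0) + norm (x0 - y)"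
      using norm_triangle_ineq[of "x - x0" "x0 - y"] by simp
    then have "norm (x - y) \<le> gauge_inv q Q0"
      using that by (auto simp: K'_def r0_def dist_norm norm_minus_commute)
    then show ?thesis
      using gauge_mono[OF q norm_ge_zero, of "x - y" "gauge_inv q Q0"] gauge_inv_right[OF q, of Q0] Q0(1) by simp
  qed
  define l where "l = measure lborel K'"
  have l: "0 < l"
    using x0 emeasure_compact_finite[OF K'(1)] unfolding l_def K'_def[symmetric]
    by (simp add: emeasure_eq_ennreal_measure less_top)
  have "K' \<noteq> {}" using x0 unfolding K'_def[symmetric] by auto
  then obtain y0 where y0: "y0 \<in> K'" by blast
  \<comment> \<open>A common bound for the component means on \<open>K\<close>; through it the
    constant depends on \<open>f\<close>.\<close>
  define B where "B = norm (f y0) + C' * q R"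
  have B: "0 \<le> B" using C' gauge_nonneg[OF q, of R] R by (simp add: B_def)
  have fB: "\<bar>f x $ k\<bar> \<le> B" if "x \<in> K" for x k
  proof -
    have "\<bar>f x $ k\<bar> \<le> norm (f x)" by (rule component_le_norm_cart)
    also have "\<dots> \<le> norm (f y0) + norm (f x - f y0)" using norm_triangle_ineq[of "f y0" "f x - f y0"] by simp
    also have "norm (f x - f y0) \<le> C' * q (norm (x - y0))" using fC' that y0 K'(2) by auto
    also have "\<dots> \<le> C' * q R"
      using C' gauge_mono[OF q norm_ge_zero diam] that y0 K'(2) by (intro mult_left_mono) auto
    finally show ?thesis by (simp add: B_def)
  qed
  \<comment> \<open>The constants are dictated by \<open>two_point_estimate\<close>,
    \<open>two_point_box\<close>, \<open>one_point_estimate\<close> and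
    \<open>two_point_kernel_integral\<close>. They are fixed before the process appears, as the
    order of quantifiers demands.\<close>
  define c where "c = sqrt (c1 / (2 * c2)) * a"
  have c: "0 < c" using c1 c2 a by (simp add: c_def)
  define L where "L = C' + (a + b) / (2 * sqrt c1) * (N + B)"
  define H where "H = 3 * exp 1 / sqrt c1 * (fact CARD('n) * exp (L / c + 1 / 2))"
  have H: "0 < H" using c1 by (simp add: H_def)
  define Cu where "Cu = (H * max (1 / c) CARD('n)) ^ CARD('n)"
  have Cu: "0 < Cu" using H c by (simp add: Cu_def less_max_iff_disj)
  define h where "h = 2 / sqrt (2 * pi * c2) * exp (- (N + 1 + B)\<^sup>2 / (2 * c1))"
  have h: "0 < h" using c2 by (simp add: h_def)
  define cl where "cl = h ^ CARD('n)"
  have cl: "0 < cl" using h by (simp add: cl_def)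
  \<comment> \<open>Two points of the ball of radius \<open>N\<close> are at distance at most
    \<open>2 N\<close>, which takes the place of \<open>T\<close>.\<close>
  define C2 where "C2 = unit_ball_vol (real CARD('d)) * (1 + CARD('d) * (S * max 1 ((2 * N / R) ^ CARD('n))))"
  have C2: "0 < C2" using S(1) unfolding C2_def by (intro mult_pos_pos add_pos_nonneg) auto
  define C where "C = cl\<^sup>2 * l / (4 * Cu * C2)"
  have C: "0 < C" using cl l Cu C2 by (simp add: C_def)
  have main: "ennreal C * Cap (recip_gauge_kernel q CARD('d)) A \<le> emeasure (completion P) (hitting_event P M K A)"
    if "prob_space P" and gp: "gaussian_process P M" and cont: "\<forall>\<omega>\<in>space P. continuous_on UNIV (\<lambda>x. M x \<omega>)"
      and iid: "iid_components P M" and mean: "\<forall>x. f x = (LINT \<omega>|P. M x \<omega>)"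
      and var: "\<forall>x\<in>K. c1 \<le> var P (\<lambda>\<omega>. M x \<omega> $ k) \<and> var P (\<lambda>\<omega>. M x \<omega> $ k) \<le> c2"
      and var_diff: "\<forall>x\<in>K. \<forall>y\<in>K. \<bar>var P (\<lambda>\<omega>. M x \<omega> $ k) - var P (\<lambda>\<omega>. M y \<omega> $ k)\<bar>
        \<le> c3 * L2norm P (\<lambda>\<omega>. M x \<omega> $ k - M y \<omega> $ k) powr (1 + \<eta>)"
      and increments: "\<forall>x\<in>K. \<forall>y\<in>K.
        a * q (norm (x - y)) \<le> L2norm P (\<lambda>\<omega>. (M x \<omega> - f x) $ k - (M y \<omega> - f y) $ k) \<and>
        L2norm P (\<lambda>\<omega>. (M x \<omega> - f x) $ k - (M y \<omega> - f y) $ k) \<le> b * q (norm (x - y))"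
      and A: "A \<in> sets borel" "A \<subseteq> ball 0 N"
    for P :: "'w measure" and M :: "real ^ 'd \<Rightarrow> 'w \<Rightarrow> real ^ 'n" and k :: 'n and A
  proof -
    interpret prob_space P by fact
    have M: "M x \<in> borel_measurable P" for x using gp by (simp add: gaussian_process_def)
    have contK: "continuous_on T (\<lambda>x. M x \<omega>)" if "\<omega> \<in> space P" for \<omega> T
      using cont that by (auto intro: continuous_on_subset)
    have gauss: "gaussian_var P (\<lambda>\<omega>. M x \<omega> $ k)" for x by (rule gaussian_process_linear(1)[OF gp])
    note integr = gaussian_var_integrable[OF gauss]
    have Ef: "expectation (\<lambda>\<omega>. M x \<omega> $ k) = f x $ k" for x
      using gaussian_process_mean[OF gp, of x k] mean by simp
    have A_norm: "norm z \<le> N" if "z \<in> A" for z using A(2) that by auto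
    have A_comp: "\<bar>z $ j\<bar> \<le> N" if "z \<in> A" for z j
      using component_le_norm_cart[of z j] A_norm[OF that] by linarith
    have one: "cl * \<epsilon> ^ CARD('n) \<le> prob {\<omega>\<in>space P. \<forall>j. \<bar>M x \<omega> $ j - z $ j\<bar> < \<epsilon>}"
      if "x \<in> K'" "z \<in> A" "0 < \<epsilon>" "\<epsilon> \<le> 1" for x z \<epsilon>
    proof -
      have "h * \<epsilon> \<le> prob {\<omega>\<in>space P. \<bar>M x \<omega> $ k - z $ j\<bar> < \<epsilon>}" for j
        unfolding h_def using var that K'(2) c1 fB[of x k] A_comp Ef
        by (intro one_point_estimate[OF gauss]) auto
      then have "(\<Prod>j\<in>(UNIV :: 'n set). h * \<epsilon>) \<le> (\<Prod>j\<in>UNIV. prob {\<omega>\<in>space P. \<bar>M x \<omega> $ k - z $ j\<bar> < \<epsilon>})"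
        using h that by (intro prod_mono) auto
      also have "\<dots> = prob {\<omega>\<in>space P. \<forall>j. \<bar>M x \<omega> $ j - z $ j\<bar> < \<epsilon>}"
        using iid_components_two_point[OF iid, of x z \<epsilon> x z k] by simp
      finally show ?thesis by (simp add: cl_def power_mult_distrib)
    qed
    have two: "ennreal (prob {\<omega>\<in>space P. \<forall>j. \<bar>M x \<omega> $ j - z $ j\<bar> < \<epsilon> \<and> \<bar>M y \<omega> $ j - z' $ j\<bar> < \<epsilon>}) \<le>
        ennreal (Cu * (\<epsilon> ^ CARD('n))\<^sup>2) * two_point_kernel q CARD('n) (norm (z - z')) (norm (x - y))"
      if x: "x \<in> K'" "y \<in> K'" and z: "z \<in> A" "z' \<in> A" and \<epsilon>: "0 < \<epsilon>" "\<epsilon> \<le> 1" for x y z z' \<epsilon>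
    proof (cases "x = y")
      case True
      define m where "m = ennreal (Cu * (\<epsilon> ^ CARD('n))\<^sup>2)"
      have "m \<noteq> 0" using Cu \<epsilon> by (simp add: m_def ennreal_eq_0_iff not_le)
      then show ?thesis using True unfolding m_def[symmetric] by (simp add: two_point_kernel_def ennreal_mult_top)
    next
      case False
      define Q where "Q = q (norm (x - y))"
      have xK: "x \<in> K" "y \<in> K" using x K'(2) by auto
      have Q: "0 < Q" "Q \<le> Q0" using gauge_pos[OF q, of "norm (x - y)"] False qK'[OF x] by (auto simp: Q_def)
      let ?X = "\<lambda>\<omega>. M x \<omega> $ k" and ?Y = "\<lambda>\<omega>. M y \<omega> $ k"
      have lin: "gaussian_var P (\<lambda>\<omega>. g * ?X \<omega> + h * ?Y \<omega>)" for g h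
        by (rule gaussian_process_linear(2)[OF gp False])
      have XY: "integrable P (\<lambda>\<omega>. (?X \<omega> - ?Y \<omega>)\<^sup>2)"
        using gaussian_var_integrable(2)[OF lin[of 1 "-1"]] by simp
      note L2 = L2norm_diff[OF integr(1)[of x] integr(1)[of y] XY]
      let ?\<delta> = "var P (\<lambda>\<omega>. ?X \<omega> - ?Y \<omega>)"
      have L2c: "(L2norm P (\<lambda>\<omega>. (M x \<omega> - f x) $ k - (M y \<omega> - f y) $ k))\<^sup>2 = ?\<delta>"
        using L2(1) unfolding Ef by simp
      have inc: "a * Q \<le> L2norm P (\<lambda>\<omega>. (M x \<omega> - f x) $ k - (M y \<omega> - f y) $ k)"
        "L2norm P (\<lambda>\<omega>. (M x \<omega> - f x) $ k - (M y \<omega> - f y) $ k) \<le> b * Q"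
        using increments xK unfolding Q_def by auto
      have \<delta>: "(a * Q)\<^sup>2 \<le> ?\<delta>" "?\<delta> \<le> (b * Q)\<^sup>2"
      proof -
        have "0 \<le> L2norm P (\<lambda>\<omega>. (M x \<omega> - f x) $ k - (M y \<omega> - f y) $ k)" by (simp add: L2norm_def)
        then show "(a * Q)\<^sup>2 \<le> ?\<delta>" "?\<delta> \<le> (b * Q)\<^sup>2"
          unfolding L2c[symmetric] using inc a Q by (intro power_mono; simp)+
      qed
      have mdiff: "\<bar>f x $ k - f y $ k\<bar> \<le> C' * Q"
        using component_le_norm_cart[of "f x - f y" k] fC'[OF xK] by (simp add: Q_def)
      \<comment> \<open>The uncentred increment has norm at most \<open>(b + C') Q\<close>; for this
        reason \<open>small_scale\<close> was applied with \<open>b + C'\<close>.\<close>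
      have "(L2norm P (\<lambda>\<omega>. ?X \<omega> - ?Y \<omega>))\<^sup>2 \<le> (b * Q)\<^sup>2 + (C' * Q)\<^sup>2"
        unfolding L2(2) Ef using \<delta>(2) power_mono[OF mdiff, of 2] by simp
      also have "\<dots> \<le> ((b + C') * Q)\<^sup>2"
        using b C' Q by (simp add: power2_eq_square algebra_simps)
      finally have "L2norm P (\<lambda>\<omega>. ?X \<omega> - ?Y \<omega>) \<le> (b + C') * Q"
        by (rule power2_le_imp_le) (use bC' Q in simp)
      then have "c3 * L2norm P (\<lambda>\<omega>. ?X \<omega> - ?Y \<omega>) powr (1 + \<eta>) \<le> c3 * ((b + C') * Q) powr (1 + \<eta>)"
        using c3 \<eta> by (intro mult_left_mono powr_mono2) (auto simp: L2norm_def)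
      then have vdiff: "\<bar>var P ?X - var P ?Y\<bar> \<le> sqrt c1 * a * Q"
      proof -
        have "\<bar>var P ?X - var P ?Y\<bar> \<le> c3 * L2norm P (\<lambda>\<omega>. ?X \<omega> - ?Y \<omega>) powr (1 + \<eta>)"
          using var_diff xK by simp
        then show ?thesis using Q0(2)[OF Q] \<open>c3 * L2norm P _ powr _ \<le> _\<close> by linarith
      qed
      have "\<exists>S. c * Q \<le> S \<and> 0 < S \<and> (\<forall>z z'. \<bar>z\<bar> \<le> N \<longrightarrow>
        prob {\<omega>\<in>space P. \<bar>?X \<omega> - z\<bar> < \<epsilon> \<and> \<bar>?Y \<omega> - z'\<bar> < \<epsilon>} \<le> H * \<epsilon>\<^sup>2 / S \<and>
        prob {\<omega>\<in>space P. \<bar>?X \<omega> - z\<bar> < \<epsilon> \<and> \<bar>?Y \<omega> - z'\<bar> < \<epsilon>} * \<bar>z - z'\<bar> ^ CARD('n) \<le> H * \<epsilon>\<^sup>2 / S * S ^ CARD('n))"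
        unfolding c_def H_def L_def
        using var xK c1 a b Q \<epsilon> C' N B \<delta> Q0(2)[OF Q] vdiff mdiff fB[of x k] Ef
        by (intro two_point_estimate[OF lin]) auto
      then obtain s where *: "c * Q \<le> s \<and> 0 < s \<and> (\<forall>z z'. \<bar>z\<bar> \<le> N \<longrightarrow>
        prob {\<omega>\<in>space P. \<bar>?X \<omega> - z\<bar> < \<epsilon> \<and> \<bar>?Y \<omega> - z'\<bar> < \<epsilon>} \<le> H * \<epsilon>\<^sup>2 / s \<and>
        prob {\<omega>\<in>space P. \<bar>?X \<omega> - z\<bar> < \<epsilon> \<and> \<bar>?Y \<omega> - z'\<bar> < \<epsilon>} * \<bar>z - z'\<bar> ^ CARD('n) \<le> H * \<epsilon>\<^sup>2 / s * s ^ CARD('n))"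
        by (rule exE)
      note s = *[THEN conjunct1] *[THEN conjunct2, THEN conjunct1]
      note est = *[THEN conjunct2, THEN conjunct2, rule_format]
      have "ennreal (\<Prod>j\<in>UNIV. prob {\<omega>\<in>space P. \<bar>?X \<omega> - z $ j\<bar> < \<epsilon> \<and> \<bar>?Y \<omega> - z' $ j\<bar> < \<epsilon>}) \<le>
          ennreal ((H * \<epsilon>\<^sup>2 * max (1 / c) CARD('n)) ^ CARD('n)) * two_point_kernel q CARD('n) (norm (z - z')) (norm (x - y))"
      proof (rule two_point_box[of _ "H * \<epsilon>\<^sup>2" s z z' c])
        fix j
        show "prob {\<omega>\<in>space P. \<bar>?X \<omega> - z $ j\<bar> < \<epsilon> \<and> \<bar>?Y \<omega> - z' $ j\<bar> < \<epsilon>} \<le> H * \<epsilon>\<^sup>2 / s"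
          "prob {\<omega>\<in>space P. \<bar>?X \<omega> - z $ j\<bar> < \<epsilon> \<and> \<bar>?Y \<omega> - z' $ j\<bar> < \<epsilon>} * \<bar>z $ j - z' $ j\<bar> ^ CARD('n) \<le> H * \<epsilon>\<^sup>2 / s * s ^ CARD('n)"
          by (rule est[OF A_comp[OF z(1)], THEN conjunct1], rule est[OF A_comp[OF z(1)], THEN conjunct2])
        show "c * q (norm (x - y)) \<le> s" "0 < q (norm (x - y))" using s(1) Q(1) by (simp_all add: Q_def)
      qed (use s c H in simp_all)
      also have "(H * \<epsilon>\<^sup>2 * max (1 / c) CARD('n)) ^ CARD('n) = Cu * (\<epsilon> ^ CARD('n))\<^sup>2"
        by (simp add: Cu_def power_mult_distrib power_mult[symmetric] mult.commute)
      also have "(\<Prod>j\<in>UNIV. prob {\<omega>\<in>space P. \<bar>?X \<omega> - z $ j\<bar> < \<epsilon> \<and> \<bar>?Y \<omega> - z' $ j\<bar> < \<epsilon>}) =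
          prob {\<omega>\<in>space P. \<forall>j. \<bar>M x \<omega> $ j - z $ j\<bar> < \<epsilon> \<and> \<bar>M y \<omega> $ j - z' $ j\<bar> < \<epsilon>}"
        by (rule iid_components_two_point[OF iid, symmetric])
      finally show ?thesis .
    qed
    have hitK: "hitting_event P M K A \<in> sets (completion P)"
      using contK by (intro hitting_event_completion K M A) (auto intro: finite_measure_axioms)
    define p where "p = measure (completion P) (hitting_event P M K A)"
    have fin: "emeasure (completion P) (hitting_event P M K A) = ennreal p"
    proof -
      have "emeasure (completion P) (hitting_event P M K A) \<le> emeasure (completion P) (space (completion P))"
        by (rule emeasure_space)
      also have "\<dots> = 1" by (simp add: emeasure_space_1)
      finally have "emeasure (completion P) (hitting_event P M K A) \<noteq> \<top>" by (auto simp: top_unique)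
      then show ?thesis unfolding p_def by (rule emeasure_eq_ennreal_measure)
    qed
    have "ennreal C * Cap (recip_gauge_kernel q CARD('d)) A \<le> ennreal p"
    proof (rule Cap_le_ennreal[OF C])
      show "0 \<le> p" by (simp add: p_def)
      fix \<mu> I
      assume "\<mu> \<in> prob_measures_on A"
        and I: "(\<integral>\<^sup>+p. recip_gauge_kernel q CARD('d) (fst p - snd p) \<partial>(\<mu> \<Otimes>\<^sub>M \<mu>)) = ennreal I" "0 \<le> I"
      then have \<mu>: "prob_space \<mu>" "sets \<mu> = sets borel" "emeasure \<mu> A = 1"
        by (auto simp: prob_measures_on_def)
      interpret \<mu>: prob_space \<mu> by fact
      \<comment> \<open>The limit in \<open>\<epsilon>\<close> needs a compact target. Inner
        regularity provides one inside \<open>A\<close> that carries more than half of the mass,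
        independently of how \<open>\<mu>\<close> was chosen.\<close>
      have "(SUP T\<in>{T. T \<subseteq> A \<and> compact T}. emeasure \<mu> T) = 1"
        unfolding \<mu>(3)[symmetric] using A(1) \<mu> by (intro inner_regular[symmetric]) auto
      moreover have "ennreal (1 / 2) < 1"
        using ennreal_less_iff[of "1 / 2" 1] by simp
      ultimately have "ennreal (1 / 2) < (SUP T\<in>{T. T \<subseteq> A \<and> compact T}. emeasure \<mu> T)"
        by (simp only:)
      then obtain A' where A': "A' \<subseteq> A" "compact A'" "ennreal (1 / 2) < emeasure \<mu> A'"
        unfolding less_SUP_iff by auto
      have half: "1 / 2 \<le> measure \<mu> A'"
        using A'(3) by (simp add: \<mu>.emeasure_eq_measure ennreal_less_iff del: ennreal_half)
      have "A' \<noteq> {}" using A'(3) by auto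
      have "C \<le> prob (hitting_event P M K' A') * I"
      proof (rule hitting_event_thickened_limit[OF M contK K'(1) A'(2) \<open>A' \<noteq> {}\<close>])
        fix \<epsilon> :: real assume \<epsilon>: "0 < \<epsilon>" "\<epsilon> \<le> 1"
        show "C \<le> prob (hitting_event P M K' {y. infdist y A' \<le> CARD('n) * \<epsilon>}) * I"
          unfolding C_def
        proof (rule hitting_event_thickened_bound[OF M _ K'(1) l_def[symmetric] l A'(2) \<mu>(1,2) half \<epsilon>(1) _ _ q _
              recip_gauge_kernel_measurable[OF q] I(1) cl Cu C2 I(2)])
          show "continuous_on UNIV (\<lambda>x. M x \<omega>)" if "\<omega> \<in> space P" for \<omega> using contK[OF that] .
          show "cl * \<epsilon> ^ CARD('n) \<le> prob {\<omega>\<in>space P. \<forall>j. \<bar>M x \<omega> $ j - z $ j\<bar> < \<epsilon>}" if "x \<in> K'" "z \<in> A'" for x z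
            using one[of x z \<epsilon>] that A'(1) \<epsilon> by blast
          show "ennreal (prob {\<omega>\<in>space P. \<forall>j. \<bar>M x \<omega> $ j - z $ j\<bar> < \<epsilon> \<and> \<bar>M y \<omega> $ j - z' $ j\<bar> < \<epsilon>}) \<le>
              ennreal (Cu * (\<epsilon> ^ CARD('n))\<^sup>2) * two_point_kernel q CARD('n) (norm (z - z')) (norm (x - y))"
            if "x \<in> K'" "y \<in> K'" "z \<in> A'" "z' \<in> A'" for x y z z'
            using two[of x y z z' \<epsilon>] that A'(1) \<epsilon> by blast
          show "(\<integral>\<^sup>+y. two_point_kernel q CARD('n) (norm (z - z')) (norm (x - y)) * indicator K' y \<partial>lborel) \<le>
              ennreal C2 * recip_gauge_kernel q CARD('d) (z - z')" if "x \<in> K'" "z \<in> A'" "z' \<in> A'" for x z z'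
            unfolding C2_def
          proof (rule two_point_kernel_integral[OF q S(1) R S(2)])
            show "K' \<in> sets borel" using K'(1) by (rule borel_compact)
            show "norm (x - y) \<le> R" if "y \<in> K'" for y using diam[of x y] that \<open>x \<in> K'\<close> K'(2) by auto
            show "norm (z - z') \<le> 2 * N"
            proof -
              have "norm z \<le> N" "norm z' \<le> N" using A_norm that A'(1) by auto
              then show ?thesis using norm_triangle_ineq4[of z z'] by linarith
            qed
          qed
        qed
      qed
      also have "\<dots> \<le> p * I"
      \<comment> \<open>Enlarging \<open>K'\<close> to \<open>K\<close> and \<open>A'\<close> to
        \<open>A\<close> enlarges the event. The smaller event is measurable for \<open>P\<close>
        itself; the comparison takes place in the completion, where the larger one is known to be
        measurable.\<close>
      proof (intro mult_right_mono I(2))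
        have hit': "hitting_event P M K' A' \<in> sets P"
          by (intro hitting_event_closed_sets K'(1) compact_imp_closed A'(2) M contK)
        have "ennreal (prob (hitting_event P M K' A')) = emeasure (completion P) (hitting_event P M K' A')"
          using hit' by (simp add: emeasure_eq_measure emeasure_completion)
        also have "\<dots> \<le> emeasure (completion P) (hitting_event P M K A)"
          using K'(2) A'(1) hitK by (intro emeasure_mono) (auto simp: hitting_event_def)
        finally show "prob (hitting_event P M K' A') \<le> p"
          unfolding fin by (simp add: p_def)
      qed
      finally show "C \<le> p * I" .
    qed
    then show ?thesis by (simp add: fin)
  qed
  show ?thesis
    by (rule exI[of _ C], intro conjI C allI impI, rule main)
qed

end
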